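(* Let $\mathbb{K}\in\{\mathbb{R},\mathbb{C}\}$. For each integer $N\ge 2$ let $Y_1,\dots,Y_N,Y_1',\dots,Y_N'$ be independent $N\times N$ random matrices whose entries are all i.i.d. $\mathbb{K}$-valued Gaussian random variables of mean zero and $L_2$-norm equal to $N^{-1/2}$. Then there is an absolute constant $C$ (independent of $N$) such that, with probability tending to $1$ as $N\to\infty$, for all scalars $a_{ii'}\in\mathbb{K}$ $(1\le i,i'\le N)$ simultaneously $$\Big\|\sum_{i,i'=1}^N a_{ii'}\,Y_i\otimes Y'_{i'}\Big\|\le C(\log N)^{3/2}\Big(\sum_{i,i'=1}^N|a_{ii'}|^2\Big)^{1/2}.$$ Equivalently (in expectation form), let $(g_{i,k,l})_{1\le i,k,l\le N}$ be i.i.d. standard $\mathbb{K}$-valued Gaussian random variables (mean zero, $\mathbb{E}|g_{i,k,l}|^2=1$), let $(g'_{i,k,l})_{1\le i,k,l\le N}$ be an independent copy of this family, and let $$\mathcal{T}=\sum_{i,k,l,i',k',l'=1}^N g_{i,k,l}\,g'_{i',k',l'}\;e_{ii'}\otimes e_{kk'}\otimes e_{ll'}.$$ Then there is an absolute constant $C$ such that for all $N\ge2$ the norm $\|\mathcal{T}\|_\vee$ of $\mathcal{T}$ in the triple injective tensor product $\ell_2^{N^2}\stackrel{\vee}{\otimes}\ell_2^{N^2}\stackrel{\vee}{\otimes}\ell_2^{N^2}$ satisfies $$\mathbb{E}\|\mathcal{T}\|_\vee\le C(\log N)^{3/2}N.$$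
   Context: $\|\sum a_{ii'}Y_i\otimes Y'_{i'}\|$ is the operator norm of the $N^2\times N^2$ matrix acting on $\ell_2^N\otimes_2\ell_2^N$ (Hilbert space tensor product). $(e_{ij})_{1\le i,j\le N}$ is the canonical orthonormal basis of $\ell_2^{N^2}$, viewed as the space of $N\times N$ matrices over $\mathbb{K}$ with the Hilbert–Schmidt norm $\|\cdot\|_2$. The injective norm is explicitly $$\|\mathcal{T}\|_\vee=\sup\Big\{\Big|\sum g_{i,k,l}\,g'_{i',k',l'}R_{ii'}S_{kk'}T_{ll'}\Big|\Big\},$$ the supremum over all $N\times N$ matrices $R,S,T$ over $\mathbb{K}$ with $\|R\|_2,\|S\|_2,\|T\|_2\le1$. *)

theory Defs
  imports "HOL-Probability.Probability"
begin

text \<open>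
  Since the dimension \<open>N\<close> varies inside the statements, vectors, matrices and tensors are functions
  on explicit finite index sets, and only their values on these sets matter. The scalar field is a
  type \<open>'k\<close>, to be instantiated by \<open>real\<close> and by \<open>complex\<close>.
\<close>

definition l2_norm :: "'i set \<Rightarrow> ('i \<Rightarrow> 'k::real_normed_field) \<Rightarrow> real" where
  "l2_norm I x = L2_set (\<lambda>i. norm (x i)) I"

definition matrix_op_norm :: "'i set \<Rightarrow> ('i \<Rightarrow> 'i \<Rightarrow> 'k::real_normed_field) \<Rightarrow> real" where
  "matrix_op_norm I A =
     Sup {l2_norm I (\<lambda>p. \<Sum>q\<in>I. A p q * x q) | x. l2_norm I x \<le> 1}"

definition kron :: "('i \<Rightarrow> 'i \<Rightarrow> 'k::real_normed_field) \<Rightarrow> ('j \<Rightarrow> 'j \<Rightarrow> 'k) \<Rightarrow> 'i \<times> 'j \<Rightarrow> 'i \<times> 'j \<Rightarrow> 'k" where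
  "kron A B p q = A (fst p) (fst q) * B (snd p) (snd q)"

abbreviation sq :: "nat \<Rightarrow> (nat \<times> nat) set" where
  "sq N \<equiv> {1..N} \<times> {1..N}"

definition tensor_sum_norm ::
    "nat \<Rightarrow> (nat \<Rightarrow> nat \<Rightarrow> 'k::real_normed_field) \<Rightarrow> (nat \<Rightarrow> nat \<Rightarrow> nat \<Rightarrow> 'k) \<Rightarrow> (nat \<Rightarrow> nat \<Rightarrow> nat \<Rightarrow> 'k) \<Rightarrow> real" where
  "tensor_sum_norm N a Y Y' =
     matrix_op_norm (sq N) (\<lambda>p q. \<Sum>i=1..N. \<Sum>i'=1..N. a i i' * kron (Y i) (Y' i') p q)"

definition matrix_unit :: "nat \<Rightarrow> nat \<Rightarrow> nat \<times> nat \<Rightarrow> 'k::real_normed_field" where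
  "matrix_unit i j p = (if p = (i, j) then 1 else 0)"

text \<open>
  An element of the triple tensor product of \<open>\<ell>\<^sub>2\<^bsup>I\<^esup>\<close> with itself is represented by its coefficients in
  the product basis.
\<close>

definition elem_tensor ::
    "('i \<Rightarrow> 'k::real_normed_field) \<Rightarrow> ('i \<Rightarrow> 'k) \<Rightarrow> ('i \<Rightarrow> 'k) \<Rightarrow> 'i \<Rightarrow> 'i \<Rightarrow> 'i \<Rightarrow> 'k" where
  "elem_tensor u v w p q r = u p * v q * w r"

text \<open>
  The functionals in the unit ball of the dual of \<open>\<ell>\<^sub>2\<^bsup>I\<^esup>\<close> are given by the bilinear (not sesquilinear)
  pairing with the vectors of the unit ball of \<open>\<ell>\<^sub>2\<^bsup>I\<^esup>\<close>.
\<close>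

definition injective_norm :: "'i set \<Rightarrow> ('i \<Rightarrow> 'i \<Rightarrow> 'i \<Rightarrow> 'k::real_normed_field) \<Rightarrow> real" where
  "injective_norm I t =
     Sup {norm (\<Sum>p\<in>I. \<Sum>q\<in>I. \<Sum>r\<in>I. t p q r * R p * S q * T r) | R S T.
            l2_norm I R \<le> 1 \<and> l2_norm I S \<le> 1 \<and> l2_norm I T \<le> 1}"

definition product_tensor ::
    "nat \<Rightarrow> (nat \<Rightarrow> nat \<Rightarrow> nat \<Rightarrow> 'k::real_normed_field) \<Rightarrow> (nat \<Rightarrow> nat \<Rightarrow> nat \<Rightarrow> 'k) \<Rightarrow>
      nat \<times> nat \<Rightarrow> nat \<times> nat \<Rightarrow> nat \<times> nat \<Rightarrow> 'k" where
  "product_tensor N g g' p q r =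
     (\<Sum>i=1..N. \<Sum>k=1..N. \<Sum>l=1..N. \<Sum>i'=1..N. \<Sum>k'=1..N. \<Sum>l'=1..N.
        g i k l * g' i' k' l' *
        elem_tensor (matrix_unit i i') (matrix_unit k k') (matrix_unit l l') p q r)"

text \<open>
  The density of the centred Gaussian law on \<open>'k\<close> with \<open>L\<^sub>2\<close>-norm \<open>\<sigma>\<close>: the real coordinates are
  independent centred Gaussians of variance \<open>\<sigma>\<^sup>2 / d\<close>, where \<open>d\<close> is the real dimension of \<open>'k\<close>. For
  \<open>complex\<close> this is the usual circularly symmetric Gaussian, see \<open>gaussian_density_complex\<close> below.
\<close>

definition gaussian_density :: "real \<Rightarrow> 'k::euclidean_space \<Rightarrow> real" where
  "gaussian_density \<sigma> x = (\<Prod>b\<in>Basis. normal_density 0 (\<sigma> / sqrt (real DIM('k))) (x \<bullet> b))"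

lemma gaussian_density_real: "gaussian_density \<sigma> (x::real) = normal_density 0 \<sigma> x"
  by (simp add: gaussian_density_def)

lemma gaussian_density_complex:
  "gaussian_density \<sigma> (z::complex) =
     normal_density 0 (\<sigma> / sqrt 2) (Re z) * normal_density 0 (\<sigma> / sqrt 2) (Im z)"
  by (simp add: gaussian_density_def Basis_complex_def inner_complex_def)

text \<open>
  All the \<open>2 N\<^sup>3\<close> variables \<open>X\<^sub>i\<^sub>k\<^sub>l\<close>, \<open>X'\<^sub>i\<^sub>k\<^sub>l\<close> with \<open>1 \<le> i, k, l \<le> N\<close> are mutually independent, each with
  the centred Gaussian law of \<open>L\<^sub>2\<close>-norm \<open>\<sigma>\<close>. The two families are joined over a disjoint sum of two
  copies of the index set.
\<close>

definition iid_gaussian_pair ::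
    "'a measure \<Rightarrow> nat \<Rightarrow> real \<Rightarrow> (nat \<Rightarrow> nat \<Rightarrow> nat \<Rightarrow> 'a \<Rightarrow> 'k::euclidean_space) \<Rightarrow>
      (nat \<Rightarrow> nat \<Rightarrow> nat \<Rightarrow> 'a \<Rightarrow> 'k) \<Rightarrow> bool" where
  "iid_gaussian_pair M N \<sigma> X X' \<longleftrightarrow>
     prob_space.indep_vars M (\<lambda>_. borel)
       (case_sum (\<lambda>(i, k, l). X i k l) (\<lambda>(i, k, l). X' i k l))
       (({1..N} \<times> {1..N} \<times> {1..N}) <+> ({1..N} \<times> {1..N} \<times> {1..N})) \<and>
     (\<forall>i\<in>{1..N}. \<forall>k\<in>{1..N}. \<forall>l\<in>{1..N}.
        distributed M lborel (X i k l) (gaussian_density \<sigma>) \<and>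
        distributed M lborel (X' i k l) (gaussian_density \<sigma>))"

text \<open>
  The suprema above are over nonempty sets; the following facts show that these sets are also
  bounded, so that \<open>Sup\<close> has its intended meaning, and that the injective norm of the tensor is
  given by the explicit formula in terms of three matrices.
\<close>

lemma norm_le_l2_norm:
  assumes "finite I" "i \<in> I"
  shows "norm (x i) \<le> l2_norm I x"
  using member_le_L2_set[OF assms, of "\<lambda>i. norm (x i)"] by (simp add: l2_norm_def)

lemma bdd_above_matrix_op_norm:
  fixes A :: "'i \<Rightarrow> 'i \<Rightarrow> 'k::real_normed_field"
  assumes "finite I"
  shows "bdd_above {l2_norm I (\<lambda>p. \<Sum>q\<in>I. A p q * x q) | x. l2_norm I x \<le> 1}"
proof (rule bdd_aboveI)
  fix y assume "y \<in> {l2_norm I (\<lambda>p. \<Sum>q\<in>I. A p q * x q) | x. l2_norm I x \<le> 1}"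
  then obtain x where y: "y = l2_norm I (\<lambda>p. \<Sum>q\<in>I. A p q * x q)" and x: "l2_norm I x \<le> 1"
    by blast
  have x1: "norm (x q) \<le> 1" if "q \<in> I" for q
    using norm_le_l2_norm[OF assms that, of x] x by linarith
  have "y \<le> (\<Sum>p\<in>I. norm (\<Sum>q\<in>I. A p q * x q))"
    unfolding y l2_norm_def by (rule L2_set_le_sum) simp
  also have "\<dots> \<le> (\<Sum>p\<in>I. \<Sum>q\<in>I. norm (A p q))"
    by (intro sum_mono sum_norm_le) (simp add: norm_mult mult_left_le x1)
  finally show "y \<le> (\<Sum>p\<in>I. \<Sum>q\<in>I. norm (A p q))" .
qed

lemma bdd_above_injective_norm:
  fixes t :: "'i \<Rightarrow> 'i \<Rightarrow> 'i \<Rightarrow> 'k::real_normed_field"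
  assumes "finite I"
  shows "bdd_above {norm (\<Sum>p\<in>I. \<Sum>q\<in>I. \<Sum>r\<in>I. t p q r * R p * S q * T r) | R S T.
            l2_norm I R \<le> 1 \<and> l2_norm I S \<le> 1 \<and> l2_norm I T \<le> 1}"
proof (rule bdd_aboveI)
  fix y assume "y \<in> {norm (\<Sum>p\<in>I. \<Sum>q\<in>I. \<Sum>r\<in>I. t p q r * R p * S q * T r) | R S T.
            l2_norm I R \<le> 1 \<and> l2_norm I S \<le> 1 \<and> l2_norm I T \<le> 1}"
  then obtain R S T where y: "y = norm (\<Sum>p\<in>I. \<Sum>q\<in>I. \<Sum>r\<in>I. t p q r * R p * S q * T r)"
    and b: "l2_norm I R \<le> 1" "l2_norm I S \<le> 1" "l2_norm I T \<le> 1"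
    by blast
  have le1: "norm (x q) \<le> 1" if "q \<in> I" "l2_norm I x \<le> 1" for q and x :: "'i \<Rightarrow> 'k"
    using norm_le_l2_norm[OF assms that(1), of x] that(2) by linarith
  show "y \<le> (\<Sum>p\<in>I. \<Sum>q\<in>I. \<Sum>r\<in>I. norm (t p q r))"
    unfolding y
  proof (intro sum_norm_le)
    fix p q r assume "p \<in> I" "q \<in> I" "r \<in> I"
    then have "norm (R p) * norm (S q) * norm (T r) \<le> 1"
      by (intro mult_le_one mult_nonneg_nonneg norm_ge_zero le1 b)
    then show "norm (t p q r * R p * S q * T r) \<le> norm (t p q r)"
      using mult_left_le[of "norm (R p) * norm (S q) * norm (T r)" "norm (t p q r)"]
      by (simp add: norm_mult mult.assoc)
  qed
qed

lemma product_tensor_eq: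
  assumes "i \<in> {1..N}" "i' \<in> {1..N}" "k \<in> {1..N}" "k' \<in> {1..N}" "l \<in> {1..N}" "l' \<in> {1..N}"
  shows "product_tensor N g g' (i, i') (k, k') (l, l') = g i k l * g' i' k' l'"
proof -
  have pick: "(\<Sum>j=1..N. f j) = f m" if "m \<in> {1..N}" "\<And>j. j \<noteq> m \<Longrightarrow> f j = 0"
    for m :: nat and f :: "nat \<Rightarrow> 'a"
    using that sum.remove[of "{1..N}" m f] by simp
  show ?thesis
    unfolding product_tensor_def elem_tensor_def matrix_unit_def
    apply (rule trans[OF pick[OF assms(1)]], simp)
    apply (rule trans[OF pick[OF assms(3)]], simp)
    apply (rule trans[OF pick[OF assms(5)]], simp)
    apply (rule trans[OF pick[OF assms(2)]], simp)
    apply (rule trans[OF pick[OF assms(4)]], simp)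
    apply (rule trans[OF pick[OF assms(6)]], simp)
    by simp
qed

lemma injective_norm_product_tensor:
  "injective_norm (sq N) (product_tensor N g g') =
     Sup {norm (\<Sum>i=1..N. \<Sum>i'=1..N. \<Sum>k=1..N. \<Sum>k'=1..N. \<Sum>l=1..N. \<Sum>l'=1..N.
            g i k l * g' i' k' l' * R (i, i') * S (k, k') * T (l, l')) | R S T.
            l2_norm (sq N) R \<le> 1 \<and> l2_norm (sq N) S \<le> 1 \<and> l2_norm (sq N) T \<le> 1}"
proof -
  have sq: "(\<Sum>p\<in>sq N. f p) = (\<Sum>i=1..N. \<Sum>i'=1..N. f (i, i'))" for f :: "nat \<times> nat \<Rightarrow> 'a"
    by (simp add: sum.cartesian_product)
  have "(\<Sum>p\<in>sq N. \<Sum>q\<in>sq N. \<Sum>r\<in>sq N. product_tensor N g g' p q r * R p * S q * T r) =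
     (\<Sum>i=1..N. \<Sum>i'=1..N. \<Sum>k=1..N. \<Sum>k'=1..N. \<Sum>l=1..N. \<Sum>l'=1..N.
            g i k l * g' i' k' l' * R (i, i') * S (k, k') * T (l, l'))" for R S T
    unfolding sq by (intro sum.cong refl) (simp only: product_tensor_eq)
  then show ?thesis
    by (simp only: injective_norm_def)
qed

end

theory Submission
  imports Defs
begin

text \<open>
  Expanding all variables in real coordinates reduces the complex case to the real one. For real
  \<open>R\<close>, \<open>S\<close>, \<open>T\<close> in the Hilbert-Schmidt ball, grouping singular values into dyadic blocks writes each matrix as
  \<open>\<Sum>\<^sub>j c\<^sub>j 2\<^bsup>- j / 2\<^esup> A\<^sub>j B\<^sub>j\<close> with contractions \<open>A\<^sub>j\<close>, \<open>B\<^sub>j\<close> through dimension \<open>2\<^sup>j\<close> and \<open>\<Sum> c\<^sub>j\<^sup>2 = O (1)\<close>. There are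
  \<open>O (log N)\<close> blocks, so by Cauchy-Schwarz each matrix costs a factor \<open>(log N)\<^bsup>1/2\<^esup>\<close>, and it remains to bound the
  form by \<open>O (N)\<close> uniformly over a triple of blocks of ranks \<open>r \<ge> s, t\<close>.

  The net of all such triples has cardinality \<open>exp (O (N r))\<close>. For a fixed triple the form equals
  \<open>(r s t)\<^bsup>- 1/2\<^esup> \<langle>g, A B g'\<rangle>\<close> with contractions \<open>A\<close>, \<open>B\<close> through dimension \<open>D = r s t\<close>, and
  \<open>E exp (\<lambda> \<langle>g, A B g'\<rangle>) \<le> (1 - \<lambda>\<^sup>2)\<^bsup>- D / 2\<^esup>\<close>. This beats the net if \<open>r \<le> s t\<close>. If \<open>r > s t\<close>, then \<open>R\<close> is tested
  against a matrix of rank at most \<open>s t\<close>, and trace duality removes \<open>R\<close>.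
\<close>

section \<open>Contractions and singular values\<close>

text \<open>Both statements concern the one form <x, (R \<otimes> S \<otimes> T) x'>: the operator
  norm arises from it by duality with \<open>R = a\<close>, the injective norm by a supremum over
  all three matrices. Only the scale differs, and \<sigma>^2 = 1 / N turns the factor N into a
  constant.

  The obstacle is that a net of a whole Hilbert-Schmidt ball has exp(O(N^2)) points, while a chaos
  has exponential moments only below the inverse of its operator norm. Flat blocks balance the two:
  a normalized flat matrix of rank r has operator norm r^(-1/2), and its factors have only N r
  entries. To beat exp(O(N r)) net points at deviation of order N, the exponent must be of order r;
  it is admissible up to order (r s t)^(1/2), which is the condition r \<le> s t. The log moment is
  then of order r^2, which N r absorbs because r \<le> 2 N.

  All estimates hold pointwise up to a nonnegative random error of small mean, uniformly in R, S, T.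
  This one form of the bound serves both the probability and the expectation.\<close>

definition bil :: "'i set \<Rightarrow> 'j set \<Rightarrow> ('i \<Rightarrow> 'j \<Rightarrow> real) \<Rightarrow> ('i \<Rightarrow> real) \<Rightarrow> ('j \<Rightarrow> real) \<Rightarrow> real" where
  "bil I J A x y = (\<Sum>i\<in>I. \<Sum>j\<in>J. A i j * x i * y j)"

text \<open>Operator norm at most one, phrased through the bilinear form: this is symmetric in the
  two index sets and visibly a closed, convex and symmetric condition on the entries, as the nets
  require.\<close>

definition contraction :: "'i set \<Rightarrow> 'j set \<Rightarrow> ('i \<Rightarrow> 'j \<Rightarrow> real) \<Rightarrow> bool" where
  "contraction I J A \<longleftrightarrow> (\<forall>x y. \<bar>bil I J A x y\<bar> \<le> L2_set x I * L2_set y J)"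

text \<open>Rectangular Kronecker product. Nested to the right it gives matrices indexed by triples,
  and the two sides of a rank factorization can be tensored separately.\<close>

definition tensor ::
    "('i \<Rightarrow> 'j \<Rightarrow> 'k::times) \<Rightarrow> ('l \<Rightarrow> 'm \<Rightarrow> 'k) \<Rightarrow> 'i \<times> 'l \<Rightarrow> 'j \<times> 'm \<Rightarrow> 'k" where
  "tensor A B p q = A (fst p) (fst q) * B (snd p) (snd q)"

lemma L2_set_square: "(L2_set x I)\<^sup>2 = (\<Sum>i\<in>I. (x i)\<^sup>2)"
  by (simp add: L2_set_def sum_nonneg)

lemma L2_set_scale: "L2_set (\<lambda>i. c * x i) I = \<bar>c\<bar> * L2_set x I"
  by (simp add: L2_set_def power_mult_distrib real_sqrt_mult flip: sum_distrib_left)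

lemma L2_set_abs: "L2_set (\<lambda>i. \<bar>x i\<bar>) I = L2_set x I"
  by (simp add: L2_set_def)

lemma abs_sum_mult_le_L2_set: "\<bar>\<Sum>i\<in>I. x i * y i\<bar> \<le> L2_set x I * L2_set y I"
  using sum_abs[of "\<lambda>i. x i * y i" I] L2_set_mult_ineq[of x y I] by (simp add: abs_mult)

lemma bil_flip: "bil J I (\<lambda>j i. A i j) y x = bil I J A x y"
  unfolding bil_def by (subst sum.swap) (simp add: mult_ac)

lemma bil_left: "bil I J A x y = (\<Sum>i\<in>I. x i * (\<Sum>j\<in>J. A i j * y j))"
  by (simp add: bil_def sum_distrib_left mult_ac)

lemma bil_right: "bil I J A x y = (\<Sum>j\<in>J. y j * (\<Sum>i\<in>I. A i j * x i))"
  unfolding bil_def by (subst sum.swap) (simp add: sum_distrib_left mult_ac)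

lemma bil_scale_left: "bil I J A (\<lambda>i. c * x i) y = c * bil I J A x y"
  by (simp add: bil_def sum_distrib_left mult_ac)

lemma bil_scale_right: "bil I J A x (\<lambda>i. c * y i) = c * bil I J A x y"
  by (simp add: bil_def sum_distrib_left mult_ac)

lemma bil_scale: "bil I J (\<lambda>i j. c * A i j) x y = c * bil I J A x y"
  by (simp add: bil_def sum_distrib_left mult_ac)

lemma bil_diff: "bil I J (\<lambda>i j. A i j - B i j) x y = bil I J A x y - bil I J B x y"
  by (simp add: bil_def left_diff_distrib sum_subtractf)

lemma bil_rank_one:
  "bil I J (\<lambda>i j. c * u i * v j) x y = c * (\<Sum>i\<in>I. u i * x i) * (\<Sum>j\<in>J. v j * y j)"
  by (simp add: bil_def sum_distrib_left sum_distrib_right mult_ac)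

text \<open>Test the form against its own image \<open>?z\<close>: it becomes the squared norm of
  \<open>?z\<close>, and one factor cancels.\<close>

lemma op_bound_apply:
  assumes "\<And>x y. \<bar>bil I J A x y\<bar> \<le> c * L2_set x I * L2_set y J" "0 \<le> c"
  shows "L2_set (\<lambda>i. \<Sum>j\<in>J. A i j * y j) I \<le> c * L2_set y J"
proof -
  let ?z = "\<lambda>i. \<Sum>j\<in>J. A i j * y j"
  have "L2_set ?z I * L2_set ?z I = bil I J A ?z y"
    by (simp add: bil_left power2_eq_square[symmetric] L2_set_square)
  also have "\<dots> \<le> L2_set ?z I * (c * L2_set y J)"
    using assms(1)[of ?z y] by (simp add: mult_ac)
  finally have *: "L2_set ?z I * L2_set ?z I \<le> L2_set ?z I * (c * L2_set y J)" .
  show ?thesis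
  proof (cases "L2_set ?z I = 0")
    case False
    then have "0 < L2_set ?z I"
      using L2_set_nonneg[of ?z I] by linarith
    with * show ?thesis by simp
  qed (use assms(2) in simp)
qed

lemma contraction_apply:
  assumes "contraction I J A"
  shows "L2_set (\<lambda>i. \<Sum>j\<in>J. A i j * y j) I \<le> L2_set y J"
  using op_bound_apply[of I J A 1 y] assms by (simp add: contraction_def)

lemma contractionI:
  assumes "\<And>y. L2_set (\<lambda>i. \<Sum>j\<in>J. A i j * y j) I \<le> L2_set y J"
  shows "contraction I J A"
  unfolding contraction_def
proof (intro allI)
  fix x y
  have "\<bar>bil I J A x y\<bar> \<le> L2_set x I * L2_set (\<lambda>i. \<Sum>j\<in>J. A i j * y j) I"
    unfolding bil_left by (rule abs_sum_mult_le_L2_set)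
  also have "\<dots> \<le> L2_set x I * L2_set y J"
    by (intro mult_left_mono assms L2_set_nonneg)
  finally show "\<bar>bil I J A x y\<bar> \<le> L2_set x I * L2_set y J" .
qed

lemma contraction_flip: "contraction J I (\<lambda>j i. A i j) \<longleftrightarrow> contraction I J A"
  unfolding contraction_def bil_flip[of J I A] by (metis mult.commute)

lemma contraction_cong:
  assumes "\<And>i j. i \<in> I \<Longrightarrow> j \<in> J \<Longrightarrow> A i j = B i j"
  shows "contraction I J A \<longleftrightarrow> contraction I J B"
proof -
  have "bil I J A x y = bil I J B x y" for x y
    unfolding bil_def by (intro sum.cong refl) (simp add: assms)
  then show ?thesis by (simp add: contraction_def)
qed

lemma contraction_entry:
  assumes "contraction I J A" "finite I" "finite J" "i \<in> I" "j \<in> J"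
  shows "\<bar>A i j\<bar> \<le> 1"
proof -
  let ?x = "\<lambda>k. if k = i then 1 else 0 :: real" and ?y = "\<lambda>k. if k = j then 1 else 0 :: real"
  have "bil I J A ?x ?y = A i j"
    unfolding bil_def using assms(2-)
    by (simp add: if_distrib[of "\<lambda>z. _ * z"] cong: if_cong)
  moreover have "L2_set ?x I = 1" "L2_set ?y J = 1"
    unfolding L2_set_def using assms(2-) by (simp_all add: if_distrib[of "\<lambda>z. z\<^sup>2"] cong: if_cong)
  ultimately show ?thesis
    using assms(1) unfolding contraction_def by (metis mult_1)
qed

abbreviation id_mat :: "'i \<Rightarrow> 'i \<Rightarrow> real" where
  "id_mat \<equiv> \<lambda>i j. if i = j then 1 else 0"

lemma contraction_identity: "contraction I I id_mat"
proof (cases "finite I")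
  case True
  show ?thesis
  proof (rule contractionI)
    fix y :: "'a \<Rightarrow> real"
    have "(\<Sum>j\<in>I. (if i = j then 1 else 0) * y j) = y i" if "i \<in> I" for i
      using True that by (simp add: if_distrib[of "\<lambda>z. z * _"] cong: if_cong)
    then show "L2_set (\<lambda>i. \<Sum>j\<in>I. (if i = j then 1 else 0) * y j) I \<le> L2_set y I"
      by (simp cong: L2_set_cong_simp)
  qed
qed (simp add: contraction_def bil_def)

text \<open>The product acts as \<open>B\<close> on the second coordinate and then as
  \<open>A\<close> on the first. In either step the other coordinate is a parameter, over which
  squared norms add up.\<close>

lemma contraction_tensor:
  assumes "contraction I J A" "contraction K L B"
  shows "contraction (I \<times> K) (J \<times> L) (tensor A B)"
proof (rule contractionI)
  fix y :: "'b \<times> 'd \<Rightarrow> real"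
  define z where "z j k = (\<Sum>l\<in>L. B k l * y (j, l))" for j k
  have eq: "(\<Sum>q\<in>J \<times> L. tensor A B p q * y q) = (\<Sum>j\<in>J. A (fst p) j * z j (snd p))" for p
    unfolding z_def sum_distrib_left sum.cartesian_product
    by (intro sum.cong refl) (auto simp: tensor_def mult_ac)
  have sq: "(L2_set f (S \<times> T))\<^sup>2 = (\<Sum>i\<in>S. \<Sum>j\<in>T. (f (i, j))\<^sup>2)" for f :: "'x \<times> 'y \<Rightarrow> real" and S T
    by (simp add: L2_set_square sum.cartesian_product)
  have "(L2_set (\<lambda>p. \<Sum>j\<in>J. A (fst p) j * z j (snd p)) (I \<times> K))\<^sup>2 =
      (\<Sum>k\<in>K. (L2_set (\<lambda>i. \<Sum>j\<in>J. A i j * z j k) I)\<^sup>2)"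
    unfolding sq unfolding L2_set_square fst_conv snd_conv by (rule sum.swap)
  also have "\<dots> \<le> (\<Sum>k\<in>K. (L2_set (\<lambda>j. z j k) J)\<^sup>2)"
    by (intro sum_mono power_mono contraction_apply assms L2_set_nonneg)
  also have "\<dots> = (\<Sum>j\<in>J. (L2_set (\<lambda>k. \<Sum>l\<in>L. B k l * y (j, l)) K)\<^sup>2)"
    unfolding L2_set_square by (subst sum.swap) (simp add: z_def)
  also have "\<dots> \<le> (\<Sum>j\<in>J. (L2_set (\<lambda>l. y (j, l)) L)\<^sup>2)"
    by (intro sum_mono power_mono contraction_apply assms L2_set_nonneg)
  also have "\<dots> = (L2_set y (J \<times> L))\<^sup>2"
    unfolding sq unfolding L2_set_square ..
  finally show "L2_set (\<lambda>p. \<Sum>q\<in>J \<times> L. tensor A B p q * y q) (I \<times> K)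
      \<le> L2_set y (J \<times> L)"
    unfolding eq using power2_le_imp_le L2_set_nonneg by blast
qed

lemma contraction_comp:
  assumes "contraction I J A" "contraction J K B"
  shows "contraction I K (\<lambda>i k. \<Sum>j\<in>J. A i j * B j k)"
proof (rule contractionI)
  fix y :: "'c \<Rightarrow> real"
  have "(\<Sum>k\<in>K. (\<Sum>j\<in>J. A i j * B j k) * y k) = (\<Sum>j\<in>J. A i j * (\<Sum>k\<in>K. B j k * y k))" for i
    unfolding sum_distrib_left sum_distrib_right by (subst sum.swap) (simp add: mult_ac)
  then have "L2_set (\<lambda>i. \<Sum>k\<in>K. (\<Sum>j\<in>J. A i j * B j k) * y k) I \<le> L2_set (\<lambda>j. \<Sum>k\<in>K. B j k * y k) J"
    using contraction_apply[OF assms(1), of "\<lambda>j. \<Sum>k\<in>K. B j k * y k"] by simp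
  also have "\<dots> \<le> L2_set y K"
    by (rule contraction_apply[OF assms(2)])
  finally show "L2_set (\<lambda>i. \<Sum>k\<in>K. (\<Sum>j\<in>J. A i j * B j k) * y k) I \<le> L2_set y K" .
qed

text \<open>Pythagoras. Columns shorter than one are allowed because deflation yields zero vectors
  once the rank is exhausted, and because the blocks below rescale columns by quotients of singular
  values.\<close>

lemma contraction_orthogonal_columns:
  assumes "finite K"
    and orth: "\<And>k l. k \<in> K \<Longrightarrow> l \<in> K \<Longrightarrow> k \<noteq> l \<Longrightarrow> (\<Sum>i\<in>I. u k i * u l i) = 0"
    and norm: "\<And>k. k \<in> K \<Longrightarrow> L2_set (u k) I \<le> 1"
  shows "contraction I K (\<lambda>i k. u k i)"
proof (rule contractionI)
  fix y :: "'a \<Rightarrow> real"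
  have "(L2_set (\<lambda>i. \<Sum>k\<in>K. u k i * y k) I)\<^sup>2 = (\<Sum>i\<in>I. \<Sum>k\<in>K. \<Sum>l\<in>K. y k * y l * (u k i * u l i))"
    unfolding L2_set_square unfolding power2_eq_square sum_product by (intro sum.cong refl) simp
  also have "\<dots> = (\<Sum>k\<in>K. \<Sum>l\<in>K. y k * y l * (\<Sum>i\<in>I. u k i * u l i))"
    unfolding sum_distrib_left by (subst sum.swap, intro sum.cong refl, subst sum.swap) simp
  also have "\<dots> = (\<Sum>k\<in>K. \<Sum>l\<in>K. if k = l then (y k)\<^sup>2 * (L2_set (u k) I)\<^sup>2 else 0)"
    by (intro sum.cong refl) (auto simp: orth L2_set_square power2_eq_square[of "u _ _"] power2_eq_square[of "y _"])
  also have "\<dots> = (\<Sum>k\<in>K. (y k)\<^sup>2 * (L2_set (u k) I)\<^sup>2)"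
    using assms(1) by simp
  also have "\<dots> \<le> (\<Sum>k\<in>K. (y k)\<^sup>2)"
    by (intro sum_mono mult_left_le) (auto intro!: power_le_one norm)
  also have "\<dots> = (L2_set y K)\<^sup>2"
    by (simp add: L2_set_square)
  finally show "L2_set (\<lambda>i. \<Sum>k\<in>K. u k i * y k) I \<le> L2_set y K"
    using power2_le_imp_le L2_set_nonneg by blast
qed

text \<open>
  If \<open>\<sigma> = 0\<close>, the singular vectors are taken to be \<open>0\<close>: this keeps the sequences below orthogonal after
  the rank is exhausted.
\<close>

definition top_singular ::
    "'i set \<Rightarrow> 'j set \<Rightarrow> ('i \<Rightarrow> 'j \<Rightarrow> real) \<Rightarrow> real \<Rightarrow> ('i \<Rightarrow> real) \<Rightarrow> ('j \<Rightarrow> real) \<Rightarrow> bool" where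
  "top_singular I J A \<sigma> u v \<longleftrightarrow>
     (\<forall>x y. \<bar>bil I J A x y\<bar> \<le> \<sigma> * L2_set x I * L2_set y J) \<and>
     (\<forall>i\<in>I. (\<Sum>j\<in>J. A i j * v j) = \<sigma> * u i) \<and>
     (\<forall>j\<in>J. (\<Sum>i\<in>I. A i j * u i) = \<sigma> * v j) \<and>
     (\<sigma> = 0 \<and> u = (\<lambda>_. 0) \<and> v = (\<lambda>_. 0) \<or> 0 < \<sigma> \<and> L2_set u I = 1 \<and> L2_set v J = 1)"

text \<open>Vectors are functions on a whole type; pinning them to zero off \<open>I\<close> puts
  the ball inside a product of compact sets, so Tychonoff applies.\<close>

lemma compact_unit_ball:
  assumes "finite I"
  shows "compact {x :: 'i \<Rightarrow> real. (\<forall>i. i \<notin> I \<longrightarrow> x i = 0) \<and> L2_set x I \<le> 1}" (is "compact ?B")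
proof -
  let ?C = "PiE UNIV (\<lambda>i. if i \<in> I then {-1..1} else {0::real})"
  have "compactin (product_topology (\<lambda>i. euclidean) UNIV) ?C"
    unfolding compactin_PiE by simp
  then have "compact ?C"
    by (simp add: euclidean_product_topology)
  moreover have "closed {x :: 'i \<Rightarrow> real. L2_set x I \<le> 1}"
    unfolding L2_set_def by (intro closed_Collect_le continuous_intros) auto
  ultimately have "compact (?C \<inter> {x. L2_set x I \<le> 1})"
    by (rule compact_Int_closed)
  moreover have "?C \<inter> {x. L2_set x I \<le> 1} = ?B"
  proof (intro set_eqI iffI)
    fix x assume "x \<in> ?C \<inter> {x. L2_set x I \<le> 1}"
    then show "x \<in> ?B" by (auto simp: PiE_iff dest: spec)
        (metis singletonD)
  next
    fix x assume x: "x \<in> ?B"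
    have "\<bar>x i\<bar> \<le> 1" if "i \<in> I" for i
      using norm_le_l2_norm[OF assms that, of x] x unfolding l2_norm_def by (simp add: L2_set_abs)
    then show "x \<in> ?C \<inter> {x. L2_set x I \<le> 1}"
      using x by (auto simp: PiE_iff abs_le_iff)
  qed
  ultimately show ?thesis by simp
qed

text \<open>Equality case of the operator bound: the squared distance between \<open>A v\<close> and
  \<open>\<sigma> u\<close> expands to at most \<sigma>^2 - 2 \<sigma>^2 + \<sigma>^2 = 0.\<close>

lemma singular_vector:
  assumes bd: "\<And>x y. \<bar>bil I J A x y\<bar> \<le> \<sigma> * L2_set x I * L2_set y J"
    and "0 \<le> \<sigma>" "finite I" "L2_set u I = 1" "L2_set v J = 1" "bil I J A u v = \<sigma>" "i \<in> I"
  shows "(\<Sum>j\<in>J. A i j * v j) = \<sigma> * u i"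
proof -
  define z where "z i = (\<Sum>j\<in>J. A i j * v j)" for i
  have "L2_set z I \<le> \<sigma>"
    using op_bound_apply[of I J A \<sigma> v] assms unfolding z_def by simp
  then have z: "(\<Sum>i\<in>I. (z i)\<^sup>2) \<le> \<sigma>\<^sup>2"
    using assms(2) by (metis L2_set_square L2_set_nonneg power_mono)
  have u: "(\<Sum>i\<in>I. (u i)\<^sup>2) = 1"
    using assms(4) by (metis L2_set_square one_power2)
  have "(\<Sum>i\<in>I. (z i - \<sigma> * u i)\<^sup>2) = (\<Sum>i\<in>I. (z i)\<^sup>2) - 2 * \<sigma> * (\<Sum>i\<in>I. u i * z i) + \<sigma>\<^sup>2 * (\<Sum>i\<in>I. (u i)\<^sup>2)"
    unfolding sum_distrib_left sum_subtractf[symmetric] sum.distrib[symmetric]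
    by (intro sum.cong refl) (simp add: power2_eq_square algebra_simps)
  also have "\<dots> \<le> 0"
    using z assms(6) unfolding bil_left z_def[symmetric] u by (simp add: power2_eq_square)
  finally have "(\<Sum>i\<in>I. (z i - \<sigma> * u i)\<^sup>2) = 0"
    using sum_nonneg[of I "\<lambda>i. (z i - \<sigma> * u i)\<^sup>2"] by force
  then have "(z i - \<sigma> * u i)\<^sup>2 = 0"
    using assms(3,7) by (simp add: sum_nonneg_eq_0_iff)
  then show ?thesis by (simp add: z_def)
qed

text \<open>The top singular pair is a maximizer of the form on the product of the two unit balls,
  which exists by compactness.\<close>

lemma top_singular_exists:
  assumes "finite I" "finite J"
  obtains \<sigma> u v where "top_singular I J A \<sigma> u v"
proof -
  let ?B = "\<lambda>I. {x. (\<forall>i. i \<notin> I \<longrightarrow> x i = 0) \<and> L2_set x I \<le> 1}"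
  have "\<exists>p\<in>?B I \<times> ?B J. \<forall>q\<in>?B I \<times> ?B J. bil I J A (fst q) (snd q) \<le> bil I J A (fst p) (snd p)"
  proof (rule continuous_attains_sup)
    show "compact (?B I \<times> ?B J)"
      by (intro compact_Times compact_unit_ball assms)
    have "(\<lambda>_. 0, \<lambda>_. 0) \<in> ?B I \<times> ?B J"
      by (simp add: L2_set_def)
    then show "?B I \<times> ?B J \<noteq> {}" by (metis empty_iff)
    have "continuous_on S (\<lambda>p. fst p i)" "continuous_on S (\<lambda>p. snd p j)"
      for S :: "(('a \<Rightarrow> real) \<times> ('b \<Rightarrow> real)) set" and i j
      using continuous_on_product_then_coordinatewise[OF continuous_on_fst[OF continuous_on_id], of S i]
        continuous_on_product_then_coordinatewise[OF continuous_on_snd[OF continuous_on_id], of S j]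
      by simp_all
    then show "continuous_on (?B I \<times> ?B J) (\<lambda>p. bil I J A (fst p) (snd p))"
      unfolding bil_def by (intro continuous_on_sum continuous_on_mult continuous_on_const)
  qed
  then obtain u v where uv: "u \<in> ?B I" "v \<in> ?B J"
    and max: "\<And>x y. x \<in> ?B I \<Longrightarrow> y \<in> ?B J \<Longrightarrow> bil I J A x y \<le> bil I J A u v"
    by fastforce
  define \<sigma> where "\<sigma> = bil I J A u v"
  have "bil I J A (\<lambda>_. 0) (\<lambda>_. 0) \<le> \<sigma>"
    unfolding \<sigma>_def by (rule max) (auto simp: L2_set_def)
  then have "0 \<le> \<sigma>" by (simp add: bil_def)
  have norm_in: "(\<lambda>i. if i \<in> I then x i / L2_set x I else 0) \<in> ?B I" for x :: "'x \<Rightarrow> real" and I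
  proof -
    have "L2_set (\<lambda>i. if i \<in> I then x i / L2_set x I else 0) I = L2_set (\<lambda>i. (1 / L2_set x I) * x i) I"
      by (intro L2_set_cong) auto
    also have "\<dots> \<le> 1" unfolding L2_set_scale by simp
    finally show ?thesis by simp
  qed
  \<comment> \<open>Homogeneity extends maximality from the balls to all vectors; vectors of norm
    zero vanish on the index set and are treated apart.\<close>
  have le: "bil I J A x y \<le> \<sigma> * L2_set x I * L2_set y J" for x y
  proof (cases "L2_set x I = 0 \<or> L2_set y J = 0")
    case True
    then have "(\<forall>i\<in>I. x i = 0) \<or> (\<forall>j\<in>J. y j = 0)"
      using assms by (simp add: L2_set_eq_0_iff)
    then have "bil I J A x y = 0" unfolding bil_def by (auto intro!: sum.neutral)
    with True show ?thesis by auto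
  next
    case False
    then have pos: "0 < L2_set x I * L2_set y J"
      by (simp add: less_le)
    have "bil I J A x y / (L2_set x I * L2_set y J) =
        bil I J A (\<lambda>i. (1 / L2_set x I) * x i) (\<lambda>j. (1 / L2_set y J) * y j)"
      unfolding bil_scale_left bil_scale_right by simp
    also have "\<dots> = bil I J A (\<lambda>i. if i \<in> I then x i / L2_set x I else 0)
        (\<lambda>j. if j \<in> J then y j / L2_set y J else 0)"
      unfolding bil_def by (intro sum.cong refl) simp
    also have "\<dots> \<le> \<sigma>"
      unfolding \<sigma>_def by (intro max norm_in)
    finally show ?thesis
      using pos by (simp add: field_simps)
  qed
  have bd: "\<bar>bil I J A x y\<bar> \<le> \<sigma> * L2_set x I * L2_set y J" for x y
    using le[of x y] le[of "\<lambda>i. - 1 * x i" y] unfolding bil_scale_left L2_set_scale by simp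
  show thesis
  proof (cases "\<sigma> = 0")
    case True
    have "top_singular I J A 0 (\<lambda>_. 0) (\<lambda>_. 0)"
      unfolding top_singular_def using bd True by simp
    then show thesis by (rule that)
  next
    case False
    with \<open>0 \<le> \<sigma>\<close> have pos: "0 < \<sigma>" by simp
    have u1: "L2_set u I \<le> 1" and v1: "L2_set v J \<le> 1" using uv by auto
    \<comment> \<open>When the maximum is positive, homogeneity forces the maximizers onto the unit
      spheres.\<close>
    have "\<sigma> \<le> \<sigma> * L2_set u I * L2_set v J"
      using le[of u v] unfolding \<sigma>_def by simp
    then have ge: "1 \<le> L2_set u I * L2_set v J"
      using pos by (simp add: mult.assoc)
    have "L2_set u I * L2_set v J \<le> L2_set u I" "L2_set u I * L2_set v J \<le> L2_set v J"
      using u1 v1 by (simp_all add: mult_left_le mult_left_le_one_le)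
    with ge u1 v1 have uv1: "L2_set u I = 1" "L2_set v J = 1"
      by linarith+
    have "(\<Sum>j\<in>J. A i j * v j) = \<sigma> * u i" if "i \<in> I" for i
      using singular_vector[OF bd \<open>0 \<le> \<sigma>\<close> assms(1) uv1] that by (simp add: \<sigma>_def)
    moreover have "(\<Sum>i\<in>I. A i j * u i) = \<sigma> * v j" if "j \<in> J" for j
      using singular_vector[of J I "\<lambda>j i. A i j" \<sigma> v u j] that bd \<open>0 \<le> \<sigma>\<close> assms uv1
      by (simp add: bil_flip[of J I A] mult_ac \<sigma>_def[symmetric])
    ultimately have "top_singular I J A \<sigma> u v"
      unfolding top_singular_def using bd pos uv1 by simp
    then show thesis by (rule that)
  qed
qed

section \<open>Singular value expansion by repeated removal of the top singular pair\<close>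

locale deflation =
  fixes I :: "'i set" and J :: "'j set" and M :: "nat \<Rightarrow> 'i \<Rightarrow> 'j \<Rightarrow> real"
    and \<sigma> :: "nat \<Rightarrow> real" and u :: "nat \<Rightarrow> 'i \<Rightarrow> real" and v :: "nat \<Rightarrow> 'j \<Rightarrow> real"
  assumes finite_I: "finite I" and finite_J: "finite J"
    and top: "\<And>n. top_singular I J (M n) (\<sigma> n) (u n) (v n)"
    and step: "\<And>n. M (Suc n) = (\<lambda>i j. M n i j - \<sigma> n * u n i * v n j)"
begin

lemma sigma_cases: "\<sigma> n = 0 \<and> u n = (\<lambda>_. 0) \<and> v n = (\<lambda>_. 0) \<or> 0 < \<sigma> n \<and> L2_set (u n) I = 1 \<and> L2_set (v n) J = 1"
  using top[of n] by (simp add: top_singular_def)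

lemma sigma_nonneg: "0 \<le> \<sigma> n"
  using sigma_cases[of n] by auto

lemma unit_norms: "0 < \<sigma> n \<Longrightarrow> (\<Sum>i\<in>I. (u n i)\<^sup>2) = 1" "0 < \<sigma> n \<Longrightarrow> (\<Sum>j\<in>J. (v n j)\<^sup>2) = 1"
  using sigma_cases[of n] by (auto simp flip: L2_set_square)

lemma norm_le_one: "L2_set (u n) I \<le> 1" "L2_set (v n) J \<le> 1"
  using sigma_cases[of n] by (auto simp: L2_set_def)

lemma op_le_sigma: "\<bar>bil I J (M n) x y\<bar> \<le> \<sigma> n * L2_set x I * L2_set y J"
  using top[of n] by (simp add: top_singular_def)

lemma apply_v: "i \<in> I \<Longrightarrow> (\<Sum>j\<in>J. M n i j * v n j) = \<sigma> n * u n i"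
  using top[of n] by (simp add: top_singular_def)

lemma apply_u: "j \<in> J \<Longrightarrow> (\<Sum>i\<in>I. M n i j * u n i) = \<sigma> n * v n j"
  using top[of n] by (simp add: top_singular_def)

text \<open>Transposition exchanges \<open>u\<close> and \<open>v\<close>, so orthogonality has to
  be proved for one family only.\<close>

lemma deflation_flip: "deflation J I (\<lambda>n j i. M n i j) \<sigma> v u"
proof
  show "top_singular J I (\<lambda>j i. M n i j) (\<sigma> n) (v n) (u n)" for n
    unfolding top_singular_def bil_flip[of J I "M n"]
    using op_le_sigma[of n] sigma_cases[of n] apply_u apply_v by (auto simp: mult_ac)
qed (auto simp: finite_I finite_J step mult_ac)

text \<open>Removing the top pair kills \<open>v n\<close>. An older \<open>v k\<close> stays in the
  kernel because \<open>\<sigma> n\<close> times \<open>v n\<close> is the image of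
  \<open>u n\<close> under the transpose of \<open>M n\<close>, hence orthogonal to the kernel of
  \<open>M n\<close>.\<close>

lemma annihilates_v: "k < n \<Longrightarrow> i \<in> I \<Longrightarrow> (\<Sum>j\<in>J. M n i j * v k j) = 0"
proof (induction n arbitrary: i)
  case (Suc n)
  have exp: "(\<Sum>j\<in>J. M (Suc n) i j * v k j) =
      (\<Sum>j\<in>J. M n i j * v k j) - u n i * (\<sigma> n * (\<Sum>j\<in>J. v n j * v k j))"
    unfolding step by (simp add: algebra_simps sum_subtractf sum_distrib_left)
  show ?case
  proof (cases "k = n")
    case True
    have "\<sigma> n * (\<Sum>j\<in>J. v n j * v n j) = \<sigma> n"
      using unit_norms(2)[of n] sigma_cases[of n] by (auto simp: power2_eq_square)
    then show ?thesis
      unfolding exp using apply_v[OF Suc.prems(2), of n] by (auto simp: True)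
  next
    case False
    then have kn: "k < n" using Suc.prems by simp
    have "\<sigma> n * (\<Sum>j\<in>J. v n j * v k j) = (\<Sum>j\<in>J. v k j * (\<Sum>i\<in>I. M n i j * u n i))"
      unfolding sum_distrib_left[of "\<sigma> n"] by (intro sum.cong refl) (simp add: apply_u)
    also have "\<dots> = (\<Sum>i\<in>I. u n i * (\<Sum>j\<in>J. M n i j * v k j))"
      using bil_left[of I J "M n" "u n" "v k"] bil_right[of I J "M n" "u n" "v k"] by simp
    also have "\<dots> = 0"
      using Suc.IH[OF kn] by simp
    finally show ?thesis
      unfolding exp using Suc.IH[OF kn Suc.prems(2)] by simp
  qed
qed simp

text \<open>For \<open>k < n\<close> and nonzero \<open>\<sigma> n\<close>, the vector
  \<open>v n\<close> lies in the range of the transpose of \<open>M n\<close>, and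
  \<open>v k\<close> in the kernel of \<open>M n\<close>. If \<open>\<sigma> n = 0\<close>, then
  \<open>v n\<close> is zero by convention.\<close>

lemma orthogonal_v:
  assumes "k \<noteq> n"
  shows "(\<Sum>j\<in>J. v n j * v k j) = 0"
proof -
  have *: "(\<Sum>j\<in>J. v n j * v k j) = 0" if kn: "k < n" for k n
  proof (cases "\<sigma> n = 0")
    case True
    then show ?thesis using sigma_cases[of n] by simp
  next
    case False
    have "\<sigma> n * (\<Sum>j\<in>J. v n j * v k j) = (\<Sum>j\<in>J. v k j * (\<Sum>i\<in>I. M n i j * u n i))"
      unfolding sum_distrib_left[of "\<sigma> n"] by (intro sum.cong refl) (simp add: apply_u)
    also have "\<dots> = (\<Sum>i\<in>I. u n i * (\<Sum>j\<in>J. M n i j * v k j))"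
      using bil_left[of I J "M n" "u n" "v k"] bil_right[of I J "M n" "u n" "v k"] by simp
    also have "\<dots> = 0"
      using annihilates_v[OF kn] by simp
    finally show ?thesis using False by simp
  qed
  show ?thesis
    using *[of k n] *[of n k] assms by (cases "k < n") (simp_all add: mult.commute)
qed

lemma orthogonal_u: "k \<noteq> n \<Longrightarrow> (\<Sum>i\<in>I. u n i * u k i) = 0"
  by (rule deflation.orthogonal_v[OF deflation_flip])

lemma bil_singular: "bil I J (M n) (u n) (v n) = \<sigma> n"
proof -
  have "bil I J (M n) (u n) (v n) = (\<Sum>i\<in>I. \<sigma> n * (u n i)\<^sup>2)"
    unfolding bil_left by (intro sum.cong refl) (simp add: apply_v power2_eq_square)
  then show ?thesis
    using unit_norms(1)[of n] sigma_cases[of n] by (auto simp flip: sum_distrib_left)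
qed

text \<open>At the next singular pair the subtracted rank-one term vanishes by orthogonality, so its
  value is still governed by the norm of the previous residual.\<close>

lemma sigma_decreasing: "\<sigma> (Suc n) \<le> \<sigma> n"
proof -
  have "\<sigma> (Suc n) = bil I J (M n) (u (Suc n)) (v (Suc n))"
    using bil_singular[of "Suc n"] orthogonal_u[of "Suc n" n]
    unfolding step bil_diff bil_rank_one by simp
  also have "\<dots> \<le> \<sigma> n * L2_set (u (Suc n)) I * L2_set (v (Suc n)) J"
    using op_le_sigma[of n "u (Suc n)" "v (Suc n)"] by linarith
  also have "\<dots> \<le> \<sigma> n * 1 * 1"
    by (intro mult_mono norm_le_one mult_nonneg_nonneg sigma_nonneg) auto
  finally show ?thesis by simp
qed

lemma sigma_antimono: "m \<le> n \<Longrightarrow> \<sigma> n \<le> \<sigma> m"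
  by (rule lift_Suc_antimono_le[of \<sigma>, OF sigma_decreasing])

text \<open>The cross term contributes -2 \<sigma>^2, the square of the rank-one term
  +\<sigma>^2.\<close>

lemma frobenius_step: "(\<Sum>i\<in>I. \<Sum>j\<in>J. (M (Suc n) i j)\<^sup>2) = (\<Sum>i\<in>I. \<Sum>j\<in>J. (M n i j)\<^sup>2) - (\<sigma> n)\<^sup>2"
proof -
  have "(\<Sum>i\<in>I. \<Sum>j\<in>J. (M (Suc n) i j)\<^sup>2) = (\<Sum>i\<in>I. \<Sum>j\<in>J. (M n i j)\<^sup>2) - 2 * \<sigma> n * bil I J (M n) (u n) (v n)
      + (\<sigma> n)\<^sup>2 * ((\<Sum>i\<in>I. (u n i)\<^sup>2) * (\<Sum>j\<in>J. (v n j)\<^sup>2))"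
    unfolding step bil_def sum_product unfolding sum_distrib_left sum_subtractf[symmetric] sum.distrib[symmetric]
    by (intro sum.cong refl) (simp add: power2_eq_square algebra_simps)
  also have "(\<sigma> n)\<^sup>2 * ((\<Sum>i\<in>I. (u n i)\<^sup>2) * (\<Sum>j\<in>J. (v n j)\<^sup>2)) = (\<sigma> n)\<^sup>2"
    using unit_norms[of n] sigma_cases[of n] by auto
  finally show ?thesis
    by (simp add: bil_singular power2_eq_square)
qed

lemma sum_sigma_le: "(\<Sum>k<n. (\<sigma> k)\<^sup>2) \<le> (\<Sum>i\<in>I. \<Sum>j\<in>J. (M 0 i j)\<^sup>2)"
proof -
  have "(\<Sum>k<n. (\<sigma> k)\<^sup>2) + (\<Sum>i\<in>I. \<Sum>j\<in>J. (M n i j)\<^sup>2) = (\<Sum>i\<in>I. \<Sum>j\<in>J. (M 0 i j)\<^sup>2)"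
    by (induction n) (simp_all add: frobenius_step)
  moreover have "0 \<le> (\<Sum>i\<in>I. \<Sum>j\<in>J. (M n i j)\<^sup>2)"
    by (intro sum_nonneg) simp
  ultimately show ?thesis by linarith
qed

lemma singular_expansion: "M 0 i j = (\<Sum>k<n. \<sigma> k * u k i * v k j) + M n i j"
  by (induction n) (simp_all add: step)

text \<open>Cauchy condensation: the indices from \<open>2 ^ m - 1\<close> to just below
  \<open>2 ^ Suc m - 1\<close> number \<open>2 ^ m\<close>, and their singular values are at least
  the one that follows them. That value carries the weight \<open>2 ^ Suc m\<close>, hence the
  factor 2.\<close>

lemma dyadic_sum_le: "(\<Sum>j\<le>m. 2 ^ j * (\<sigma> (2 ^ j - 1))\<^sup>2) \<le> (\<sigma> 0)\<^sup>2 + 2 * (\<Sum>k<2 ^ m - 1. (\<sigma> k)\<^sup>2)"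
proof (induction m)
  case (Suc m)
  have split: "{..<2 ^ Suc m - 1} = {..<2 ^ m - 1} \<union> {2 ^ m - 1..<2 ^ Suc m - (1::nat)}"
    by auto
  have "2 ^ m * (\<sigma> (2 ^ Suc m - 1))\<^sup>2 = (\<Sum>k=2 ^ m - 1..<2 ^ Suc m - (1::nat). (\<sigma> (2 ^ Suc m - 1))\<^sup>2)"
    by simp
  also have "\<dots> \<le> (\<Sum>k=2 ^ m - 1..<2 ^ Suc m - (1::nat). (\<sigma> k)\<^sup>2)"
    by (intro sum_mono power_mono sigma_antimono sigma_nonneg) simp
  finally have "2 ^ m * (\<sigma> (2 ^ Suc m - 1))\<^sup>2 \<le> (\<Sum>k=2 ^ m - 1..<2 ^ Suc m - (1::nat). (\<sigma> k)\<^sup>2)" .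
  moreover have "(\<Sum>k<2 ^ Suc m - 1. (\<sigma> k)\<^sup>2) = (\<Sum>k<2 ^ m - 1. (\<sigma> k)\<^sup>2) + (\<Sum>k=2 ^ m - 1..<2 ^ Suc m - (1::nat). (\<sigma> k)\<^sup>2)"
    unfolding split by (rule sum.union_disjoint) auto
  ultimately show ?case
    using Suc.IH by simp
qed simp

end

text \<open>Choosing a top pair for every matrix makes deflation a plain recursion on the
  residual.\<close>

lemma deflation_exists:
  assumes "finite I" "finite J"
  obtains M \<sigma> u v where "M 0 = A" "deflation I J M \<sigma> u v"
proof -
  have "\<exists>t. top_singular I J B (fst t) (fst (snd t)) (snd (snd t))" for B
    using top_singular_exists[OF assms, of B] by (metis fst_conv snd_conv)
  then obtain t where t: "\<And>B. top_singular I J B (fst (t B)) (fst (snd (t B))) (snd (snd (t B)))"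
    by metis
  define M where "M = rec_nat A (\<lambda>_ B i j. B i j - fst (t B) * fst (snd (t B)) i * snd (snd (t B)) j)"
  have "deflation I J M (\<lambda>n. fst (t (M n))) (\<lambda>n. fst (snd (t (M n)))) (\<lambda>n. snd (snd (t (M n))))"
    by standard (use assms t in \<open>auto simp: M_def\<close>)
  moreover have "M 0 = A" by (simp add: M_def)
  ultimately show thesis using that by blast
qed

text \<open>
  The \<open>k\<close>-th block collects the singular values with indices in \<open>[2\<^sup>k - 1, 2\<^bsup>k + 1\<^esup> - 1)\<close>, all of them
  bounded by \<open>c k / sqrt (2\<^sup>k)\<close>. The last block is the whole remainder after \<open>2\<^sup>m - 1\<close> deflations, whose
  operator norm is controlled by the next singular value; hence it is not needed that the deflation
  terminates.
\<close>

lemma dyadic_decomposition: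
  fixes A :: "nat \<Rightarrow> nat \<Rightarrow> real"
  assumes I: "finite I" and J: "J \<subseteq> {..<2 ^ m}"
  obtains c and P Q :: "nat \<Rightarrow> nat \<Rightarrow> nat \<Rightarrow> real" where "\<And>k. 0 \<le> c k"
    "\<And>k. k \<le> m \<Longrightarrow> contraction I {..<2 ^ k} (P k)"
    "\<And>k. k \<le> m \<Longrightarrow> contraction {..<2 ^ k} J (Q k)"
    "(\<Sum>k\<le>m. (c k)\<^sup>2) \<le> 3 * (\<Sum>i\<in>I. \<Sum>j\<in>J. (A i j)\<^sup>2)"
    "\<And>i j. i \<in> I \<Longrightarrow> j \<in> J \<Longrightarrow>
       A i j = (\<Sum>k\<le>m. c k / sqrt (2 ^ k) * (\<Sum>\<alpha><2 ^ k. P k i \<alpha> * Q k \<alpha> j))"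
proof -
  have finJ: "finite J" using J finite_subset by blast
  obtain M \<sigma> u v where M0: "M 0 = A" and "deflation I J M \<sigma> u v"
    using deflation_exists[OF I finJ] by blast
  then interpret deflation I J M \<sigma> u v by simp
  define c where "c k = sqrt (2 ^ k) * \<sigma> (2 ^ k - 1)" for k
  \<comment> \<open>For \<open>k < m\<close> the columns are left singular vectors. In the last
    block the residual is divided by its operator norm; if that is zero, division by zero yields the
    zero matrix.\<close>
  define P where "P k i \<alpha> =
     (if k < m then u (2 ^ k - 1 + \<alpha>) i else if \<alpha> \<in> J then M (2 ^ m - 1) i \<alpha> / \<sigma> (2 ^ m - 1) else 0)"
    for k i \<alpha>
  \<comment> \<open>The rows are right singular vectors weighted by the quotient to the largest
    singular value of the block; in the last block they embed \<open>J\<close> into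
    \<open>{..<2 ^ m}\<close>.\<close>
  define Q where "Q k \<alpha> j =
     (if k < m then \<sigma> (2 ^ k - 1 + \<alpha>) / \<sigma> (2 ^ k - 1) * v (2 ^ k - 1 + \<alpha>) j else if \<alpha> = j then 1 else 0)"
    for k \<alpha> j
  show thesis
  proof (rule that)
    show "0 \<le> c k" for k by (simp add: c_def sigma_nonneg)
    show "contraction I {..<2 ^ k} (P k)" if "k \<le> m" for k
    proof (cases "k < m")
      case True
      have "contraction I {..<2 ^ k} (\<lambda>i \<alpha>. u (2 ^ k - 1 + \<alpha>) i)"
        by (rule contraction_orthogonal_columns) (auto intro: orthogonal_u norm_le_one)
      with True show ?thesis by (simp add: P_def[abs_def])
    next
      case False
      with that have k: "k = m" by simp
      define B where "B i j = M (2 ^ m - 1) i j / \<sigma> (2 ^ m - 1)" for i j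
      have "contraction I J B"
        unfolding contraction_def
      proof (intro allI)
        fix x y
        have B: "B = (\<lambda>i j. (1 / \<sigma> (2 ^ m - 1)) * M (2 ^ m - 1) i j)"
          by (simp add: B_def[abs_def])
        show "\<bar>bil I J B x y\<bar> \<le> L2_set x I * L2_set y J"
          unfolding B bil_scale
          using op_le_sigma[of "2 ^ m - 1" x y] sigma_nonneg[of "2 ^ m - 1"]
          by (cases "\<sigma> (2 ^ m - 1) = 0") (simp_all add: abs_mult field_simps)
      qed
      have "contraction I {..<2 ^ m} (\<lambda>i \<alpha>. if \<alpha> \<in> J then B i \<alpha> else 0)"
      proof (rule contractionI)
        fix y :: "nat \<Rightarrow> real"
        have "(\<Sum>\<alpha><2 ^ m. (if \<alpha> \<in> J then B i \<alpha> else 0) * y \<alpha>) = (\<Sum>\<alpha>\<in>J. B i \<alpha> * y \<alpha>)" for i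
          using J by (intro sum.mono_neutral_cong_right) auto
        then have "L2_set (\<lambda>i. \<Sum>\<alpha><2 ^ m. (if \<alpha> \<in> J then B i \<alpha> else 0) * y \<alpha>) I \<le> L2_set y J"
          using contraction_apply[OF \<open>contraction I J B\<close>, of y] by simp
        also have "\<dots> \<le> L2_set y {..<2 ^ m}"
          unfolding L2_set_def using J by (intro real_sqrt_le_mono sum_mono2) auto
        finally show "L2_set (\<lambda>i. \<Sum>\<alpha><2 ^ m. (if \<alpha> \<in> J then B i \<alpha> else 0) * y \<alpha>) I \<le> L2_set y {..<2 ^ m}" .
      qed
      then show ?thesis
        unfolding k by (rule contraction_cong[THEN iffD1, rotated]) (simp add: P_def B_def)
    qed
    show "contraction {..<2 ^ k} J (Q k)" if "k \<le> m" for k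
    proof (cases "k < m")
      case True
      have "contraction J {..<2 ^ k} (\<lambda>j \<alpha>. \<sigma> (2 ^ k - 1 + \<alpha>) / \<sigma> (2 ^ k - 1) * v (2 ^ k - 1 + \<alpha>) j)"
      proof (rule contraction_orthogonal_columns)
        fix \<alpha> \<beta> :: nat assume "\<alpha> \<noteq> \<beta>"
        then have "(\<Sum>j\<in>J. v (2 ^ k - 1 + \<alpha>) j * v (2 ^ k - 1 + \<beta>) j) = 0"
          by (intro orthogonal_v) (metis add_left_cancel)
        then have "\<sigma> (2 ^ k - 1 + \<alpha>) / \<sigma> (2 ^ k - 1) * (\<sigma> (2 ^ k - 1 + \<beta>) / \<sigma> (2 ^ k - 1)) *
            (\<Sum>j\<in>J. v (2 ^ k - 1 + \<alpha>) j * v (2 ^ k - 1 + \<beta>) j) = 0"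
          by simp
        then show "(\<Sum>i\<in>J. \<sigma> (2 ^ k - 1 + \<alpha>) / \<sigma> (2 ^ k - 1) * v (2 ^ k - 1 + \<alpha>) i *
            (\<sigma> (2 ^ k - 1 + \<beta>) / \<sigma> (2 ^ k - 1) * v (2 ^ k - 1 + \<beta>) i)) = 0"
          unfolding sum_distrib_left by (simp add: mult_ac)
      next
        fix \<alpha> :: nat
        have "\<bar>\<sigma> (2 ^ k - 1 + \<alpha>) / \<sigma> (2 ^ k - 1)\<bar> \<le> 1"
          using sigma_antimono[of "2 ^ k - 1" "2 ^ k - 1 + \<alpha>"] sigma_nonneg[of "2 ^ k - 1"]
            sigma_nonneg[of "2 ^ k - 1 + \<alpha>"]
          by (cases "\<sigma> (2 ^ k - 1) = 0") (simp_all add: divide_le_eq)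
        then show "L2_set (\<lambda>j. \<sigma> (2 ^ k - 1 + \<alpha>) / \<sigma> (2 ^ k - 1) * v (2 ^ k - 1 + \<alpha>) j) J \<le> 1"
          unfolding L2_set_scale by (intro mult_le_one norm_le_one L2_set_nonneg)
      qed simp
      with True show ?thesis
        unfolding contraction_flip[of J "{..<2 ^ k}" "Q k", symmetric] by (simp add: Q_def)
    next
      case False
      with that have k: "k = m" by simp
      show ?thesis
      proof (rule contractionI)
        fix y :: "nat \<Rightarrow> real"
        have "(\<Sum>j\<in>J. Q k \<alpha> j * y j) = (if \<alpha> \<in> J then y \<alpha> else 0)" for \<alpha>
          using finJ k by (simp add: Q_def if_distrib[of "\<lambda>z. z * _"] cong: if_cong)
        moreover have "L2_set (\<lambda>\<alpha>. if \<alpha> \<in> J then y \<alpha> else 0) {..<2 ^ k} = L2_set y J"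
          unfolding L2_set_def using J k
          by (intro arg_cong[where f=sqrt] sum.mono_neutral_cong_right) auto
        ultimately show "L2_set (\<lambda>\<alpha>. \<Sum>j\<in>J. Q k \<alpha> j * y j) {..<2 ^ k} \<le> L2_set y J"
          by simp
      qed
    qed
    have "(\<Sum>k\<le>m. (c k)\<^sup>2) = (\<Sum>j\<le>m. 2 ^ j * (\<sigma> (2 ^ j - 1))\<^sup>2)"
      by (simp add: c_def power_mult_distrib)
    also have "\<dots> \<le> (\<sigma> 0)\<^sup>2 + 2 * (\<Sum>k<2 ^ m - 1. (\<sigma> k)\<^sup>2)"
      by (rule dyadic_sum_le)
    \<comment> \<open>The constant is 1 + 2: the single square of \<open>\<sigma> 0\<close> and the
      partial sum are each bounded by the squared Frobenius norm.\<close>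
    also have "\<dots> \<le> 3 * (\<Sum>i\<in>I. \<Sum>j\<in>J. (A i j)\<^sup>2)"
      using sum_sigma_le[of 1] sum_sigma_le[of "2 ^ m - 1"] by (simp add: M0)
    finally show "(\<Sum>k\<le>m. (c k)\<^sup>2) \<le> 3 * (\<Sum>i\<in>I. \<Sum>j\<in>J. (A i j)\<^sup>2)" .
    fix i j assume i: "i \<in> I" and j: "j \<in> J"
    \<comment> \<open>If the first singular value of the block vanishes, so do all later ones, and
      both sides are zero.\<close>
    have ratio: "\<sigma> (2 ^ k - 1) * (\<sigma> (2 ^ k - 1 + \<alpha>) / \<sigma> (2 ^ k - 1)) = \<sigma> (2 ^ k - 1 + \<alpha>)" for k \<alpha>
      using sigma_antimono[of "2 ^ k - 1" "2 ^ k - 1 + \<alpha>"] sigma_nonneg[of "2 ^ k - 1 + \<alpha>"]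
      by (cases "\<sigma> (2 ^ k - 1) = 0") simp_all
    have block: "c k / sqrt (2 ^ k) * (\<Sum>\<alpha><2 ^ k. P k i \<alpha> * Q k \<alpha> j) =
        (\<Sum>l=2 ^ k - 1..<2 ^ Suc k - 1. \<sigma> l * u l i * v l j)" if "k < m" for k
    proof -
      have "c k / sqrt (2 ^ k) * (\<Sum>\<alpha><2 ^ k. P k i \<alpha> * Q k \<alpha> j) =
          (\<Sum>\<alpha><2 ^ k. (\<sigma> (2 ^ k - 1) * (\<sigma> (2 ^ k - 1 + \<alpha>) / \<sigma> (2 ^ k - 1))) * u (2 ^ k - 1 + \<alpha>) i * v (2 ^ k - 1 + \<alpha>) j)"
        using that unfolding c_def P_def Q_def sum_distrib_left by (intro sum.cong refl) simp
      also have "\<dots> = (\<Sum>\<alpha>=0..<2 ^ k. \<sigma> (\<alpha> + (2 ^ k - 1)) * u (\<alpha> + (2 ^ k - 1)) i * v (\<alpha> + (2 ^ k - 1)) j)"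
        unfolding ratio by (simp add: atLeast0LessThan add.commute)
      also have "\<dots> = (\<Sum>l=0 + (2 ^ k - 1)..<2 ^ k + (2 ^ k - 1). \<sigma> l * u l i * v l j)"
        by (rule sum.shift_bounds_nat_ivl[symmetric])
      also have "2 ^ k + (2 ^ k - 1) = 2 ^ Suc k - (1::nat)" by simp
      finally show ?thesis by simp
    qed
    have sum_blocks: "(\<Sum>k<n. \<Sum>l=2 ^ k - 1..<2 ^ Suc k - 1. f l) = (\<Sum>l<2 ^ n - 1. f l)" for n and f :: "nat \<Rightarrow> real"
    proof (induction n)
      case (Suc n)
      have "{..<2 ^ Suc n - 1} = {..<2 ^ n - 1} \<union> {2 ^ n - 1..<2 ^ Suc n - (1::nat)}"
        by auto
      then have "(\<Sum>l<2 ^ Suc n - 1. f l) = (\<Sum>l<2 ^ n - 1. f l) + (\<Sum>l=2 ^ n - 1..<2 ^ Suc n - 1. f l)"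
        by (simp only: sum.union_disjoint[OF finite_lessThan finite_atLeastLessThan ivl_disj_int(2)]
            ivl_disj_int)
      with Suc show ?case by simp
    qed simp
    have last: "c m / sqrt (2 ^ m) * (\<Sum>\<alpha><2 ^ m. P m i \<alpha> * Q m \<alpha> j) = M (2 ^ m - 1) i j"
    proof -
      have "(\<Sum>\<alpha><2 ^ m. P m i \<alpha> * Q m \<alpha> j) = (\<Sum>\<alpha>\<in>{j}. P m i \<alpha> * Q m \<alpha> j)"
        using j J by (intro sum.mono_neutral_right) (auto simp: Q_def)
      then have "c m / sqrt (2 ^ m) * (\<Sum>\<alpha><2 ^ m. P m i \<alpha> * Q m \<alpha> j) =
          \<sigma> (2 ^ m - 1) * (M (2 ^ m - 1) i j / \<sigma> (2 ^ m - 1))"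
        using j by (simp add: c_def P_def Q_def)
      also have "\<dots> = M (2 ^ m - 1) i j"
      proof (cases "\<sigma> (2 ^ m - 1) = 0")
        case True
        \<comment> \<open>A residual of operator norm zero vanishes entrywise: test it on coordinate
          vectors.\<close>
        let ?x = "\<lambda>k. if k = i then 1 else 0 :: real" and ?y = "\<lambda>k. if k = j then 1 else 0 :: real"
        have "bil I J (M (2 ^ m - 1)) ?x ?y = M (2 ^ m - 1) i j"
          unfolding bil_def using i j I finJ
          by (simp add: if_distrib[of "\<lambda>z. _ * z"] cong: if_cong)
        then show ?thesis
          using op_le_sigma[of "2 ^ m - 1" ?x ?y] True by simp
      qed simp
      finally show ?thesis .
    qed
    have "(\<Sum>k\<le>m. c k / sqrt (2 ^ k) * (\<Sum>\<alpha><2 ^ k. P k i \<alpha> * Q k \<alpha> j)) =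
        (\<Sum>k<m. \<Sum>l=2 ^ k - 1..<2 ^ Suc k - 1. \<sigma> l * u l i * v l j) + M (2 ^ m - 1) i j"
      unfolding lessThan_Suc_atMost[symmetric] sum.lessThan_Suc last
      by (intro arg_cong2[where f="(+)"] sum.cong refl block) simp
    also have "\<dots> = A i j"
      unfolding sum_blocks M0[symmetric] by (rule singular_expansion[symmetric])
    finally show "A i j = (\<Sum>k\<le>m. c k / sqrt (2 ^ k) * (\<Sum>\<alpha><2 ^ k. P k i \<alpha> * Q k \<alpha> j))" ..
  qed
qed

section \<open>Nets of the unit ball of a finite-dimensional norm\<close>

lemma emeasure_lborel_affine_vimage:
  fixes c y :: real
  assumes "0 < c" and [measurable]: "B \<in> sets borel"
  shows "emeasure lborel B = ennreal c * emeasure lborel {t. c * (t - y) \<in> B}"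
proof -
  have "emeasure lborel B = emeasure (density (distr lborel borel (\<lambda>x. - c * y + c * x)) (\<lambda>_. ennreal \<bar>c\<bar>)) B"
    using assms(1) by (subst lborel_real_affine[of c "- c * y"]) auto
  also have "\<dots> = ennreal c * emeasure lborel ((\<lambda>x. - c * y + c * x) -` B \<inter> space lborel)"
    using assms(1) by (simp add: emeasure_density_const emeasure_distr)
  also have "(\<lambda>x. - c * y + c * x) -` B \<inter> space lborel = {t. c * (t - y) \<in> B}"
    by (auto simp: algebra_simps)
  finally show ?thesis .
qed

text \<open>Checked on boxes, which determine the product measure; each coordinate contributes one
  factor \<open>c\<close>.\<close>

lemma emeasure_PiM_lborel_affine_vimage:
  fixes y :: "'e \<Rightarrow> real"
  assumes E: "finite E" and c: "0 < c" and A: "A \<in> sets (PiM E (\<lambda>_. lborel))"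
  shows "emeasure (PiM E (\<lambda>_. lborel)) A =
    ennreal (c ^ card E) *
    emeasure (PiM E (\<lambda>_. lborel)) {z \<in> space (PiM E (\<lambda>_. lborel)). (\<lambda>e\<in>E. c * (z e - y e)) \<in> A}"
proof -
  interpret product_sigma_finite "\<lambda>_ :: 'e. lborel :: real measure" ..
  let ?\<mu> = "PiM E (\<lambda>_. lborel :: real measure)"
  define T where "T z = (\<lambda>e\<in>E. c * (z e - y e))" for z
  have T: "T \<in> measurable ?\<mu> ?\<mu>"
    unfolding T_def by (intro measurable_restrict) simp
  have "scale_measure (ennreal (c ^ card E)) (distr ?\<mu> ?\<mu> T) = ?\<mu>"
  proof (rule PiM_eqI[OF E])
    fix B :: "'e \<Rightarrow> real set" assume B: "\<And>i. i \<in> E \<Longrightarrow> B i \<in> sets lborel"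
    have vim: "T -` Pi\<^sub>E E B \<inter> space ?\<mu> = Pi\<^sub>E E (\<lambda>e. {t. c * (t - y e) \<in> B e})"
      by (auto simp: T_def space_PiM PiE_iff extensional_def)
    have meas: "{t. c * (t - y e) \<in> B e} \<in> sets lborel" if "e \<in> E" for e
    proof -
      have "(\<lambda>t. c * (t - y e)) -` B e \<inter> space borel \<in> sets borel"
        using B[OF that] by (intro measurable_sets[of _ borel borel]) auto
      then show ?thesis by (simp add: vimage_def)
    qed
    have "Pi\<^sub>E E B \<in> sets ?\<mu>"
      by (intro sets_PiM_I_finite E B)
    then have "emeasure (scale_measure (ennreal (c ^ card E)) (distr ?\<mu> ?\<mu> T)) (Pi\<^sub>E E B) =
        ennreal (c ^ card E) * (\<Prod>e\<in>E. emeasure lborel {t. c * (t - y e) \<in> B e})"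
      using T by (simp add: emeasure_distr vim emeasure_PiM[OF E meas])
    also have "\<dots> = (\<Prod>e\<in>E. ennreal c) * (\<Prod>e\<in>E. emeasure lborel {t. c * (t - y e) \<in> B e})"
      using c by (simp add: ennreal_power)
    also have "\<dots> = (\<Prod>e\<in>E. emeasure lborel (B e))"
      unfolding prod.distrib[symmetric]
      by (intro prod.cong refl emeasure_lborel_affine_vimage[symmetric] c) (use B in simp)
    finally show "emeasure (scale_measure (ennreal (c ^ card E)) (distr ?\<mu> ?\<mu> T)) (Pi\<^sub>E E B) =
        (\<Prod>e\<in>E. emeasure lborel (B e))" .
  qed simp
  then have "emeasure ?\<mu> A = emeasure (scale_measure (ennreal (c ^ card E)) (distr ?\<mu> ?\<mu> T)) A"
    by simp
  also have "\<dots> = ennreal (c ^ card E) * emeasure ?\<mu> (T -` A \<inter> space ?\<mu>)"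
    using T A by (simp add: emeasure_distr)
  also have "T -` A \<inter> space ?\<mu> = {z \<in> space ?\<mu>. (\<lambda>e\<in>E. c * (z e - y e)) \<in> A}"
    by (auto simp: T_def)
  finally show ?thesis .
qed

text \<open>
  Volume argument: if the points of \<open>F \<subseteq> K\<close> are \<open>1/2\<close>-separated, the sets \<open>y + K/4\<close> are disjoint and
  contained in \<open>(5/4) K\<close>.
\<close>

lemma convex_body_net:
  fixes K :: "('e::countable \<Rightarrow> real) set"
  assumes E: "finite E"
    and K_closed: "closed K"
    and K_cong: "\<And>x y. x \<in> K \<Longrightarrow> (\<And>e. e \<in> E \<Longrightarrow> x e = y e) \<Longrightarrow> y \<in> K"
    and K_convex: "\<And>x y a b. x \<in> K \<Longrightarrow> y \<in> K \<Longrightarrow> 0 \<le> a \<Longrightarrow> 0 \<le> b \<Longrightarrow> a + b = 1 \<Longrightarrow> (\<lambda>e. a * x e + b * y e) \<in> K"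
    and K_symmetric: "\<And>x. x \<in> K \<Longrightarrow> (\<lambda>e. - x e) \<in> K"
    and K_bounded: "\<And>x e. x \<in> K \<Longrightarrow> e \<in> E \<Longrightarrow> \<bar>x e\<bar> \<le> \<rho>"
    and K_solid: "0 < \<delta>" "\<And>x. (\<And>e. e \<in> E \<Longrightarrow> \<bar>x e\<bar> \<le> \<delta>) \<Longrightarrow> x \<in> K"
  obtains F where "finite F" "F \<subseteq> K" "card F \<le> 5 ^ card E"
    "\<And>x. x \<in> K \<Longrightarrow> \<exists>y\<in>F. (\<lambda>e. 2 * (x e - y e)) \<in> K"
proof -
  interpret product_sigma_finite "\<lambda>_ :: 'e. lborel :: real measure" ..
  let ?\<mu> = "PiM E (\<lambda>_. lborel :: real measure)"
  define K' where "K' = {z \<in> space ?\<mu>. z \<in> K}"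
  \<comment> \<open>\<open>S c y\<close> is the translate y + K / c, within the extensional
    functions that carry the Lebesgue product.\<close>
  define S where "S c y = {z \<in> space ?\<mu>. (\<lambda>e\<in>E. c * (z e - y e)) \<in> K'}" for c :: real and y
  have S_iff: "z \<in> S c y \<longleftrightarrow> z \<in> space ?\<mu> \<and> (\<lambda>e. c * (z e - y e)) \<in> K" for c y z
    unfolding S_def K'_def
    by (auto simp: space_PiM intro: K_cong[of "\<lambda>e\<in>E. c * (z e - y e)"] K_cong[of "\<lambda>e. c * (z e - y e)"])
  have K'_meas: "K' \<in> sets ?\<mu>"
  proof -
    \<comment> \<open>\<open>K\<close> is closed in the full function space; extension by zero pulls
      it back to extensional functions.\<close>
    define g where "g z = (\<lambda>e. if e \<in> E then z e else 0)" for z :: "'e \<Rightarrow> real"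
    have "g \<in> measurable ?\<mu> borel"
    proof (rule measurable_coordinatewise_then_product)
      show "(\<lambda>z. g z e) \<in> borel_measurable ?\<mu>" for e
        by (cases "e \<in> E") (simp_all add: g_def)
    qed
    then have "g -` K \<inter> space ?\<mu> \<in> sets ?\<mu>"
      using K_closed by (intro measurable_sets) auto
    moreover have "g z \<in> K \<longleftrightarrow> z \<in> K" for z
      using K_cong[of z "g z"] K_cong[of "g z" z] by (auto simp: g_def)
    ultimately show ?thesis
      unfolding K'_def by (simp add: vimage_def Collect_conj_eq Int_commute)
  qed
  have S_meas: "S c y \<in> sets ?\<mu>" for c y
  proof -
    have "(\<lambda>z. \<lambda>e\<in>E. c * (z e - y e)) \<in> measurable ?\<mu> ?\<mu>"
      by (intro measurable_restrict) simp
    from measurable_sets[OF this K'_meas] show ?thesis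
      unfolding S_def by (simp add: vimage_def Collect_conj_eq Int_commute)
  qed
  have scale: "emeasure ?\<mu> K' = ennreal (c ^ card E) * emeasure ?\<mu> (S c y)" if "0 < c" for c y
    unfolding S_def by (rule emeasure_PiM_lborel_affine_vimage[OF E that K'_meas])
  have "K' \<subseteq> Pi\<^sub>E E (\<lambda>_. {-\<rho>..\<rho>})"
  proof
    fix z assume "z \<in> K'"
    then have z: "z \<in> K" "z \<in> extensional E"
      by (simp_all add: K'_def space_PiM PiE_iff)
    have "z e \<in> {-\<rho>..\<rho>}" if "e \<in> E" for e
      using K_bounded[OF z(1) that] by auto
    then show "z \<in> Pi\<^sub>E E (\<lambda>_. {-\<rho>..\<rho>})"
      using z(2) by (simp add: PiE_iff)
  qed
  then have "emeasure ?\<mu> K' \<le> emeasure ?\<mu> (Pi\<^sub>E E (\<lambda>_. {-\<rho>..\<rho>}))"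
    by (intro emeasure_mono sets_PiM_I_finite E) auto
  also have "\<dots> = (\<Prod>e\<in>E. emeasure lborel {-\<rho>..\<rho>})"
    by (rule emeasure_PiM[OF E]) simp
  also have "\<dots> = ennreal (max 0 (2 * \<rho>)) ^ card E"
    by (simp add: emeasure_lborel_Icc_eq max_def)
  also have "\<dots> = ennreal (max 0 (2 * \<rho>) ^ card E)"
    by (rule ennreal_power) simp
  also have "\<dots> < \<infinity>"
    by simp
  finally have fin: "emeasure ?\<mu> K' < \<infinity>" .
  have "0 < ennreal ((2 * \<delta>) ^ card E)"
    using K_solid(1) by simp
  also have "\<dots> = ennreal (2 * \<delta>) ^ card E"
    using K_solid(1) by (intro ennreal_power[symmetric]) simp
  also have "\<dots> = (\<Prod>e\<in>E. emeasure lborel {-\<delta>..\<delta>})"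
    using K_solid(1) by simp
  also have "\<dots> = emeasure ?\<mu> (Pi\<^sub>E E (\<lambda>_. {-\<delta>..\<delta>}))"
    by (rule emeasure_PiM[OF E, symmetric]) simp
  also have "\<dots> \<le> emeasure ?\<mu> K'"
  proof (rule emeasure_mono[OF _ K'_meas], rule subsetI)
    fix z assume z: "z \<in> Pi\<^sub>E E (\<lambda>_. {-\<delta>..\<delta>})"
    have "z \<in> K"
    proof (rule K_solid(2))
      fix e assume "e \<in> E"
      then have "z e \<in> {-\<delta>..\<delta>}" using z by (simp add: PiE_iff)
      then show "\<bar>z e\<bar> \<le> \<delta>" by auto
    qed
    with z show "z \<in> K'"
      by (simp add: K'_def space_PiM PiE_iff)
  qed
  finally have pos: "0 < emeasure ?\<mu> K'" .
  have card_le: "card F \<le> 5 ^ card E"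
    if F: "finite F" "F \<subseteq> K"
      and sep: "\<And>x y. x \<in> F \<Longrightarrow> y \<in> F \<Longrightarrow> x \<noteq> y \<Longrightarrow> (\<lambda>e. 2 * (x e - y e)) \<notin> K" for F
  proof -
    have disj: "disjoint_family_on (S 4) F"
      unfolding disjoint_family_on_def
    proof (intro ballI impI equals0I)
      fix x y z assume "x \<in> F" "y \<in> F" "x \<noteq> y" and z: "z \<in> S 4 x \<inter> S 4 y"
      \<comment> \<open>A common point z of x + K/4 and y + K/4 would put 2 (x - y) into
        \<open>K\<close>, as the midpoint of -4 (z - x) and 4 (z - y).\<close>
      have "(\<lambda>e. 1 / 2 * (- (4 * (z e - x e))) + 1 / 2 * (4 * (z e - y e))) \<in> K"
        using z by (intro K_convex K_symmetric) (auto simp: S_iff)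
      moreover have "(\<lambda>e. 1 / 2 * (- (4 * (z e - x e))) + 1 / 2 * (4 * (z e - y e))) = (\<lambda>e. 2 * (x e - y e))"
        by (simp add: algebra_simps)
      ultimately show False
        using sep[OF \<open>x \<in> F\<close> \<open>y \<in> F\<close> \<open>x \<noteq> y\<close>] by simp
    qed
    have "of_nat (card F) * emeasure ?\<mu> K' = (\<Sum>y\<in>F. emeasure ?\<mu> K')"
      by simp
    also have "\<dots> = ennreal (4 ^ card E) * (\<Sum>y\<in>F. emeasure ?\<mu> (S 4 y))"
      unfolding sum_distrib_left by (intro sum.cong refl scale) simp
    also have "(\<Sum>y\<in>F. emeasure ?\<mu> (S 4 y)) = emeasure ?\<mu> (\<Union>y\<in>F. S 4 y)"
      using S_meas by (intro sum_emeasure F disj) auto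
    also have "\<dots> \<le> emeasure ?\<mu> (S (4 / 5) (\<lambda>_. 0))"
    proof (rule emeasure_mono[OF _ S_meas], rule UN_least, rule subsetI)
      fix y z assume "y \<in> F" and z: "z \<in> S 4 y"
      \<comment> \<open>If z = y + k / 4 with k in \<open>K\<close>, then (4/5) z = (1/5) k + (4/5)
        y is a convex combination.\<close>
      have "(\<lambda>e. 1 / 5 * (4 * (z e - y e)) + 4 / 5 * y e) \<in> K"
        using z \<open>y \<in> F\<close> F(2) by (intro K_convex) (auto simp: S_iff)
      moreover have "(\<lambda>e. 1 / 5 * (4 * (z e - y e)) + 4 / 5 * y e) = (\<lambda>e. 4 / 5 * (z e - 0))"
        by (simp add: algebra_simps)
      ultimately show "z \<in> S (4 / 5) (\<lambda>_. 0)"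
        using z by (simp add: S_iff)
    qed
    finally have "of_nat (card F) * emeasure ?\<mu> K' \<le> ennreal (4 ^ card E) * emeasure ?\<mu> (S (4 / 5) (\<lambda>_. 0))"
      by (simp add: mult_left_mono)
    \<comment> \<open>The ratio of the scales 5/4 and 1/4 is the 5 of the bound.\<close>
    also have "ennreal (4 ^ card E) = ennreal (5 ^ card E) * ennreal ((4 / 5) ^ card E)"
      by (simp flip: ennreal_mult'' add: power_divide)
    also have "\<dots> * emeasure ?\<mu> (S (4 / 5) (\<lambda>_. 0)) = ennreal (5 ^ card E) * emeasure ?\<mu> K'"
      using scale[of "4 / 5" "\<lambda>_. 0"] by (simp add: mult.assoc)
    finally have "ennreal (real (card F)) * emeasure ?\<mu> K' \<le> ennreal (5 ^ card E) * emeasure ?\<mu> K'"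
      by (simp add: ennreal_of_nat_eq_real_of_nat)
    then have "real (card F) \<le> 5 ^ card E"
      using pos fin by (cases "emeasure ?\<mu> K'") (auto simp flip: ennreal_mult simp: ennreal_less_zero_iff)
    then show ?thesis
      by (metis of_nat_le_iff of_nat_numeral of_nat_power)
  qed
  define sep where "sep F \<longleftrightarrow> finite F \<and> F \<subseteq> K \<and> (\<forall>x\<in>F. \<forall>y\<in>F. x \<noteq> y \<longrightarrow> (\<lambda>e. 2 * (x e - y e)) \<notin> K)" for F
  have "sep {}" by (simp add: sep_def)
  moreover have sep_card: "card F \<le> 5 ^ card E" if "sep F" for F
    using that unfolding sep_def by (intro card_le) auto
  \<comment> \<open>Sizes of separated sets are bounded, so one of maximal size exists; a point that
    it fails to cover could be added to it.\<close>
  ultimately have "\<exists>F. sep F \<and> (\<forall>G. sep G \<longrightarrow> card G \<le> card F)"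
    by (intro ex_has_greatest_nat[of sep "{}" card "Suc (5 ^ card E)"]) (auto simp: less_Suc_eq_le)
  then obtain F where F: "sep F" and max: "\<And>G. sep G \<Longrightarrow> card G \<le> card F"
    by auto
  show thesis
  proof
    show "finite F" "F \<subseteq> K"
      using F by (simp_all add: sep_def)
    show "card F \<le> 5 ^ card E"
      by (rule sep_card[OF F])
    show "\<exists>y\<in>F. (\<lambda>e. 2 * (x e - y e)) \<in> K" if x: "x \<in> K" for x
    proof (rule ccontr)
      assume *: "\<not> ?thesis"
      have "(\<lambda>e. 2 * (x e - x e)) \<in> K"
        using K_solid by simp
      then have "x \<notin> F" using * by blast
      have "(\<lambda>e. 2 * (y e - x e)) \<notin> K" if "y \<in> F" for y
        using K_symmetric[of "\<lambda>e. 2 * (y e - x e)"] * that by (auto simp: algebra_simps)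
      then have "sep (insert x F)"
        using F x * unfolding sep_def by auto
      from max[OF this] show False
        using \<open>x \<notin> F\<close> \<open>finite F\<close> by simp
    qed
  qed
qed

text \<open>The convex body is the operator norm ball in dimension \<open>card I * card J\<close>.
  The approximation is to half the radius in the same norm, which is what the later halving argument
  needs.\<close>

lemma contraction_net:
  fixes I :: "'i::countable set" and J :: "'j::countable set"
  assumes fin: "finite I" "finite J"
  obtains F where "finite F" "card F \<le> 5 ^ (card I * card J)"
    "\<And>A. A \<in> F \<Longrightarrow> contraction I J A"
    "\<And>A. contraction I J A \<Longrightarrow> \<exists>B\<in>F. contraction I J (\<lambda>i j. 2 * (A i j - B i j))"
proof -
  let ?mat = "\<lambda>(x :: 'i \<times> 'j \<Rightarrow> real) i j. x (i, j)"
  define K where "K = {x. contraction I J (?mat x)}"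
  \<comment> \<open>A matrix with entries of size \<delta> has operator norm below one, by counting
    entries; the extra 1 keeps the denominator positive when an index set is empty.\<close>
  define \<delta> where "\<delta> = 1 / (1 + real (card I * card J))"
  have "0 < \<delta>" unfolding \<delta>_def by (simp add: add_pos_nonneg)
  have solid: "x \<in> K" if x: "\<And>e. e \<in> I \<times> J \<Longrightarrow> \<bar>x e\<bar> \<le> \<delta>" for x
    unfolding K_def contraction_def mem_Collect_eq
  proof (intro allI)
    fix u :: "'i \<Rightarrow> real" and v :: "'j \<Rightarrow> real"
    have "\<bar>bil I J (?mat x) u v\<bar> \<le> (\<Sum>i\<in>I. \<Sum>j\<in>J. \<bar>x (i, j) * u i * v j\<bar>)"
      unfolding bil_def by (intro order_trans[OF sum_abs] sum_mono sum_abs)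
    also have "\<dots> \<le> (\<Sum>i\<in>I. \<Sum>j\<in>J. \<delta> * L2_set u I * L2_set v J)"
    proof (intro sum_mono)
      fix i j assume ij: "i \<in> I" "j \<in> J"
      have "\<bar>u i\<bar> \<le> L2_set u I" "\<bar>v j\<bar> \<le> L2_set v J"
        using norm_le_l2_norm[OF fin(1) ij(1), of u] norm_le_l2_norm[OF fin(2) ij(2), of v]
        by (simp_all add: l2_norm_def L2_set_abs)
      then show "\<bar>x (i, j) * u i * v j\<bar> \<le> \<delta> * L2_set u I * L2_set v J"
        unfolding abs_mult using x[of "(i, j)"] ij \<open>0 < \<delta>\<close> by (intro mult_mono) auto
    qed
    also have "\<dots> = (real (card I * card J) * \<delta>) * (L2_set u I * L2_set v J)"
      by simp
    also have "\<dots> \<le> 1 * (L2_set u I * L2_set v J)"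
      by (intro mult_right_mono) (auto simp: \<delta>_def divide_le_eq add_pos_nonneg)
    finally show "\<bar>bil I J (?mat x) u v\<bar> \<le> L2_set u I * L2_set v J" by simp
  qed
  have K1: "closed K"
    unfolding K_def contraction_def bil_def
    by (intro closed_Collect_all closed_Collect_le continuous_on_rabs continuous_on_sum
        continuous_on_mult continuous_on_const continuous_on_product_coordinates)
  have K2: "y \<in> K" if "x \<in> K" "\<And>e. e \<in> I \<times> J \<Longrightarrow> x e = y e" for x y
    using that contraction_cong[of I J "?mat x" "?mat y"] by (simp add: K_def)
  have K3: "(\<lambda>e. a * x e + b * y e) \<in> K" if "x \<in> K" "y \<in> K" "0 \<le> a" "0 \<le> b" "a + b = 1" for x y and a b :: real
    unfolding K_def contraction_def mem_Collect_eq
  proof (intro allI)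
    fix u v
    have "bil I J (\<lambda>i j. a * x (i, j) + b * y (i, j)) u v = a * bil I J (?mat x) u v + b * bil I J (?mat y) u v"
      unfolding bil_def by (simp add: algebra_simps sum.distrib sum_distrib_left)
    then have "\<bar>bil I J (\<lambda>i j. a * x (i, j) + b * y (i, j)) u v\<bar> \<le>
        a * \<bar>bil I J (?mat x) u v\<bar> + b * \<bar>bil I J (?mat y) u v\<bar>"
      using abs_triangle_ineq[of "a * bil I J (?mat x) u v" "b * bil I J (?mat y) u v"] that(3,4)
      by (simp add: abs_mult)
    also have "\<dots> \<le> a * (L2_set u I * L2_set v J) + b * (L2_set u I * L2_set v J)"
      using that unfolding K_def contraction_def by (intro add_mono mult_left_mono) auto
    also have "\<dots> = L2_set u I * L2_set v J"
      using that(5) by (metis distrib_right mult_1)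
    finally show "\<bar>bil I J (\<lambda>i j. a * x (i, j) + b * y (i, j)) u v\<bar> \<le> L2_set u I * L2_set v J" .
  qed
  have K4: "(\<lambda>e. - x e) \<in> K" if "x \<in> K" for x
    using that bil_scale[of I J "-1" "?mat x"] by (simp add: K_def contraction_def)
  have K5: "\<bar>x e\<bar> \<le> 1" if "x \<in> K" "e \<in> I \<times> J" for x e
    using that contraction_entry[of I J "?mat x" "fst e" "snd e"] fin by (auto simp: K_def)
  obtain F where F: "finite F" "F \<subseteq> K" "card F \<le> 5 ^ card (I \<times> J)"
    "\<And>x. x \<in> K \<Longrightarrow> \<exists>y\<in>F. (\<lambda>e. 2 * (x e - y e)) \<in> K"
  proof (rule convex_body_net[of "I \<times> J" K 1 \<delta>])
    show "y \<in> K" if "x \<in> K" "\<And>e. e \<in> I \<times> J \<Longrightarrow> x e = y e" for x y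
      using that by (rule K2)
    show "(\<lambda>e. a * x e + b * y e) \<in> K" if "x \<in> K" "y \<in> K" "0 \<le> a" "0 \<le> b" "a + b = 1" for x y a b
      using that by (rule K3)
    show "\<bar>x e\<bar> \<le> 1" if "x \<in> K" "e \<in> I \<times> J" for x e
      using that by (rule K5)
    show "x \<in> K" if "\<And>e. e \<in> I \<times> J \<Longrightarrow> \<bar>x e\<bar> \<le> \<delta>" for x
      using that by (rule solid)
  qed (use fin K1 K4 \<open>0 < \<delta>\<close> in auto)
  show thesis
  proof
    show "finite (?mat ` F)" using F(1) by simp
    show "card (?mat ` F) \<le> 5 ^ (card I * card J)"
      using card_image_le[OF F(1), of ?mat] F(3) by (simp add: card_cartesian_product)
    show "contraction I J A" if "A \<in> ?mat ` F" for A
      using that F(2) by (auto simp: K_def)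
    fix A assume "contraction I J A"
    then have "case_prod A \<in> K" by (simp add: K_def)
    with F(4) obtain y where "y \<in> F" "(\<lambda>e. 2 * (case_prod A e - y e)) \<in> K" by blast
    then show "\<exists>B\<in>?mat ` F. contraction I J (\<lambda>i j. 2 * (A i j - B i j))"
      by (auto simp: K_def intro!: bexI[of _ y])
  qed
qed

text \<open>With s the supremum of \<open>f\<close> over contractions, splitting off a net point
  gives s \<le> b + s / 2. The a priori bound \<open>\<beta>\<close> makes s finite, so that s / 2
  may be subtracted.\<close>

lemma seminorm_net_bound:
  fixes f :: "('i \<Rightarrow> 'j \<Rightarrow> real) \<Rightarrow> real"
  assumes net: "\<And>A. A \<in> F \<Longrightarrow> contraction I J A"
    "\<And>A. contraction I J A \<Longrightarrow> \<exists>B\<in>F. contraction I J (\<lambda>i j. 2 * (A i j - B i j))"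
    and f: "\<And>A B. f (\<lambda>i j. A i j + 1 / 2 * B i j) \<le> f A + 1 / 2 * f B"
    and bdd: "\<And>A. contraction I J A \<Longrightarrow> f A \<le> \<beta>"
    and b: "\<And>A. A \<in> F \<Longrightarrow> f A \<le> b"
    and A: "contraction I J A"
  shows "f A \<le> 2 * b"
proof -
  let ?s = "Sup (f ` Collect (contraction I J))"
  have bdd_above: "bdd_above (f ` Collect (contraction I J))"
    using bdd by (intro bdd_aboveI[of _ \<beta>]) auto
  have "?s \<le> b + 1 / 2 * ?s"
  proof (rule cSup_least)
    show "f ` Collect (contraction I J) \<noteq> {}" using A by auto
    fix y assume "y \<in> f ` Collect (contraction I J)"
    then obtain C where C: "contraction I J C" "y = f C" by auto
    from net(2)[OF C(1)] obtain B where B: "B \<in> F" "contraction I J (\<lambda>i j. 2 * (C i j - B i j))"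
      by blast
    have "(\<lambda>i j. B i j + 1 / 2 * (2 * (C i j - B i j))) = C"
      by (intro ext) (simp add: field_simps)
    then have "y = f (\<lambda>i j. B i j + 1 / 2 * (2 * (C i j - B i j)))"
      by (simp add: C(2))
    also have "\<dots> \<le> f B + 1 / 2 * f (\<lambda>i j. 2 * (C i j - B i j))"
      by (rule f)
    also have "f (\<lambda>i j. 2 * (C i j - B i j)) \<le> ?s"
      using B(2) by (intro cSup_upper bdd_above) auto
    finally show "y \<le> b + 1 / 2 * ?s"
      using b[OF B(1)] by simp
  qed
  moreover have "f A \<le> ?s"
    using A by (intro cSup_upper bdd_above) auto
  ultimately show ?thesis by simp
qed

section \<open>Exponential moments of Gaussian chaos\<close>

abbreviation std_normal :: "real measure" where
  "std_normal \<equiv> density lborel (\<lambda>x. ennreal (std_normal_density x))"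

lemma prob_space_std_normal: "prob_space std_normal"
  by (rule prob_space_normal_density) simp

lemma nn_integral_normal_density: "0 < s \<Longrightarrow> (\<integral>\<^sup>+x. ennreal (normal_density m s x) \<partial>lborel) = 1"
  using prob_space.emeasure_space_1[OF prob_space_normal_density[of s m]]
  by (simp add: emeasure_density)

text \<open>Completing the square turns the integrand into a multiple of the normal density centred
  at \<open>a\<close>.\<close>

lemma nn_integral_exp_std_normal:
  "(\<integral>\<^sup>+x. ennreal (exp (a * x)) \<partial>std_normal) = ennreal (exp (a\<^sup>2 / 2))"
proof -
  have "(\<integral>\<^sup>+x. ennreal (exp (a * x)) \<partial>std_normal) =
      (\<integral>\<^sup>+x. ennreal (exp (a\<^sup>2 / 2)) * ennreal (normal_density a 1 x) \<partial>lborel)"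
    by (subst nn_integral_density)
      (auto intro!: nn_integral_cong simp: normal_density_def field_simps power2_eq_square
        simp flip: ennreal_mult exp_add)
  then show ?thesis
    by (simp add: nn_integral_cmult nn_integral_normal_density)
qed

text \<open>The exact value is s = (1 - 2 \<beta>)^(-1/2), because the integrand is s times the
  normal density of standard deviation s. The range of \<beta> gives 1 \<le> (1 + 4 \<beta>) (1 - 2
  \<beta>), hence the exponential bound.\<close>

lemma nn_integral_exp_square_std_normal:
  assumes "0 \<le> \<beta>" "\<beta> \<le> 1 / 4"
  shows "(\<integral>\<^sup>+x. ennreal (exp (\<beta> * x\<^sup>2)) \<partial>std_normal) \<le> ennreal (exp (2 * \<beta>))"
proof -
  define s where "s = 1 / sqrt (1 - 2 * \<beta>)"
  have s: "0 < s" "s\<^sup>2 = 1 / (1 - 2 * \<beta>)"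
    using assms by (simp_all add: s_def power_divide)
  have "(\<integral>\<^sup>+x. ennreal (exp (\<beta> * x\<^sup>2)) \<partial>std_normal) = (\<integral>\<^sup>+x. ennreal s * ennreal (normal_density 0 s x) \<partial>lborel)"
  proof (subst nn_integral_density)
    have "std_normal_density x * exp (\<beta> * x\<^sup>2) = s * normal_density 0 s x" for x
    proof -
      have "normal_density 0 s x = 1 / (sqrt (2 * pi) * s) * exp (- x\<^sup>2 / (2 * s\<^sup>2))"
        using s(1) by (simp add: normal_density_def real_sqrt_mult)
      also have "- x\<^sup>2 / (2 * s\<^sup>2) = - x\<^sup>2 / 2 + \<beta> * x\<^sup>2"
        using assms unfolding s(2) by (simp add: field_simps)
      finally show ?thesis
        using s(1) by (simp add: normal_density_def flip: exp_add)
    qed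
    then show "(\<integral>\<^sup>+x. ennreal (std_normal_density x) * ennreal (exp (\<beta> * x\<^sup>2)) \<partial>lborel) =
        (\<integral>\<^sup>+x. ennreal s * ennreal (normal_density 0 s x) \<partial>lborel)"
      using s(1) by (simp flip: ennreal_mult)
  qed auto
  also have "\<dots> = ennreal s"
    using s(1) by (simp add: nn_integral_cmult nn_integral_normal_density)
  also have "s \<le> exp (2 * \<beta>)"
  proof (rule power2_le_imp_le)
    have "1 \<le> (1 + 4 * \<beta>) * (1 - 2 * \<beta>)"
      using assms mult_left_mono[OF assms(2,1)] by (simp add: algebra_simps)
    also have "\<dots> \<le> exp (4 * \<beta>) * (1 - 2 * \<beta>)"
      using assms exp_ge_add_one_self[of "4 * \<beta>"] by (intro mult_right_mono) auto
    finally show "s\<^sup>2 \<le> (exp (2 * \<beta>))\<^sup>2"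
      unfolding s(2) using assms by (simp add: divide_le_eq exp_double[symmetric])
  qed simp
  then have "ennreal s \<le> ennreal (exp (2 * \<beta>))" by (rule ennreal_leI)
  finally show ?thesis .
qed

interpretation gauss: product_sigma_finite "\<lambda>_ :: 'i. std_normal"
  by (intro product_sigma_finite.intro prob_space_imp_sigma_finite prob_space_std_normal)

lemma measurable_component_gauss:
  assumes "e \<in> E"
  shows "(\<lambda>x. x e) \<in> borel_measurable (PiM E (\<lambda>_. std_normal))"
  using measurable_component_singleton[OF assms, of "\<lambda>_. std_normal"]
  by (simp cong: measurable_cong_sets)

lemma sum_square_scale: "(\<Sum>i\<in>I. (c * y i)\<^sup>2) = c\<^sup>2 * (\<Sum>i\<in>I. (y i :: real)\<^sup>2)"
  by (simp add: power_mult_distrib sum_distrib_left)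

text \<open>Stated along an injection \<open>f\<close>, so that it applies to either half of a
  disjoint sum as well as to an index set itself.\<close>

lemma nn_integral_exp_linear_gauss:
  assumes P: "finite P" and f: "inj_on f P"
  shows "(\<integral>\<^sup>+x. ennreal (exp (\<Sum>p\<in>P. a p * x (f p))) \<partial>PiM (f ` P) (\<lambda>_. std_normal)) =
    ennreal (exp ((\<Sum>p\<in>P. (a p)\<^sup>2) / 2))"
proof -
  define b where "b e = a (inv_into P f e)" for e
  have b: "b (f p) = a p" if "p \<in> P" for p
    using that f by (simp add: b_def)
  have "(\<Sum>p\<in>P. a p * x (f p)) = (\<Sum>e\<in>f ` P. b e * x e)" for x
    using f by (simp add: sum.reindex b)
  then have "(\<integral>\<^sup>+x. ennreal (exp (\<Sum>p\<in>P. a p * x (f p))) \<partial>PiM (f ` P) (\<lambda>_. std_normal)) =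
      (\<integral>\<^sup>+x. (\<Prod>e\<in>f ` P. ennreal (exp (b e * x e))) \<partial>PiM (f ` P) (\<lambda>_. std_normal))"
    using P by (simp add: exp_sum prod_ennreal)
  also have "\<dots> = (\<Prod>e\<in>f ` P. \<integral>\<^sup>+x. ennreal (exp (b e * x)) \<partial>std_normal)"
    using P by (intro gauss.product_nn_integral_prod) auto
  also have "\<dots> = (\<Prod>p\<in>P. ennreal (exp ((a p)\<^sup>2 / 2)))"
    using f by (simp add: nn_integral_exp_std_normal prod.reindex b)
  also have "\<dots> = ennreal (exp ((\<Sum>p\<in>P. (a p)\<^sup>2) / 2))"
    using P by (simp add: prod_ennreal exp_sum sum_divide_distrib)
  finally show ?thesis .
qed

lemma nn_integral_exp_square_gauss:
  assumes D: "finite D" and \<beta>: "0 \<le> \<beta>" "\<beta> \<le> 1 / 4"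
  shows "(\<integral>\<^sup>+x. ennreal (exp (\<beta> * (\<Sum>d\<in>D. (x d)\<^sup>2))) \<partial>PiM D (\<lambda>_. std_normal)) \<le>
    ennreal (exp (2 * \<beta> * card D))"
proof -
  have "(\<integral>\<^sup>+x. ennreal (exp (\<beta> * (\<Sum>d\<in>D. (x d)\<^sup>2))) \<partial>PiM D (\<lambda>_. std_normal)) =
      (\<integral>\<^sup>+x. (\<Prod>d\<in>D. ennreal (exp (\<beta> * (x d)\<^sup>2))) \<partial>PiM D (\<lambda>_. std_normal))"
    using D by (simp add: exp_sum prod_ennreal sum_distrib_left)
  also have "\<dots> = (\<Prod>d\<in>D. \<integral>\<^sup>+x. ennreal (exp (\<beta> * x\<^sup>2)) \<partial>std_normal)"
    using D by (intro gauss.product_nn_integral_prod) auto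
  also have "\<dots> \<le> (\<Prod>d\<in>D. ennreal (exp (2 * \<beta>)))"
    using \<beta> by (intro prod_mono_ennreal nn_integral_exp_square_std_normal)
  also have "\<dots> = ennreal (exp (2 * \<beta> * card D))"
    by (simp add: ennreal_power exp_of_nat_mult[symmetric] mult_ac)
  finally show ?thesis .
qed

text \<open>
  The Gaussian vector \<open>h\<close> linearizes the square, \<open>exp (\<beta> |y|\<^sup>2) = E exp (sqrt (2 \<beta>) \<langle>h, y\<rangle>)\<close>; after
  exchanging the two expectations only the transposed contraction applied to \<open>h\<close> remains. Thus the
  Gaussian measure need not be rotated to diagonalize \<open>B\<close>.
\<close>

lemma nn_integral_exp_contraction_gauss:
  assumes fin: "finite D" "finite Q" and f: "inj_on f Q" and B: "contraction D Q B"
    and \<beta>: "0 \<le> \<beta>" "\<beta> \<le> 1 / 4"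
  shows "(\<integral>\<^sup>+x. ennreal (exp (\<beta> * (\<Sum>d\<in>D. (\<Sum>q\<in>Q. B d q * x (f q))\<^sup>2))) \<partial>PiM (f ` Q) (\<lambda>_. std_normal)) \<le>
    ennreal (exp (2 * \<beta> * card D))"
proof -
  let ?G = "\<lambda>E. PiM E (\<lambda>_. std_normal)"
  define y where "y x d = (\<Sum>q\<in>Q. B d q * x (f q))" for x d
  have [measurable]: "(\<lambda>x. x (f q)) \<in> borel_measurable (?G (f ` Q))" if "q \<in> Q" for q
    using that by (intro measurable_component_gauss) auto
  interpret pair_sigma_finite "?G (f ` Q)" "?G D"
    by (intro pair_sigma_finite.intro gauss.sigma_finite fin finite_imageI)
  have lin: "ennreal (exp (\<beta> * (\<Sum>d\<in>D. (y x d)\<^sup>2))) =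
      (\<integral>\<^sup>+h. ennreal (exp (\<Sum>d\<in>D. (sqrt (2 * \<beta>) * y x d) * h d)) \<partial>?G D)" for x
    using nn_integral_exp_linear_gauss[of D "\<lambda>d. d" "\<lambda>d. sqrt (2 * \<beta>) * y x d"] fin(1) \<beta>(1)
    unfolding sum_square_scale by simp
  have "(\<integral>\<^sup>+x. ennreal (exp (\<beta> * (\<Sum>d\<in>D. (y x d)\<^sup>2))) \<partial>?G (f ` Q)) =
      (\<integral>\<^sup>+x. (\<integral>\<^sup>+h. ennreal (exp (\<Sum>d\<in>D. (sqrt (2 * \<beta>) * y x d) * h d)) \<partial>?G D) \<partial>?G (f ` Q))"
    unfolding lin ..
  also have "\<dots> = (\<integral>\<^sup>+h. (\<integral>\<^sup>+x. ennreal (exp (\<Sum>d\<in>D. (sqrt (2 * \<beta>) * y x d) * h d)) \<partial>?G (f ` Q)) \<partial>?G D)"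
    unfolding y_def by (rule Fubini'[symmetric]) measurable
  also have "\<dots> = (\<integral>\<^sup>+h. ennreal (exp (\<beta> * (\<Sum>q\<in>Q. (\<Sum>d\<in>D. B d q * h d)\<^sup>2))) \<partial>?G D)"
  proof (intro nn_integral_cong)
    fix h
    have "(\<Sum>d\<in>D. (sqrt (2 * \<beta>) * y x d) * h d) = (\<Sum>q\<in>Q. (sqrt (2 * \<beta>) * (\<Sum>d\<in>D. B d q * h d)) * x (f q))" for x
      unfolding y_def sum_distrib_left sum_distrib_right by (subst sum.swap) (simp add: mult_ac)
    then show "(\<integral>\<^sup>+x. ennreal (exp (\<Sum>d\<in>D. (sqrt (2 * \<beta>) * y x d) * h d)) \<partial>?G (f ` Q)) =
        ennreal (exp (\<beta> * (\<Sum>q\<in>Q. (\<Sum>d\<in>D. B d q * h d)\<^sup>2)))"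
      using nn_integral_exp_linear_gauss[OF fin(2) f, of "\<lambda>q. sqrt (2 * \<beta>) * (\<Sum>d\<in>D. B d q * h d)"] \<beta>(1)
      unfolding sum_square_scale by simp
  qed
  also have "\<dots> \<le> (\<integral>\<^sup>+h. ennreal (exp (\<beta> * (\<Sum>d\<in>D. (h d)\<^sup>2))) \<partial>?G D)"
  proof (intro nn_integral_mono ennreal_leI)
    fix h
    have "L2_set (\<lambda>q. \<Sum>d\<in>D. B d q * h d) Q \<le> L2_set h D"
      using contraction_apply[of Q D "\<lambda>q d. B d q"] B by (simp add: contraction_flip[of Q D B])
    then have "(L2_set (\<lambda>q. \<Sum>d\<in>D. B d q * h d) Q)\<^sup>2 \<le> (L2_set h D)\<^sup>2"
      by (intro power_mono) auto
    then show "exp (\<beta> * (\<Sum>q\<in>Q. (\<Sum>d\<in>D. B d q * h d)\<^sup>2)) \<le> exp (\<beta> * (\<Sum>d\<in>D. (h d)\<^sup>2))"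
      unfolding L2_set_square using \<beta>(1) by (simp add: mult_left_mono)
  qed
  also have "\<dots> \<le> ennreal (exp (2 * \<beta> * card D))"
    by (rule nn_integral_exp_square_gauss[OF fin(1) \<beta>])
  finally show ?thesis unfolding y_def .
qed

text \<open>For a fixed second family the chaos is linear in the first. Integrating the first out
  leaves the exponential of a square, with \<beta> = \<theta>^2 / 2, from which the contraction
  \<open>A\<close> can be removed; only the intermediate dimension \<open>card D\<close>
  survives.\<close>

lemma nn_integral_exp_decoupled_chaos_gauss:
  fixes A :: "'p \<Rightarrow> 'd \<Rightarrow> real" and B :: "'d \<Rightarrow> 'q \<Rightarrow> real"
  assumes fin: "finite P" "finite D" "finite Q" and A: "contraction P D A" and B: "contraction D Q B"
    and \<theta>: "\<theta>\<^sup>2 \<le> 1 / 2"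
  shows "(\<integral>\<^sup>+x. ennreal (exp (\<theta> * (\<Sum>p\<in>P. x (Inl p) * (\<Sum>d\<in>D. A p d * (\<Sum>q\<in>Q. B d q * x (Inr q))))))
      \<partial>PiM (P <+> Q) (\<lambda>_. std_normal)) \<le> ennreal (exp (\<theta>\<^sup>2 * card D))"
proof -
  let ?G = "\<lambda>E. PiM E (\<lambda>_ :: 'p + 'q. std_normal)"
  define z where "z x p = (\<Sum>d\<in>D. A p d * (\<Sum>q\<in>Q. B d q * x (Inr q)))" for x :: "'p + 'q \<Rightarrow> real" and p
  have [measurable]: "(\<lambda>x. x (Inr q)) \<in> borel_measurable (?G (Inr ` Q))" if "q \<in> Q" for q
    using that by (intro measurable_component_gauss) auto
  have [measurable]: "(\<lambda>x. x (Inl p)) \<in> borel_measurable (?G (Inl ` P))" if "p \<in> P" for p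
    using that by (intro measurable_component_gauss) auto
  have [measurable]: "(\<lambda>x. x (Inl p)) \<in> borel_measurable (?G (Inl ` P \<union> Inr ` Q))" if "p \<in> P" for p
    using that by (intro measurable_component_gauss) auto
  have [measurable]: "(\<lambda>x. x (Inr q)) \<in> borel_measurable (?G (Inl ` P \<union> Inr ` Q))" if "q \<in> Q" for q
    using that by (intro measurable_component_gauss) auto
  interpret pair_sigma_finite "?G (Inl ` P)" "?G (Inr ` Q)"
    by (intro pair_sigma_finite.intro gauss.sigma_finite fin finite_imageI)
  have disj: "Inl ` P \<inter> Inr ` Q = {}" by auto
  have merge_l: "merge (Inl ` P) (Inr ` Q) (x, y) (Inl p) = x (Inl p)" if "p \<in> P"
    for x y :: "'p + 'q \<Rightarrow> real" and p
    using that by (auto simp: merge_def)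
  have merge_r: "merge (Inl ` P) (Inr ` Q) (x, y) (Inr q) = y (Inr q)" if "q \<in> Q"
    for x y :: "'p + 'q \<Rightarrow> real" and q
    using that by (auto simp: merge_def)
  have "(\<integral>\<^sup>+x. ennreal (exp (\<theta> * (\<Sum>p\<in>P. x (Inl p) * z x p))) \<partial>?G (P <+> Q)) =
      (\<integral>\<^sup>+x. \<integral>\<^sup>+y. ennreal (exp (\<theta> * (\<Sum>p\<in>P. merge (Inl ` P) (Inr ` Q) (x, y) (Inl p) *
        z (merge (Inl ` P) (Inr ` Q) (x, y)) p))) \<partial>?G (Inr ` Q) \<partial>?G (Inl ` P))"
    unfolding Plus_def z_def
    by (rule gauss.product_nn_integral_fold[OF disj finite_imageI[OF fin(1)] finite_imageI[OF fin(3)]]) measurable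
  also have "\<dots> = (\<integral>\<^sup>+x. \<integral>\<^sup>+y. ennreal (exp (\<theta> * (\<Sum>p\<in>P. x (Inl p) * z y p))) \<partial>?G (Inr ` Q) \<partial>?G (Inl ` P))"
    unfolding z_def by (simp add: merge_l merge_r cong: sum.cong_simp)
  also have "\<dots> = (\<integral>\<^sup>+y. \<integral>\<^sup>+x. ennreal (exp (\<theta> * (\<Sum>p\<in>P. x (Inl p) * z y p))) \<partial>?G (Inl ` P) \<partial>?G (Inr ` Q))"
    unfolding z_def by (rule Fubini'[symmetric]) measurable
  also have "\<dots> = (\<integral>\<^sup>+y. ennreal (exp (\<theta>\<^sup>2 / 2 * (\<Sum>p\<in>P. (z y p)\<^sup>2))) \<partial>?G (Inr ` Q))"
  proof (intro nn_integral_cong)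
    fix y
    have "\<theta> * (\<Sum>p\<in>P. x (Inl p) * z y p) = (\<Sum>p\<in>P. (\<theta> * z y p) * x (Inl p))" for x :: "'p + 'q \<Rightarrow> real"
      by (simp add: sum_distrib_left mult_ac)
    then show "(\<integral>\<^sup>+x. ennreal (exp (\<theta> * (\<Sum>p\<in>P. x (Inl p) * z y p))) \<partial>?G (Inl ` P)) =
        ennreal (exp (\<theta>\<^sup>2 / 2 * (\<Sum>p\<in>P. (z y p)\<^sup>2)))"
      using nn_integral_exp_linear_gauss[OF fin(1), of "Inl :: 'p \<Rightarrow> 'p + 'q" "\<lambda>p. \<theta> * z y p"]
      unfolding sum_square_scale by simp
  qed
  also have "\<dots> \<le> (\<integral>\<^sup>+y. ennreal (exp (\<theta>\<^sup>2 / 2 * (\<Sum>d\<in>D. (\<Sum>q\<in>Q. B d q * y (Inr q))\<^sup>2))) \<partial>?G (Inr ` Q))"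
  proof (intro nn_integral_mono ennreal_leI)
    fix y :: "'p + 'q \<Rightarrow> real"
    have "(L2_set (z y) P)\<^sup>2 \<le> (L2_set (\<lambda>d. \<Sum>q\<in>Q. B d q * y (Inr q)) D)\<^sup>2"
      unfolding z_def by (intro power_mono contraction_apply A L2_set_nonneg)
    then show "exp (\<theta>\<^sup>2 / 2 * (\<Sum>p\<in>P. (z y p)\<^sup>2)) \<le>
        exp (\<theta>\<^sup>2 / 2 * (\<Sum>d\<in>D. (\<Sum>q\<in>Q. B d q * y (Inr q))\<^sup>2))"
      unfolding L2_set_square by (simp add: mult_left_mono)
  qed
  also have "\<dots> \<le> ennreal (exp (2 * (\<theta>\<^sup>2 / 2) * card D))"
    using \<theta> by (intro nn_integral_exp_contraction_gauss fin B) auto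
  finally show ?thesis unfolding z_def by simp
qed

text \<open>Independence identifies the joint law with the product of the marginals, so integrals
  over an arbitrary probability space become integrals over the canonical one.\<close>

lemma (in prob_space) nn_integral_indep_std_normal:
  assumes "I \<noteq> {}" and indep: "indep_vars (\<lambda>_. borel) Z I"
    and dist: "\<And>i. i \<in> I \<Longrightarrow> distributed M lborel (Z i) (\<lambda>x. ennreal (std_normal_density x))"
    and F: "F \<in> borel_measurable (PiM I (\<lambda>_. std_normal))"
  shows "(\<integral>\<^sup>+\<omega>. F (\<lambda>i\<in>I. Z i \<omega>) \<partial>M) = (\<integral>\<^sup>+x. F x \<partial>PiM I (\<lambda>_. std_normal))"
proof -
  have rv: "random_variable borel (Z i)" if "i \<in> I" for i
    using indep that by (simp add: indep_vars_def)
  have sets: "sets (PiM I (\<lambda>_. borel :: real measure)) = sets (PiM I (\<lambda>_. std_normal))"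
    by (intro sets_PiM_cong) auto
  have "distr M (PiM I (\<lambda>_. borel)) (\<lambda>\<omega>. \<lambda>i\<in>I. Z i \<omega>) = PiM I (\<lambda>i. distr M borel (Z i))"
    using indep_vars_iff_distr_eq_PiM'[OF assms(1) rv] indep by simp
  also have "\<dots> = PiM I (\<lambda>_. std_normal)"
  proof (intro PiM_cong refl)
    fix i assume "i \<in> I"
    have "distr M borel (Z i) = distr M lborel (Z i)"
      by (intro distr_cong) auto
    then show "distr M borel (Z i) = std_normal"
      using distributed_distr_eq_density[OF dist[OF \<open>i \<in> I\<close>]] by simp
  qed
  finally have distr: "distr M (PiM I (\<lambda>_. borel)) (\<lambda>\<omega>. \<lambda>i\<in>I. Z i \<omega>) = PiM I (\<lambda>_. std_normal)" .
  have "(\<integral>\<^sup>+\<omega>. F (\<lambda>i\<in>I. Z i \<omega>) \<partial>M) = (\<integral>\<^sup>+x. F x \<partial>distr M (PiM I (\<lambda>_. borel)) (\<lambda>\<omega>. \<lambda>i\<in>I. Z i \<omega>))"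
    using F rv by (subst nn_integral_distr) (auto intro!: measurable_restrict simp: measurable_cong_sets[OF sets refl])
  then show ?thesis unfolding distr .
qed

section \<open>The trilinear form\<close>

abbreviation cube :: "nat \<Rightarrow> (nat \<times> nat \<times> nat) set" where
  "cube N \<equiv> {1..N} \<times> {1..N} \<times> {1..N}"

text \<open>Grouping the six indices into two triples displays a single matrix between two
  independent Gaussian vectors, as the chaos estimate wants it; the norms of the theorem group the
  same indices into three pairs.\<close>

definition triform ::
    "nat \<Rightarrow> (nat \<times> nat \<times> nat \<Rightarrow> 'k) \<Rightarrow> (nat \<times> nat \<times> nat \<Rightarrow> 'k) \<Rightarrow>
      (nat \<Rightarrow> nat \<Rightarrow> 'k) \<Rightarrow> (nat \<Rightarrow> nat \<Rightarrow> 'k) \<Rightarrow> (nat \<Rightarrow> nat \<Rightarrow> 'k::comm_ring_1) \<Rightarrow> 'k" where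
  "triform N x x' R S T = (\<Sum>p\<in>cube N. \<Sum>q\<in>cube N. tensor R (tensor S T) p q * x p * x' q)"

abbreviation hs_norm :: "nat \<Rightarrow> (nat \<Rightarrow> nat \<Rightarrow> 'k::real_normed_field) \<Rightarrow> real" where
  "hs_norm N R \<equiv> l2_norm (sq N) (case_prod R)"

definition matprod :: "nat \<Rightarrow> ('i \<Rightarrow> nat \<Rightarrow> real) \<Rightarrow> (nat \<Rightarrow> 'j \<Rightarrow> real) \<Rightarrow> 'i \<Rightarrow> 'j \<Rightarrow> real" where
  "matprod r A B i j = (\<Sum>\<alpha><r. A i \<alpha> * B \<alpha> j)"

lemma contraction_matprod:
  "contraction I {..<r} A \<Longrightarrow> contraction {..<r} J B \<Longrightarrow> contraction I J (matprod r A B)"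
  unfolding matprod_def[abs_def] by (rule contraction_comp)

lemma matprod_add_left:
  "matprod r (\<lambda>i j. A i j + c * A' i j) B = (\<lambda>i j. matprod r A B i j + c * matprod r A' B i j)"
  by (intro ext) (simp add: matprod_def algebra_simps sum.distrib sum_distrib_left)

lemma matprod_add_right:
  "matprod r A (\<lambda>i j. B i j + c * B' i j) = (\<lambda>i j. matprod r A B i j + c * matprod r A B' i j)"
  by (intro ext) (simp add: matprod_def algebra_simps sum.distrib sum_distrib_left)

lemma triform_add:
  "triform N x x' (\<lambda>i j. R i j + c * R' i j) S T = triform N x x' R S T + c * triform N x x' R' S T"
  "triform N x x' R (\<lambda>i j. S i j + c * S' i j) T = triform N x x' R S T + c * triform N x x' R S' T"
  "triform N x x' R S (\<lambda>i j. T i j + c * T' i j) = triform N x x' R S T + c * triform N x x' R S T'"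
  by (simp_all add: triform_def tensor_def distrib_left distrib_right sum.distrib sum_distrib_left mult_ac)

text \<open>A crude bound depending on the sample; it supplies the finiteness that the net argument
  requires.\<close>

lemma triform_le:
  fixes x :: "nat \<times> nat \<times> nat \<Rightarrow> real"
  assumes "contraction {1..N} {1..N} R" "contraction {1..N} {1..N} S" "contraction {1..N} {1..N} T"
  shows "\<bar>triform N x x' R S T\<bar> \<le> L2_set x (cube N) * L2_set x' (cube N)"
  using contraction_tensor[OF assms(1) contraction_tensor[OF assms(2,3)]]
  unfolding triform_def contraction_def bil_def by blast

lemma sum_tensor_mult:
  fixes A A' :: "_ \<Rightarrow> _ \<Rightarrow> 'k::comm_semiring_0"
  shows "(\<Sum>d\<in>J \<times> J'. tensor A A' p d * tensor B B' d q) =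
    (\<Sum>j\<in>J. A (fst p) j * B j (fst q)) * (\<Sum>j\<in>J'. A' (snd p) j * B' j (snd q))"
  unfolding sum_product sum.cartesian_product tensor_def
  by (intro sum.cong refl) (auto simp: mult_ac)

text \<open>Three rank factorizations combine into one through the product dimension r s t, which
  becomes the \<open>card D\<close> of the chaos estimate.\<close>

lemma tensor_matprod:
  "tensor (matprod r A B) (tensor (matprod s A' B') (matprod t A'' B'')) p q =
    (\<Sum>d\<in>{..<r} \<times> {..<s} \<times> {..<t}. tensor A (tensor A' A'') p d * tensor B (tensor B' B'') d q)"
  unfolding sum_tensor_mult by (simp add: tensor_def matprod_def)

lemma linear_net_bound:
  fixes \<phi> :: "('i \<Rightarrow> 'j \<Rightarrow> real) \<Rightarrow> real"
  assumes net: "\<And>A. A \<in> F \<Longrightarrow> contraction I J A"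
    "\<And>A. contraction I J A \<Longrightarrow> \<exists>B\<in>F. contraction I J (\<lambda>i j. 2 * (A i j - B i j))"
    and lin: "\<And>A B. \<phi> (\<lambda>i j. A i j + 1 / 2 * B i j) = \<phi> A + 1 / 2 * \<phi> B"
    and bdd: "\<And>A. contraction I J A \<Longrightarrow> \<bar>\<phi> A\<bar> \<le> \<beta>"
    and b: "\<And>A. A \<in> F \<Longrightarrow> \<bar>\<phi> A\<bar> \<le> b"
    and A: "contraction I J A"
  shows "\<bar>\<phi> A\<bar> \<le> 2 * b"
proof (rule seminorm_net_bound[where f = "\<lambda>A. \<bar>\<phi> A\<bar>" and F = F, OF net _ bdd b A])
  show "\<bar>\<phi> (\<lambda>i j. A i j + 1 / 2 * B i j)\<bar> \<le> \<bar>\<phi> A\<bar> + 1 / 2 * \<bar>\<phi> B\<bar>" for A B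
    unfolding lin using abs_triangle_ineq[of "\<phi> A" "1 / 2 * \<phi> B"] by simp
qed

text \<open>The six factors are released from their nets one after the other; each release doubles
  the bound, and 64 = 2^6.\<close>

lemma triform_net_bound:
  fixes x :: "nat \<times> nat \<times> nat \<Rightarrow> real"
  assumes F: "\<And>r A. A \<in> F r \<Longrightarrow> contraction {1..N} {..<r} A"
    "\<And>r A. contraction {1..N} {..<r} A \<Longrightarrow> \<exists>B\<in>F r. contraction {1..N} {..<r} (\<lambda>i j. 2 * (A i j - B i j))"
    and G: "\<And>r A. A \<in> G r \<Longrightarrow> contraction {..<r} {1..N} A"
    "\<And>r A. contraction {..<r} {1..N} A \<Longrightarrow> \<exists>B\<in>G r. contraction {..<r} {1..N} (\<lambda>i j. 2 * (A i j - B i j))"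
    and b: "\<And>A B A' B' A'' B''. A \<in> F r \<Longrightarrow> B \<in> G r \<Longrightarrow> A' \<in> F s \<Longrightarrow> B' \<in> G s \<Longrightarrow> A'' \<in> F t \<Longrightarrow> B'' \<in> G t \<Longrightarrow>
      \<bar>triform N x x' (matprod r A B) (matprod s A' B') (matprod t A'' B'')\<bar> \<le> b"
    and con: "contraction {1..N} {..<r} A" "contraction {..<r} {1..N} B"
      "contraction {1..N} {..<s} A'" "contraction {..<s} {1..N} B'"
      "contraction {1..N} {..<t} A''" "contraction {..<t} {1..N} B''"
  shows "\<bar>triform N x x' (matprod r A B) (matprod s A' B') (matprod t A'' B'')\<bar> \<le> 64 * b"
proof -
  let ?\<Phi> = "\<lambda>A B A' B' A'' B''. triform N x x' (matprod r A B) (matprod s A' B') (matprod t A'' B'')"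
  note lin = matprod_add_left matprod_add_right triform_add
  note le = triform_le[OF contraction_matprod contraction_matprod contraction_matprod]
  have 1: "\<bar>?\<Phi> A B A' B' A'' B''\<bar> \<le> 2 * b"
    if "B \<in> G r" "A' \<in> F s" "B' \<in> G s" "A'' \<in> F t" "B'' \<in> G t" "contraction {1..N} {..<r} A" for A B A' B' A'' B''
    by (rule linear_net_bound[where \<phi> = "\<lambda>A. ?\<Phi> A B A' B' A'' B''", OF F(1) F(2) _ le b that(6)])
      (use that in \<open>auto simp only: lin intro: F(1) G(1)\<close>)
  have 2: "\<bar>?\<Phi> A B A' B' A'' B''\<bar> \<le> 2 * (2 * b)"
    if "A' \<in> F s" "B' \<in> G s" "A'' \<in> F t" "B'' \<in> G t" "contraction {1..N} {..<r} A" "contraction {..<r} {1..N} B"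
    for A B A' B' A'' B''
    by (rule linear_net_bound[where \<phi> = "\<lambda>B. ?\<Phi> A B A' B' A'' B''", OF G(1) G(2) _ le 1 that(6)])
      (use that in \<open>auto simp only: lin intro: F(1) G(1)\<close>)
  have 3: "\<bar>?\<Phi> A B A' B' A'' B''\<bar> \<le> 2 * (2 * (2 * b))"
    if "B' \<in> G s" "A'' \<in> F t" "B'' \<in> G t" "contraction {1..N} {..<r} A" "contraction {..<r} {1..N} B"
      "contraction {1..N} {..<s} A'"
    for A B A' B' A'' B''
    by (rule linear_net_bound[where \<phi> = "\<lambda>A'. ?\<Phi> A B A' B' A'' B''", OF F(1) F(2) _ le 2 that(6)])
      (use that in \<open>auto simp only: lin intro: F(1) G(1)\<close>)
  have 4: "\<bar>?\<Phi> A B A' B' A'' B''\<bar> \<le> 2 * (2 * (2 * (2 * b)))"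
    if "A'' \<in> F t" "B'' \<in> G t" "contraction {1..N} {..<r} A" "contraction {..<r} {1..N} B"
      "contraction {1..N} {..<s} A'" "contraction {..<s} {1..N} B'"
    for A B A' B' A'' B''
    by (rule linear_net_bound[where \<phi> = "\<lambda>B'. ?\<Phi> A B A' B' A'' B''", OF G(1) G(2) _ le 3 that(6)])
      (use that in \<open>auto simp only: lin intro: F(1) G(1)\<close>)
  have 5: "\<bar>?\<Phi> A B A' B' A'' B''\<bar> \<le> 2 * (2 * (2 * (2 * (2 * b))))"
    if "B'' \<in> G t" "contraction {1..N} {..<r} A" "contraction {..<r} {1..N} B"
      "contraction {1..N} {..<s} A'" "contraction {..<s} {1..N} B'" "contraction {1..N} {..<t} A''"
    for A B A' B' A'' B''
    by (rule linear_net_bound[where \<phi> = "\<lambda>A''. ?\<Phi> A B A' B' A'' B''", OF F(1) F(2) _ le 4 that(6)])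
      (use that in \<open>auto simp only: lin intro: F(1) G(1)\<close>)
  have "\<bar>?\<Phi> A B A' B' A'' B''\<bar> \<le> 2 * (2 * (2 * (2 * (2 * (2 * b)))))"
    by (rule linear_net_bound[where \<phi> = "\<lambda>B''. ?\<Phi> A B A' B' A'' B''", OF G(1) G(2) _ le 5 con(6)])
      (use con in \<open>auto simp only: lin intro: F(1) G(1)\<close>)
  then show ?thesis by simp
qed

text \<open>
  A bound with a random error term of small mean. It yields an estimate in expectation and, by
  Markov's inequality, one in probability.
\<close>

definition dominated :: "'a measure \<Rightarrow> real \<Rightarrow> ('a \<Rightarrow> real \<Rightarrow> bool) \<Rightarrow> bool" where
  "dominated M \<epsilon> Q \<longleftrightarrow> (\<exists>H\<in>borel_measurable M. (\<forall>\<omega>. 0 \<le> H \<omega>) \<and>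
     (\<integral>\<^sup>+\<omega>. ennreal (H \<omega>) \<partial>M) \<le> ennreal \<epsilon> \<and> (\<forall>\<omega>. Q \<omega> (H \<omega>)))"

lemma dominatedE:
  assumes "dominated M \<epsilon> Q"
  obtains H where "H \<in> borel_measurable M" "\<And>\<omega>. 0 \<le> H \<omega>"
    "(\<integral>\<^sup>+\<omega>. ennreal (H \<omega>) \<partial>M) \<le> ennreal \<epsilon>" "\<And>\<omega>. Q \<omega> (H \<omega>)"
  using assms unfolding dominated_def by auto

lemma dominated_mono:
  assumes Q: "dominated M \<epsilon> Q" and "\<epsilon> \<le> \<epsilon>'" and mono: "\<And>\<omega> h. 0 \<le> h \<Longrightarrow> Q \<omega> h \<Longrightarrow> Q' \<omega> h"
  shows "dominated M \<epsilon>' Q'"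
proof -
  obtain H where H: "H \<in> borel_measurable M" "\<And>\<omega>. 0 \<le> H \<omega>"
    "(\<integral>\<^sup>+\<omega>. ennreal (H \<omega>) \<partial>M) \<le> ennreal \<epsilon>" "\<And>\<omega>. Q \<omega> (H \<omega>)"
    by (rule dominatedE[OF Q], rule that)
  have "(\<integral>\<^sup>+\<omega>. ennreal (H \<omega>) \<partial>M) \<le> ennreal \<epsilon>'"
    using H(3) ennreal_leI[OF assms(2)] by (rule order_trans)
  with H show ?thesis
    unfolding dominated_def by (intro bexI[of _ H]) (auto intro: mono)
qed

text \<open>Union bound: the sum of the individual error terms exceeds each of them, and the
  conditions are monotone in the error.\<close>

lemma dominated_all:
  assumes T: "finite T" and \<epsilon>: "0 \<le> \<epsilon>" and Q: "\<And>p. p \<in> T \<Longrightarrow> dominated M \<epsilon> (Q p)"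
    and mono: "\<And>p \<omega> x y. p \<in> T \<Longrightarrow> Q p \<omega> x \<Longrightarrow> x \<le> y \<Longrightarrow> Q p \<omega> y"
  shows "dominated M (real (card T) * \<epsilon>) (\<lambda>\<omega> h. \<forall>p\<in>T. Q p \<omega> h)"
proof -
  obtain F where F: "\<And>p. p \<in> T \<Longrightarrow> F p \<in> borel_measurable M" "\<And>p \<omega>. p \<in> T \<Longrightarrow> 0 \<le> F p \<omega>"
    "\<And>p. p \<in> T \<Longrightarrow> (\<integral>\<^sup>+\<omega>. ennreal (F p \<omega>) \<partial>M) \<le> ennreal \<epsilon>" "\<And>p \<omega>. p \<in> T \<Longrightarrow> Q p \<omega> (F p \<omega>)"
    using bchoice[of T "\<lambda>p H. H \<in> borel_measurable M \<and> (\<forall>\<omega>. 0 \<le> H \<omega>) \<and>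
      (\<integral>\<^sup>+\<omega>. ennreal (H \<omega>) \<partial>M) \<le> ennreal \<epsilon> \<and> (\<forall>\<omega>. Q p \<omega> (H \<omega>))"] Q
    unfolding dominated_def by blast
  define H where "H \<omega> = (\<Sum>p\<in>T. F p \<omega>)" for \<omega>
  have "(\<integral>\<^sup>+\<omega>. ennreal (H \<omega>) \<partial>M) = (\<integral>\<^sup>+\<omega>. (\<Sum>p\<in>T. ennreal (F p \<omega>)) \<partial>M)"
    unfolding H_def by (simp add: F(2))
  also have "\<dots> = (\<Sum>p\<in>T. \<integral>\<^sup>+\<omega>. ennreal (F p \<omega>) \<partial>M)"
    by (intro nn_integral_sum measurable_compose[OF F(1) measurable_ennreal])
  also have "\<dots> \<le> (\<Sum>p\<in>T. ennreal \<epsilon>)"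
    by (intro sum_mono F(3))
  also have "\<dots> = ennreal (real (card T) * \<epsilon>)"
    using \<epsilon> by (simp add: ennreal_of_nat_eq_real_of_nat ennreal_mult)
  finally have "(\<integral>\<^sup>+\<omega>. ennreal (H \<omega>) \<partial>M) \<le> ennreal (real (card T) * \<epsilon>)" .
  moreover have "H \<in> borel_measurable M"
    unfolding H_def[abs_def] by (intro borel_measurable_sum F(1))
  moreover have "F p \<omega> \<le> H \<omega>" if "p \<in> T" for p \<omega>
    unfolding H_def using that T by (intro member_le_sum) (simp_all add: F(2))
  then have "Q p \<omega> (H \<omega>)" if "p \<in> T" for p \<omega>
    using mono[OF that F(4)[OF that]] that by blast
  moreover have "0 \<le> H \<omega>" for \<omega>
    unfolding H_def by (intro sum_nonneg F(2))
  ultimately show ?thesis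
    unfolding dominated_def by blast
qed

text \<open>Since y \<le> L + exp (y - L), the sum over \<open>G\<close> of exp (Y - L) serves as
  error term. The level \<open>L\<close> pays for the log moment \<open>\<tau>\<close>, the log
  cardinality \<open>\<gamma>\<close> and the gain \<open>c\<close>.\<close>

lemma exp_moment_dominated:
  assumes fin: "finite G" and Y[measurable]: "\<And>a. a \<in> G \<Longrightarrow> Y a \<in> borel_measurable M"
    and exp: "\<And>a. a \<in> G \<Longrightarrow> (\<integral>\<^sup>+\<omega>. ennreal (exp (Y a \<omega>)) \<partial>M) \<le> ennreal (exp \<tau>)"
    and card: "real (card G) \<le> exp \<gamma>" and L: "\<tau> + \<gamma> + c \<le> L"
  shows "dominated M (exp (- c)) (\<lambda>\<omega> h. \<forall>a\<in>G. Y a \<omega> \<le> L + h)"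
proof -
  have "dominated M (exp (\<tau> - L)) (\<lambda>\<omega> h. Y a \<omega> \<le> L + h)" if a: "a \<in> G" for a
    unfolding dominated_def
  proof (intro bexI[of _ "\<lambda>\<omega>. exp (Y a \<omega> - L)"] conjI allI)
    show "(\<lambda>\<omega>. exp (Y a \<omega> - L)) \<in> borel_measurable M"
      using Y[OF a] by simp
    have "(\<integral>\<^sup>+\<omega>. ennreal (exp (Y a \<omega> - L)) \<partial>M) = ennreal (exp (- L)) * (\<integral>\<^sup>+\<omega>. ennreal (exp (Y a \<omega>)) \<partial>M)"
      using Y[OF a] by (simp flip: nn_integral_cmult ennreal_mult exp_add)
    also have "\<dots> \<le> ennreal (exp (- L)) * ennreal (exp \<tau>)"
      by (intro mult_left_mono exp a) simp
    also have "\<dots> = ennreal (exp (\<tau> - L))"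
      by (simp flip: ennreal_mult exp_add)
    finally show "(\<integral>\<^sup>+\<omega>. ennreal (exp (Y a \<omega> - L)) \<partial>M) \<le> ennreal (exp (\<tau> - L))" .
    show "Y a \<omega> \<le> L + exp (Y a \<omega> - L)" for \<omega>
      using exp_ge_add_one_self[of "Y a \<omega> - L"] by linarith
  qed simp
  then have dom: "dominated M (real (card G) * exp (\<tau> - L)) (\<lambda>\<omega> h. \<forall>a\<in>G. Y a \<omega> \<le> L + h)"
    by (intro dominated_all fin) auto
  have "real (card G) * exp (\<tau> - L) \<le> exp \<gamma> * exp (\<tau> - L)"
    by (intro mult_right_mono card) auto
  also have "\<dots> = exp (\<gamma> + \<tau> - L)" by (simp flip: exp_add)
  also have "\<dots> \<le> exp (- c)" using L by simp
  finally show ?thesis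
    by (rule dominated_mono[OF dom])
qed

section \<open>Independent Gaussian families\<close>

lemma (in prob_space) indep_vars_reindex:
  assumes h: "inj_on h I" and indep: "indep_vars M' X (h ` I)"
  shows "indep_vars (\<lambda>i. M' (h i)) (\<lambda>i. X (h i)) I"
proof -
  let ?F = "\<lambda>i. {X i -` A \<inter> space M | A. A \<in> sets (M' i)}"
  have sets: "indep_sets ?F (h ` I)" and rv: "\<And>i. i \<in> I \<Longrightarrow> random_variable (M' (h i)) (X (h i))"
    using indep unfolding indep_vars_def2 by auto
  have "indep_sets (\<lambda>i. ?F (h i)) I"
  proof (rule indep_setsI)
    show "?F (h i) \<subseteq> events" if "i \<in> I" for i
      using rv[OF that] by (auto intro: measurable_sets)
    fix A J assume J: "J \<noteq> {}" "J \<subseteq> I" "finite J" and A: "\<forall>j\<in>J. A j \<in> ?F (h j)"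
    let ?A = "\<lambda>j. A (inv_into J h j)"
    have hJ: "inj_on h J"
      using h J(2) by (rule inj_on_subset)
    have "prob (\<Inter>j\<in>h ` J. ?A j) = (\<Prod>j\<in>h ` J. prob (?A j))"
      using A J hJ by (intro indep_setsD[OF sets]) auto
    then show "prob (\<Inter>j\<in>J. A j) = (\<Prod>j\<in>J. prob (A j))"
      using hJ by (simp add: prod.reindex)
  qed
  then show ?thesis
    using rv by (simp add: indep_vars_def2)
qed

abbreviation sample :: "(nat \<Rightarrow> nat \<Rightarrow> nat \<Rightarrow> 'a \<Rightarrow> 'k) \<Rightarrow> 'a \<Rightarrow> nat \<times> nat \<times> nat \<Rightarrow> 'k" where
  "sample X \<omega> \<equiv> \<lambda>(i, k, l). X i k l \<omega>"

abbreviation joint ::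
    "(nat \<Rightarrow> nat \<Rightarrow> nat \<Rightarrow> 'a \<Rightarrow> 'k) \<Rightarrow> (nat \<Rightarrow> nat \<Rightarrow> nat \<Rightarrow> 'a \<Rightarrow> 'k) \<Rightarrow>
      (nat \<times> nat \<times> nat) + (nat \<times> nat \<times> nat) \<Rightarrow> 'a \<Rightarrow> 'k" where
  "joint X X' \<equiv> case_sum (\<lambda>(i, k, l). X i k l) (\<lambda>(i, k, l). X' i k l)"

lemma iid_gaussian_pair_indep:
  "iid_gaussian_pair M N \<sigma> X X' \<Longrightarrow> prob_space.indep_vars M (\<lambda>_. borel) (joint X X') (cube N <+> cube N)"
  by (simp add: iid_gaussian_pair_def)

lemma iid_gaussian_pair_distributed:
  "iid_gaussian_pair M N \<sigma> X X' \<Longrightarrow> e \<in> cube N <+> cube N \<Longrightarrow>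
    distributed M lborel (joint X X' e) (\<lambda>x. ennreal (gaussian_density \<sigma> x))"
  by (auto simp: iid_gaussian_pair_def)

text \<open>Lets estimates for the first family be applied to the second.\<close>

lemma iid_gaussian_pair_swap:
  assumes "prob_space M" "iid_gaussian_pair M N \<sigma> X X'"
  shows "iid_gaussian_pair M N \<sigma> X' X"
proof -
  interpret prob_space M by fact
  let ?h = "case_sum Inr Inl"
  have img: "?h ` (cube N <+> cube N) = cube N <+> cube N"
    unfolding Plus_def image_Un image_image by (simp add: Un_commute)
  have "inj_on ?h (cube N <+> cube N)"
    by (auto intro!: inj_onI split: sum.splits)
  then have "indep_vars (\<lambda>_. borel) (joint X X' \<circ> ?h) (cube N <+> cube N)"
    using indep_vars_reindex[of ?h "cube N <+> cube N" "\<lambda>_. borel" "joint X X'"]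
      iid_gaussian_pair_indep[OF assms(2)] unfolding img comp_def by simp
  moreover have "joint X X' \<circ> ?h = joint X' X"
    by (auto split: sum.splits)
  ultimately show ?thesis
    using assms(2) by (simp add: iid_gaussian_pair_def)
qed

lemma inj_on_map_sum: "inj_on f A \<Longrightarrow> inj_on g B \<Longrightarrow> inj_on (map_sum f g) (A <+> B)"
  by (auto intro!: inj_onI dest: inj_onD)

lemma iid_gaussian_pair_permute:
  assumes "prob_space M" "iid_gaussian_pair M N \<sigma> (\<lambda>i k l. X (i, k, l)) (\<lambda>i k l. X' (i, k, l))"
    and \<pi>: "bij_betw \<pi> (cube N) (cube N)"
  shows "iid_gaussian_pair M N \<sigma> (\<lambda>i k l. X (\<pi> (i, k, l))) (\<lambda>i k l. X' (\<pi> (i, k, l)))"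
proof -
  interpret prob_space M by fact
  let ?h = "map_sum \<pi> \<pi>"
  have inj: "inj_on ?h (cube N <+> cube N)"
    using \<pi> by (intro inj_on_map_sum) (simp_all add: bij_betw_def)
  have mem: "\<pi> p \<in> cube N" if "p \<in> cube N" for p
    using \<pi> that unfolding bij_betw_def by blast
  have img: "?h ` (cube N <+> cube N) = cube N <+> cube N"
  proof -
    have "?h ` (cube N <+> cube N) = Inl ` \<pi> ` cube N \<union> Inr ` \<pi> ` cube N"
      unfolding Plus_def image_Un image_image by simp
    then show ?thesis
      using \<pi> by (simp add: bij_betw_def Plus_def)
  qed
  have "indep_vars (\<lambda>_. borel) (case_sum X X' \<circ> ?h) (cube N <+> cube N)"
    using indep_vars_reindex[OF inj, of "\<lambda>_. borel" "case_sum X X'"]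
      iid_gaussian_pair_indep[OF assms(2)] unfolding img comp_def by simp
  moreover have "case_sum X X' \<circ> ?h = case_sum (\<lambda>(i, k, l). X (\<pi> (i, k, l))) (\<lambda>(i, k, l). X' (\<pi> (i, k, l)))"
    by (auto split: sum.splits)
  moreover have "distributed M lborel (X (\<pi> p)) (\<lambda>x. ennreal (gaussian_density \<sigma> x)) \<and>
      distributed M lborel (X' (\<pi> p)) (\<lambda>x. ennreal (gaussian_density \<sigma> x))" if "p \<in> cube N" for p
    using assms(2) mem[OF that] unfolding iid_gaussian_pair_def by (cases "\<pi> p") auto
  ultimately show ?thesis
    by (simp add: iid_gaussian_pair_def)
qed

lemma sample_measurable:
  fixes X :: "nat \<Rightarrow> nat \<Rightarrow> nat \<Rightarrow> 'a \<Rightarrow> 'k::euclidean_space"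
  assumes "iid_gaussian_pair M N \<sigma> X X'" "p \<in> cube N"
  shows "(\<lambda>\<omega>. sample X \<omega> p) \<in> borel_measurable M" "(\<lambda>\<omega>. sample X' \<omega> p) \<in> borel_measurable M"
proof -
  obtain i k l where p: "p = (i, k, l)" by (cases p)
  with assms have "distributed M lborel (X i k l) (\<lambda>x. ennreal (gaussian_density \<sigma> x))"
    "distributed M lborel (X' i k l) (\<lambda>x. ennreal (gaussian_density \<sigma> x))"
    unfolding iid_gaussian_pair_def by auto
  from this[THEN distributed_measurable]
  show "(\<lambda>\<omega>. sample X \<omega> p) \<in> borel_measurable M" "(\<lambda>\<omega>. sample X' \<omega> p) \<in> borel_measurable M"
    by (simp_all add: p)
qed

lemma chaos_exp_moment:
  fixes X :: "nat \<Rightarrow> nat \<Rightarrow> nat \<Rightarrow> 'a \<Rightarrow> real"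
  assumes M: "prob_space M" and iid: "iid_gaussian_pair M N 1 X X'" and N: "1 \<le> N"
    and D: "finite D" and A: "contraction (cube N) D A" and B: "contraction D (cube N) B"
    and \<theta>: "\<theta>\<^sup>2 \<le> 1 / 2"
  shows "(\<integral>\<^sup>+\<omega>. ennreal (exp (\<theta> * bil (cube N) (cube N) (\<lambda>p q. \<Sum>d\<in>D. A p d * B d q) (sample X \<omega>) (sample X' \<omega>))) \<partial>M)
    \<le> ennreal (exp (\<theta>\<^sup>2 * card D))"
proof -
  interpret prob_space M by fact
  let ?K = "cube N <+> cube N"
  define F where "F x = ennreal (exp (\<theta> * (\<Sum>p\<in>cube N. x (Inl p) * (\<Sum>d\<in>D. A p d * (\<Sum>q\<in>cube N. B d q * x (Inr q))))))"
    for x :: "_ \<Rightarrow> real"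
  have [measurable]: "(\<lambda>x. x (Inl p)) \<in> borel_measurable (PiM ?K (\<lambda>_. std_normal))" if "p \<in> cube N" for p
    using that by (intro measurable_component_gauss) auto
  have [measurable]: "(\<lambda>x. x (Inr p)) \<in> borel_measurable (PiM ?K (\<lambda>_. std_normal))" if "p \<in> cube N" for p
    using that by (intro measurable_component_gauss) auto
  have F: "F \<in> borel_measurable (PiM ?K (\<lambda>_. std_normal))"
    unfolding F_def by measurable
  have "bil (cube N) (cube N) (\<lambda>p q. \<Sum>d\<in>D. A p d * B d q) x x' =
      (\<Sum>p\<in>cube N. x p * (\<Sum>d\<in>D. A p d * (\<Sum>q\<in>cube N. B d q * x' q)))" for x x'
  proof -
    have "(\<Sum>q\<in>cube N. (\<Sum>d\<in>D. A p d * B d q) * x' q) = (\<Sum>d\<in>D. A p d * (\<Sum>q\<in>cube N. B d q * x' q))" for p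
      unfolding sum_distrib_left sum_distrib_right by (subst sum.swap) (simp add: mult_ac)
    then show ?thesis by (simp add: bil_left)
  qed
  then have "ennreal (exp (\<theta> * bil (cube N) (cube N) (\<lambda>p q. \<Sum>d\<in>D. A p d * B d q) (sample X \<omega>) (sample X' \<omega>))) =
      F (\<lambda>e\<in>?K. joint X X' e \<omega>)" for \<omega>
    unfolding F_def by (simp add: InlI InrI split_beta cong: sum.cong_simp)
  then have "(\<integral>\<^sup>+\<omega>. ennreal (exp (\<theta> * bil (cube N) (cube N) (\<lambda>p q. \<Sum>d\<in>D. A p d * B d q) (sample X \<omega>) (sample X' \<omega>))) \<partial>M) =
      (\<integral>\<^sup>+\<omega>. F (\<lambda>e\<in>?K. joint X X' e \<omega>) \<partial>M)"
    by simp
  also have "\<dots> = (\<integral>\<^sup>+x. F x \<partial>PiM ?K (\<lambda>_. std_normal))"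
  proof (rule nn_integral_indep_std_normal[OF _ iid_gaussian_pair_indep[OF iid] _ F])
    show "?K \<noteq> {}" using N by auto
    show "distributed M lborel (joint X X' e) (\<lambda>x. ennreal (std_normal_density x))" if "e \<in> ?K" for e
      using iid_gaussian_pair_distributed[OF iid that] by (simp add: gaussian_density_real)
  qed
  also have "\<dots> \<le> ennreal (exp (\<theta>\<^sup>2 * card D))"
    unfolding F_def by (rule nn_integral_exp_decoupled_chaos_gauss) (use D A B \<theta> in auto)
  finally show ?thesis .
qed

text \<open>The exponent takes the largest admissible value 1/4, and only the left half of the joint
  family enters.\<close>

lemma square_exp_moment:
  fixes X :: "nat \<Rightarrow> nat \<Rightarrow> nat \<Rightarrow> 'a \<Rightarrow> real"
  assumes M: "prob_space M" and iid: "iid_gaussian_pair M N 1 X X'" and N: "1 \<le> N"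
    and D: "finite D" and B: "contraction D (cube N) B"
  shows "(\<integral>\<^sup>+\<omega>. ennreal (exp (1 / 4 * (L2_set (\<lambda>d. \<Sum>q\<in>cube N. B d q * sample X \<omega> q) D)\<^sup>2)) \<partial>M)
    \<le> ennreal (exp (card D / 2))"
proof -
  interpret prob_space M by fact
  let ?K = "Inl ` cube N :: (nat \<times> nat \<times> nat + nat \<times> nat \<times> nat) set"
  define F where "F x = ennreal (exp (1 / 4 * (\<Sum>d\<in>D. (\<Sum>q\<in>cube N. B d q * x (Inl q))\<^sup>2)))"
    for x :: "nat \<times> nat \<times> nat + nat \<times> nat \<times> nat \<Rightarrow> real"
  have [measurable]: "(\<lambda>x. x (Inl p)) \<in> borel_measurable (PiM ?K (\<lambda>_. std_normal))" if "p \<in> cube N" for p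
    using that by (intro measurable_component_gauss) auto
  have F: "F \<in> borel_measurable (PiM ?K (\<lambda>_. std_normal))"
    unfolding F_def by measurable
  have "ennreal (exp (1 / 4 * (L2_set (\<lambda>d. \<Sum>q\<in>cube N. B d q * sample X \<omega> q) D)\<^sup>2)) =
      F (\<lambda>e\<in>?K. joint X X' e \<omega>)" for \<omega>
    unfolding F_def by (simp add: L2_set_square split_beta cong: sum.cong_simp)
  then have "(\<integral>\<^sup>+\<omega>. ennreal (exp (1 / 4 * (L2_set (\<lambda>d. \<Sum>q\<in>cube N. B d q * sample X \<omega> q) D)\<^sup>2)) \<partial>M) =
      (\<integral>\<^sup>+\<omega>. F (\<lambda>e\<in>?K. joint X X' e \<omega>) \<partial>M)"
    by simp
  also have "\<dots> = (\<integral>\<^sup>+x. F x \<partial>PiM ?K (\<lambda>_. std_normal))"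
  proof (rule nn_integral_indep_std_normal[OF _ _ _ F])
    show "indep_vars (\<lambda>_. borel) (joint X X') ?K"
      by (rule indep_vars_subset[OF iid_gaussian_pair_indep[OF iid]]) auto
    show "?K \<noteq> {}" using N by auto
    show "distributed M lborel (joint X X' e) (\<lambda>x. ennreal (std_normal_density x))" if "e \<in> ?K" for e
      using iid_gaussian_pair_distributed[OF iid, of e] that by (auto simp: gaussian_density_real)
  qed
  also have "\<dots> \<le> ennreal (exp (2 * (1 / 4) * card D))"
    unfolding F_def by (rule nn_integral_exp_contraction_gauss) (use D B in auto)
  finally show ?thesis by simp
qed

section \<open>Matrices with flat singular values\<close>

lemma five_power_le_exp: "(5::real) ^ n \<le> exp (2 * real n)"
proof -
  \<comment> \<open>(1 + 2/8)^8 = (5/4)^8 already exceeds 5 and is at most exp 2.\<close>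
  have "(5::real) \<le> (1 + 2 / real 8) ^ 8"
    by (simp add: power_divide eval_nat_numeral)
  also have "\<dots> \<le> exp 2"
    by (rule exp_ge_one_plus_x_over_n_power_n) auto
  finally have "(5::real) ^ n \<le> exp 2 ^ n"
    by (intro power_mono) auto
  then show ?thesis by (simp add: exp_of_nat_mult[symmetric] mult.commute)
qed

lemma matrix_nets:
  obtains F G :: "nat \<Rightarrow> (nat \<Rightarrow> nat \<Rightarrow> real) set" where
    "\<And>r. finite (F r)" "\<And>r. real (card (F r)) \<le> exp (2 * real (N * r))"
    "\<And>r A. A \<in> F r \<Longrightarrow> contraction {1..N} {..<r} A"
    "\<And>r A. contraction {1..N} {..<r} A \<Longrightarrow> \<exists>B\<in>F r. contraction {1..N} {..<r} (\<lambda>i j. 2 * (A i j - B i j))"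
    "\<And>r. finite (G r)" "\<And>r. real (card (G r)) \<le> exp (2 * real (N * r))"
    "\<And>r A. A \<in> G r \<Longrightarrow> contraction {..<r} {1..N} A"
    "\<And>r A. contraction {..<r} {1..N} A \<Longrightarrow> \<exists>B\<in>G r. contraction {..<r} {1..N} (\<lambda>i j. 2 * (A i j - B i j))"
proof -
  let ?net = "\<lambda>I J n F. finite F \<and> real (card F) \<le> exp (2 * real n) \<and> (\<forall>A\<in>F. contraction I J A) \<and>
    (\<forall>A. contraction I J A \<longrightarrow> (\<exists>B\<in>F. contraction I J (\<lambda>i j. 2 * (A i j - B i j))))"
  have net: "\<exists>F. ?net I J n F" if fin: "finite I" "finite J" and n: "card I * card J = n" for I J :: "nat set" and n
  proof -
    obtain F where F: "finite F" "card F \<le> 5 ^ (card I * card J)" "\<And>A. A \<in> F \<Longrightarrow> contraction I J A"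
      "\<And>A. contraction I J A \<Longrightarrow> \<exists>B\<in>F. contraction I J (\<lambda>i j. 2 * (A i j - B i j))"
      by (rule contraction_net[OF fin], rule that)
    have "real (card F) \<le> real (5 ^ (card I * card J))"
      using F(2) by (simp only: of_nat_le_iff)
    also have "\<dots> \<le> exp (2 * real n)"
      using five_power_le_exp[of "card I * card J"] n by simp
    finally show ?thesis using F by blast
  qed
  have "\<forall>r. \<exists>F. ?net {1..N} {..<r} (N * r) F" "\<forall>r. \<exists>F. ?net {..<r} {1..N} (N * r) F"
    by (intro allI net; simp)+
  from this(1)[THEN choice] this(2)[THEN choice] obtain F G
    where "\<forall>r. ?net {1..N} {..<r} (N * r) (F r)" "\<forall>r. ?net {..<r} {1..N} (N * r) (G r)"
    by (elim exE)
  then show thesis by (intro that[of F G]) auto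
qed

text \<open>Contractions of rank at most \<open>r\<close>, presented by a factorization: the nets
  are taken on the two thin factors with N r entries each, and not on N^2 entries.\<close>

definition factored :: "nat \<Rightarrow> nat \<Rightarrow> (nat \<Rightarrow> nat \<Rightarrow> real) set" where
  "factored N r =
     {matprod r A B | A B. contraction {1..N} {..<r} A \<and> contraction {..<r} {1..N} B}"

text \<open>The square root compensates for missing normalization, since the Hilbert-Schmidt norms
  may reach sqrt r, sqrt s, sqrt t. The constants 2560 = 64 * 2 * 20 and 128 = 64 * 2 come from the
  balanced case; the gain exp (-6 N) pays for the union over all triples of blocks.\<close>

definition block_bound ::
    "'a measure \<Rightarrow> nat \<Rightarrow> (nat \<Rightarrow> nat \<Rightarrow> nat \<Rightarrow> 'a \<Rightarrow> real) \<Rightarrow> (nat \<Rightarrow> nat \<Rightarrow> nat \<Rightarrow> 'a \<Rightarrow> real) \<Rightarrow>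
      nat \<Rightarrow> nat \<Rightarrow> nat \<Rightarrow> bool" where
  "block_bound M N X X' r s t \<longleftrightarrow> dominated M (2 * exp (- 6 * real N)) (\<lambda>\<omega> h.
     \<forall>U\<in>factored N r. \<forall>V\<in>factored N s. \<forall>W\<in>factored N t.
       \<bar>triform N (sample X \<omega>) (sample X' \<omega>) U V W\<bar> \<le> sqrt (real (r * s * t)) * (2560 * real N + 128 * h))"

text \<open>
  Six nets, of total cardinality \<open>exp (O (N r))\<close>. The exponent \<open>\<theta> = r / (2 sqrt (r s t))\<close> is admissible for
  the chaos because \<open>r \<le> s t\<close>, and it is large enough to absorb the union bound at level \<open>O (N)\<close>.
\<close>

lemma block_bound_balanced:
  fixes X :: "nat \<Rightarrow> nat \<Rightarrow> nat \<Rightarrow> 'a \<Rightarrow> real"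
  assumes M: "prob_space M" and iid: "iid_gaussian_pair M N 1 X X'" and N: "1 \<le> N"
    and st: "1 \<le> s" "s \<le> r" "1 \<le> t" "t \<le> r" and r: "r \<le> 2 * N" "r \<le> s * t"
  shows "block_bound M N X X' r s t"
proof -
  have r1: "1 \<le> r" using st by linarith
  obtain F G :: "nat \<Rightarrow> (nat \<Rightarrow> nat \<Rightarrow> real) set" where
    F: "\<And>r. finite (F r)" "\<And>r. real (card (F r)) \<le> exp (2 * real (N * r))"
      "\<And>r A. A \<in> F r \<Longrightarrow> contraction {1..N} {..<r} A"
      "\<And>r A. contraction {1..N} {..<r} A \<Longrightarrow> \<exists>B\<in>F r. contraction {1..N} {..<r} (\<lambda>i j. 2 * (A i j - B i j))"
    and G: "\<And>r. finite (G r)" "\<And>r. real (card (G r)) \<le> exp (2 * real (N * r))"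
      "\<And>r A. A \<in> G r \<Longrightarrow> contraction {..<r} {1..N} A"
      "\<And>r A. contraction {..<r} {1..N} A \<Longrightarrow> \<exists>B\<in>G r. contraction {..<r} {1..N} (\<lambda>i j. 2 * (A i j - B i j))"
    using matrix_nets[of N] by blast
  define w where "w = sqrt (real (r * s * t))"
  have w2: "w\<^sup>2 = real (r * s * t)" and w0: "0 < w"
    using r1 st by (simp_all add: w_def)
  define \<theta> where "\<theta> = real r / (2 * w)"
  have \<theta>0: "0 < \<theta>" using r1 w0 by (simp add: \<theta>_def)
  have \<theta>2: "\<theta>\<^sup>2 * real (r * s * t) = (real r)\<^sup>2 / 4"
    unfolding w2[symmetric] \<theta>_def using w0 by (simp add: power_divide power_mult_distrib)
  have "\<theta>\<^sup>2 \<le> 1 / 2"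
  proof -
    \<comment> \<open>Here \<open>r \<le> s * t\<close> makes the exponent admissible.\<close>
    have "\<theta>\<^sup>2 = real r / (4 * real (s * t))"
      using \<theta>2 r1 st by (simp add: field_simps power2_eq_square)
    also have "\<dots> \<le> 1 / 2"
      using r(2) st by (simp add: divide_le_eq del: of_nat_mult)
    finally show ?thesis .
  qed
  let ?D = "{..<r} \<times> {..<s} \<times> {..<t}"
  \<comment> \<open>The last component is a sign, which turns one-sided exponential bounds into
    bounds on absolute values.\<close>
  let ?net = "F r \<times> G r \<times> F s \<times> G s \<times> F t \<times> G t \<times> {1, - 1 :: real}"
  define \<Phi> where "\<Phi> A B A' B' A'' B'' \<omega> =
    triform N (sample X \<omega>) (sample X' \<omega>) (matprod r A B) (matprod s A' B') (matprod t A'' B'')" for A B A' B' A'' B'' \<omega>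
  define Y where "Y = (\<lambda>(A, B, A', B', A'', B'', \<epsilon>) \<omega>. (\<epsilon> * \<theta>) * \<Phi> A B A' B' A'' B'' \<omega>)"
  have meas: "\<Phi> A B A' B' A'' B'' \<in> borel_measurable M" for A B A' B' A'' B''
    unfolding \<Phi>_def[abs_def] triform_def
    by (intro borel_measurable_sum borel_measurable_times borel_measurable_const sample_measurable[OF iid])
  \<comment> \<open>The log moment is at most N r / 2; six nets of log size 2 N r and the sign,
    absorbed by N r, make 13 N r; the gain is 6 N. Together this is below 20 N r.\<close>
  have dom: "dominated M (exp (- (6 * real N))) (\<lambda>\<omega> h. \<forall>a\<in>?net. Y a \<omega> \<le> 20 * real (N * r) + h)"
  proof (rule exp_moment_dominated[of ?net Y M "real (N * r) / 2" "13 * real (N * r)"])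
    show "finite ?net" using F(1) G(1) by simp
    show "Y a \<in> borel_measurable M" for a
      unfolding Y_def using meas by (simp add: split_beta)
    fix a assume a: "a \<in> ?net"
    obtain A B A' B' A'' B'' \<epsilon> where a_eq: "a = (A, B, A', B', A'', B'', \<epsilon>)"
      by (metis prod_cases7)
    have con: "contraction (cube N) ?D (tensor A (tensor A' A''))" "contraction ?D (cube N) (tensor B (tensor B' B''))"
      using a F(3) G(3) unfolding a_eq by (auto intro!: contraction_tensor)
    have eps: "\<epsilon>\<^sup>2 = 1" using a unfolding a_eq by auto
    have "\<Phi> A B A' B' A'' B'' \<omega> = bil (cube N) (cube N)
        (\<lambda>p q. \<Sum>d\<in>?D. tensor A (tensor A' A'') p d * tensor B (tensor B' B'') d q) (sample X \<omega>) (sample X' \<omega>)" for \<omega>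
      unfolding \<Phi>_def triform_def bil_def tensor_matprod ..
    then have "(\<integral>\<^sup>+\<omega>. ennreal (exp (Y a \<omega>)) \<partial>M) \<le> ennreal (exp ((\<epsilon> * \<theta>)\<^sup>2 * real (card ?D)))"
      using chaos_exp_moment[OF M iid N _ con, of "\<epsilon> * \<theta>"] \<open>\<theta>\<^sup>2 \<le> 1 / 2\<close>
      by (simp add: Y_def a_eq power_mult_distrib eps)
    also have "(\<epsilon> * \<theta>)\<^sup>2 * real (card ?D) = (real r)\<^sup>2 / 4"
      using \<theta>2 by (simp add: power_mult_distrib eps card_cartesian_product mult_ac)
    also have "\<dots> \<le> real (N * r) / 2"
      using mult_right_mono[of "real r" "2 * real N" "real r"] r(1) by (simp add: power2_eq_square)
    finally show "(\<integral>\<^sup>+\<omega>. ennreal (exp (Y a \<omega>)) \<partial>M) \<le> ennreal (exp (real (N * r) / 2))"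
      by (simp add: ennreal_leI)
  next
    have mono: "exp (2 * real (N * q)) \<le> exp (2 * real (N * r))" if "q \<le> r" for q
      using that by (simp add: mult_left_mono)
    have F': "real (card (F q)) \<le> exp (2 * real (N * r))" "real (card (G q)) \<le> exp (2 * real (N * r))" if "q \<le> r" for q
      using F(2)[of q] G(2)[of q] mono[OF that] by linarith+
    have "1 \<le> real (N * r)"
      using N r1 by (metis of_nat_1 of_nat_le_iff mult_le_mono nat_mult_1)
    then have two: "2 \<le> exp (real (N * r))"
      using exp_ge_add_one_self[of "real (N * r)"] by linarith
    have "real (card ?net) = real (card (F r)) * (real (card (G r)) * (real (card (F s)) *
        (real (card (G s)) * (real (card (F t)) * (real (card (G t)) * 2)))))"
      by (simp add: card_cartesian_product)
    also have "\<dots> \<le> exp (2 * real (N * r)) * (exp (2 * real (N * r)) * (exp (2 * real (N * r)) *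
        (exp (2 * real (N * r)) * (exp (2 * real (N * r)) * (exp (2 * real (N * r)) * exp (real (N * r)))))))"
      by (intro mult_mono F' st two order_refl mult_nonneg_nonneg of_nat_0_le_iff exp_ge_zero) auto
    also have "\<dots> = exp (13 * real (N * r))"
      by (simp flip: exp_add)
    finally show "real (card ?net) \<le> exp (13 * real (N * r))" .
    have "real N \<le> real (N * r)"
      using r1 mult_left_mono[of 1 "real r" "real N"] by simp
    then show "real (N * r) / 2 + 13 * real (N * r) + 6 * real N \<le> 20 * real (N * r)"
      by linarith
  qed
  show ?thesis
    unfolding block_bound_def
  proof (rule dominated_mono[OF dom], simp, intro ballI)
    fix \<omega> h U V W
    assume h: "0 \<le> h" and Y: "\<forall>a\<in>?net. Y a \<omega> \<le> 20 * real (N * r) + h"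
      and "U \<in> factored N r" "V \<in> factored N s" "W \<in> factored N t"
    then obtain A B A' B' A'' B'' where UVW: "U = matprod r A B" "V = matprod s A' B'" "W = matprod t A'' B''"
      and con: "contraction {1..N} {..<r} A" "contraction {..<r} {1..N} B"
        "contraction {1..N} {..<s} A'" "contraction {..<s} {1..N} B'"
        "contraction {1..N} {..<t} A''" "contraction {..<t} {1..N} B''"
      unfolding factored_def by blast
    \<comment> \<open>Division by \<open>\<theta>\<close> multiplies by 2 w / r, and r cancels
      against the level 20 N r.\<close>
    have net_le: "\<bar>\<Phi> A B A' B' A'' B'' \<omega>\<bar> \<le> 2 * w * (20 * real N + h)"
      if "A \<in> F r" "B \<in> G r" "A' \<in> F s" "B' \<in> G s" "A'' \<in> F t" "B'' \<in> G t" for A B A' B' A'' B''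
    proof -
      have "\<theta> * \<bar>\<Phi> A B A' B' A'' B'' \<omega>\<bar> \<le> 20 * real (N * r) + h"
        using Y[rule_format, of "(A, B, A', B', A'', B'', 1)"] Y[rule_format, of "(A, B, A', B', A'', B'', - 1)"] that \<theta>0
        by (simp add: Y_def abs_if)
      also have "\<dots> \<le> real r * (20 * real N + h)"
        using mult_right_mono[of 1 "real r" h] h r1 by (simp add: algebra_simps)
      finally have "real r * \<bar>\<Phi> A B A' B' A'' B'' \<omega>\<bar> \<le> real r * (2 * w * (20 * real N + h))"
        using w0 by (simp add: \<theta>_def field_simps)
      then show ?thesis
        using r1 by simp
    qed
    have "\<bar>\<Phi> A B A' B' A'' B'' \<omega>\<bar> \<le> 64 * (2 * w * (20 * real N + h))"
      unfolding \<Phi>_def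
      by (rule triform_net_bound[where F = F and G = G, OF F(3) F(4) G(3) G(4) net_le[unfolded \<Phi>_def] con])
    then show "\<bar>triform N (sample X \<omega>) (sample X' \<omega>) U V W\<bar> \<le> sqrt (real (r * s * t)) * (2560 * real N + 128 * h)"
      unfolding \<Phi>_def w_def[symmetric] UVW by (simp add: algebra_simps)
  qed
qed

lemma tensor_identity_apply:
  assumes "finite I" "i \<in> I"
  shows "(\<Sum>q\<in>I \<times> Q. tensor id_mat B (i, d) q * x q) = (\<Sum>q\<in>Q. B d q * (x (i, q) :: real))"
proof -
  have "(\<Sum>q\<in>I \<times> Q. tensor id_mat B (i, d) q * x q) =
      (\<Sum>j\<in>I. if i = j then \<Sum>q\<in>Q. B d q * x (j, q) else 0)"
    unfolding sum.cartesian_product' by (intro sum.cong refl) (simp add: tensor_def)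
  then show ?thesis
    using assms by simp
qed

text \<open>Trace duality made explicit: the form is the sum over d of <u_d, U v_d>. Each term is at
  most |u_d| |v_d|, and the arithmetic-geometric inequality turns the sum into two squared
  Hilbert-Schmidt norms.\<close>

lemma abs_bil_tensor_le_sum_squares:
  fixes x x' :: "'i \<times> 'q \<Rightarrow> real" and D :: "'d set"
  assumes I: "finite I" and U: "contraction I I U"
  shows "\<bar>bil (I \<times> Q) (I \<times> Q) (tensor U (\<lambda>p q. \<Sum>d\<in>D. A d p * B d q)) x x'\<bar> \<le>
    1 / 2 * ((L2_set (\<lambda>e. \<Sum>q\<in>I \<times> Q. tensor id_mat A e q * x q) (I \<times> D))\<^sup>2 +
      (L2_set (\<lambda>e. \<Sum>q\<in>I \<times> Q. tensor id_mat B e q * x' q) (I \<times> D))\<^sup>2)"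
proof -
  define u where "u d i = (\<Sum>q\<in>Q. A d q * x (i, q))" for d i
  define v where "v d i = (\<Sum>q\<in>Q. B d q * x' (i, q))" for d i
  have L2: "(L2_set (\<lambda>e. \<Sum>q\<in>I \<times> Q. tensor id_mat C e q * y q) (I \<times> D))\<^sup>2 =
      (\<Sum>d\<in>D. (L2_set (\<lambda>i. \<Sum>q\<in>Q. C d q * y (i, q)) I)\<^sup>2)" for C :: "'d \<Rightarrow> 'q \<Rightarrow> real" and y
  proof -
    have "(L2_set (\<lambda>e. \<Sum>q\<in>I \<times> Q. tensor id_mat C e q * y q) (I \<times> D))\<^sup>2 =
        (\<Sum>e\<in>I \<times> D. (\<Sum>q\<in>Q. C (snd e) q * y (fst e, q))\<^sup>2)"
      unfolding L2_set_square
    proof (rule sum.cong[OF refl])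
      fix e assume "e \<in> I \<times> D"
      then show "(\<Sum>q\<in>I \<times> Q. tensor id_mat C e q * y q)\<^sup>2 =
          (\<Sum>q\<in>Q. C (snd e) q * y (fst e, q))\<^sup>2"
        using tensor_identity_apply[OF I, where i = "fst e" and d = "snd e" and B = C and x = y and Q = Q] by (simp add: mem_Times_iff)
    qed
    also have "\<dots> = (\<Sum>i\<in>I. \<Sum>d\<in>D. (\<Sum>q\<in>Q. C d q * y (i, q))\<^sup>2)"
      unfolding sum.cartesian_product' fst_conv snd_conv ..
    also have "\<dots> = (\<Sum>d\<in>D. \<Sum>i\<in>I. (\<Sum>q\<in>Q. C d q * y (i, q))\<^sup>2)"
      by (rule sum.swap)
    finally show ?thesis
      unfolding L2_set_square .
  qed
  have inner: "(\<Sum>p\<in>Q. \<Sum>q\<in>Q. (\<Sum>d\<in>D. A d p * B d q) * x (i, p) * x' (j, q)) = (\<Sum>d\<in>D. u d i * v d j)" for i j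
  proof -
    have "(\<Sum>d\<in>D. u d i * v d j) = (\<Sum>d\<in>D. \<Sum>p\<in>Q. \<Sum>q\<in>Q. A d p * B d q * x (i, p) * x' (j, q))"
      unfolding u_def v_def sum_product by (simp add: mult_ac)
    also have "\<dots> = (\<Sum>p\<in>Q. \<Sum>q\<in>Q. \<Sum>d\<in>D. A d p * B d q * x (i, p) * x' (j, q))"
      by (subst sum.swap, intro sum.cong refl, rule sum.swap)
    finally show ?thesis by (simp add: sum_distrib_right)
  qed
  have "bil (I \<times> Q) (I \<times> Q) (tensor U (\<lambda>p q. \<Sum>d\<in>D. A d p * B d q)) x x' =
      (\<Sum>i\<in>I. \<Sum>p\<in>Q. \<Sum>j\<in>I. \<Sum>q\<in>Q. U i j * ((\<Sum>d\<in>D. A d p * B d q) * x (i, p) * x' (j, q)))"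
    unfolding bil_def sum.cartesian_product' tensor_def by (simp add: mult.assoc)
  also have "\<dots> = (\<Sum>i\<in>I. \<Sum>j\<in>I. U i j * (\<Sum>p\<in>Q. \<Sum>q\<in>Q. (\<Sum>d\<in>D. A d p * B d q) * x (i, p) * x' (j, q)))"
    unfolding sum_distrib_left by (intro sum.cong refl, rule sum.swap)
  also have "\<dots> = (\<Sum>i\<in>I. \<Sum>j\<in>I. \<Sum>d\<in>D. U i j * (u d i * v d j))"
    unfolding inner sum_distrib_left ..
  also have "\<dots> = (\<Sum>d\<in>D. bil I I U (u d) (v d))"
  proof -
    have "(\<Sum>i\<in>I. \<Sum>j\<in>I. \<Sum>d\<in>D. U i j * (u d i * v d j)) = (\<Sum>i\<in>I. \<Sum>d\<in>D. \<Sum>j\<in>I. U i j * (u d i * v d j))"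
      by (intro sum.cong refl, rule sum.swap)
    also have "\<dots> = (\<Sum>d\<in>D. \<Sum>i\<in>I. \<Sum>j\<in>I. U i j * (u d i * v d j))"
      by (rule sum.swap)
    finally show ?thesis by (simp add: bil_def mult.assoc)
  qed
  finally have "\<bar>bil (I \<times> Q) (I \<times> Q) (tensor U (\<lambda>p q. \<Sum>d\<in>D. A d p * B d q)) x x'\<bar> \<le>
      (\<Sum>d\<in>D. \<bar>bil I I U (u d) (v d)\<bar>)"
    using sum_abs by metis
  also have "\<dots> \<le> (\<Sum>d\<in>D. 1 / 2 * ((L2_set (u d) I)\<^sup>2 + (L2_set (v d) I)\<^sup>2))"
  proof (intro sum_mono)
    fix d
    have "\<bar>bil I I U (u d) (v d)\<bar> \<le> L2_set (u d) I * L2_set (v d) I"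
      using U by (simp add: contraction_def)
    also have "\<dots> \<le> 1 / 2 * ((L2_set (u d) I)\<^sup>2 + (L2_set (v d) I)\<^sup>2)"
      using sum_squares_bound[of "L2_set (u d) I" "L2_set (v d) I"] by simp
    finally show "\<bar>bil I I U (u d) (v d)\<bar> \<le> 1 / 2 * ((L2_set (u d) I)\<^sup>2 + (L2_set (v d) I)\<^sup>2)" .
  qed
  also have "\<dots> = 1 / 2 * ((\<Sum>d\<in>D. (L2_set (u d) I)\<^sup>2) + (\<Sum>d\<in>D. (L2_set (v d) I)\<^sup>2))"
    by (simp add: sum_distrib_left sum.distrib distrib_left)
  finally show ?thesis
    unfolding L2 u_def v_def .
qed

text \<open>
  When \<open>r > s t\<close>, the chaos bound is too weak for a net of matrices of rank \<open>r\<close>. But the matrix tested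
  against \<open>R\<close> is a product of an \<open>N \<times> s t\<close> and an \<open>s t \<times> N\<close> matrix, so its trace norm is at most the product
  of the Hilbert-Schmidt norms of the two factors, and only nets for the factors of \<open>S\<close> and \<open>T\<close> are
  needed.
\<close>

definition partial_norm :: "nat \<Rightarrow> (nat \<times> nat \<times> nat \<Rightarrow> real) \<Rightarrow> nat \<Rightarrow> nat \<Rightarrow> (nat \<Rightarrow> nat \<Rightarrow> real) \<Rightarrow> (nat \<Rightarrow> nat \<Rightarrow> real) \<Rightarrow> real" where
  "partial_norm N x s t A A' =
     L2_set (\<lambda>e. \<Sum>q\<in>cube N. tensor id_mat (tensor A A') e q * x q)
       ({1..N} \<times> {..<s} \<times> {..<t})"

lemma partial_norm_le:
  assumes "contraction {..<s} {1..N} A" "contraction {..<t} {1..N} A'"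
  shows "partial_norm N x s t A A' \<le> L2_set x (cube N)"
  unfolding partial_norm_def
  by (rule contraction_apply[OF contraction_tensor[OF contraction_identity contraction_tensor[OF assms]]])

lemma partial_norm_add:
  "partial_norm N x s t (\<lambda>i j. A i j + 1 / 2 * B i j) A' \<le> partial_norm N x s t A A' + 1 / 2 * partial_norm N x s t B A'"
  "partial_norm N x s t A (\<lambda>i j. A' i j + 1 / 2 * B' i j) \<le> partial_norm N x s t A A' + 1 / 2 * partial_norm N x s t A B'"
proof -
  let ?D = "{1..N} \<times> {..<s} \<times> {..<t}"
  have "(\<lambda>e. \<Sum>q\<in>cube N. tensor id_mat (tensor (\<lambda>i j. A i j + 1 / 2 * B i j) A') e q * x q) =
      (\<lambda>e. (\<Sum>q\<in>cube N. tensor id_mat (tensor A A') e q * x q) + 1 / 2 * (\<Sum>q\<in>cube N. tensor id_mat (tensor B A') e q * x q))"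
    by (intro ext) (simp add: tensor_def algebra_simps sum.distrib sum_distrib_left)
  then show "partial_norm N x s t (\<lambda>i j. A i j + 1 / 2 * B i j) A' \<le> partial_norm N x s t A A' + 1 / 2 * partial_norm N x s t B A'"
    using L2_set_triangle_ineq[of _ "\<lambda>e. 1 / 2 * (\<Sum>q\<in>cube N. tensor id_mat (tensor B A') e q * x q)" ?D]
    unfolding partial_norm_def L2_set_scale by simp
  have "(\<lambda>e. \<Sum>q\<in>cube N. tensor id_mat (tensor A (\<lambda>i j. A' i j + 1 / 2 * B' i j)) e q * x q) =
      (\<lambda>e. (\<Sum>q\<in>cube N. tensor id_mat (tensor A A') e q * x q) + 1 / 2 * (\<Sum>q\<in>cube N. tensor id_mat (tensor A B') e q * x q))"
    by (intro ext) (simp add: tensor_def algebra_simps sum.distrib sum_distrib_left)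
  then show "partial_norm N x s t A (\<lambda>i j. A' i j + 1 / 2 * B' i j) \<le> partial_norm N x s t A A' + 1 / 2 * partial_norm N x s t A B'"
    using L2_set_triangle_ineq[of _ "\<lambda>e. 1 / 2 * (\<Sum>q\<in>cube N. tensor id_mat (tensor A B') e q * x q)" ?D]
    unfolding partial_norm_def L2_set_scale by simp
qed

text \<open>The factor 64 is 4 * 16: the exponential moment controls one quarter of the square, and
  releasing two nets multiplies the norm by 4.\<close>

lemma partial_norm_bound:
  fixes X :: "nat \<Rightarrow> nat \<Rightarrow> nat \<Rightarrow> 'a \<Rightarrow> real"
  assumes M: "prob_space M" and iid: "iid_gaussian_pair M N 1 X X'" and N: "1 \<le> N"
    and st: "1 \<le> s" "1 \<le> t"
  shows "dominated M (exp (- (6 * real N))) (\<lambda>\<omega> h. \<forall>A A'. contraction {..<s} {1..N} A \<longrightarrow> contraction {..<t} {1..N} A' \<longrightarrow>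
    (partial_norm N (sample X \<omega>) s t A A')\<^sup>2 \<le> 64 * (20 * real (N * s * t) + h))"
proof -
  obtain G :: "nat \<Rightarrow> (nat \<Rightarrow> nat \<Rightarrow> real) set" where
    G: "\<And>r. finite (G r)" "\<And>r. real (card (G r)) \<le> exp (2 * real (N * r))"
      "\<And>r A. A \<in> G r \<Longrightarrow> contraction {..<r} {1..N} A"
      "\<And>r A. contraction {..<r} {1..N} A \<Longrightarrow> \<exists>B\<in>G r. contraction {..<r} {1..N} (\<lambda>i j. 2 * (A i j - B i j))"
    by (rule matrix_nets[of N], rule that)
  let ?D = "{1..N} \<times> {..<s} \<times> {..<t}"
  define L where "L = 20 * real (N * s * t)"
  define Y where "Y = (\<lambda>(A, A') \<omega>. 1 / 4 * (partial_norm N (sample X \<omega>) s t A A')\<^sup>2)"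
  have dom: "dominated M (exp (- (6 * real N))) (\<lambda>\<omega> h. \<forall>p\<in>G s \<times> G t. Y p \<omega> \<le> L + h)"
  proof (rule exp_moment_dominated[of "G s \<times> G t" Y M "real (N * s * t) / 2" "4 * real (N * s * t)"])
    show "finite (G s \<times> G t)" using G(1) by simp
    show "Y a \<in> borel_measurable M" for a
    proof (cases a)
      case (Pair A A')
      show ?thesis
        unfolding Y_def partial_norm_def L2_set_square Pair prod.case
        by (intro borel_measurable_sum borel_measurable_times borel_measurable_const borel_measurable_power
            sample_measurable[OF iid])
    qed
    fix a assume a: "a \<in> G s \<times> G t"
    then have "contraction ?D (cube N) (tensor id_mat (tensor (fst a) (snd a)))"
      using G(3) by (intro contraction_tensor contraction_identity) auto
    from square_exp_moment[OF M iid N _ this]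
    show "(\<integral>\<^sup>+\<omega>. ennreal (exp (Y a \<omega>)) \<partial>M) \<le> ennreal (exp (real (N * s * t) / 2))"
      by (simp add: Y_def split_beta partial_norm_def card_cartesian_product mult.assoc)
  next
    \<comment> \<open>This gives s + t \<le> s t + 1 \<le> 2 s t, so the two nets together have log
      size at most 4 N s t.\<close>
    have "(s - 1) * (t - 1) + s + t = s * t + 1"
      using st by (cases s; cases t) simp_all
    then have "s + t \<le> 2 * (s * t)"
      using mult_le_mono[OF st] by linarith
    then have "real N * real (s + t) \<le> real N * real (2 * (s * t))"
      by (intro mult_left_mono) (simp_all only: of_nat_le_iff of_nat_0_le_iff)
    then have le: "2 * real (N * s) + 2 * real (N * t) \<le> 4 * real (N * s * t)"
      by (simp add: algebra_simps)
    have "real (card (G s \<times> G t)) = real (card (G s)) * real (card (G t))"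
      by (simp add: card_cartesian_product)
    also have "\<dots> \<le> exp (2 * real (N * s)) * exp (2 * real (N * t))"
      by (intro mult_mono G(2)) auto
    also have "\<dots> = exp (2 * real (N * s) + 2 * real (N * t))"
      by (rule exp_add[symmetric])
    also have "\<dots> \<le> exp (4 * real (N * s * t))"
      using le by simp
    finally show "real (card (G s \<times> G t)) \<le> exp (4 * real (N * s * t))" .
    have "N * 1 \<le> N * (s * t)"
      using mult_le_mono[OF st] by (intro mult_le_mono2) simp
    then have "real N \<le> real (N * s * t)"
      by (simp only: of_nat_le_iff mult.assoc mult_1_right)
    then show "real (N * s * t) / 2 + 4 * real (N * s * t) + 6 * real N \<le> L"
      unfolding L_def by linarith
  qed
  have L0: "0 \<le> L" by (simp add: L_def)
  show ?thesis
  proof (rule dominated_mono[OF dom order_refl], intro allI impI)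
    fix \<omega> h A A' assume h: "0 \<le> h" and Y: "\<forall>p\<in>G s \<times> G t. Y p \<omega> \<le> L + h"
      and con: "contraction {..<s} {1..N} A" "contraction {..<t} {1..N} A'"
    let ?f = "partial_norm N (sample X \<omega>) s t" and ?b = "2 * sqrt (L + h)"
    have net_le: "?f A A' \<le> ?b" if "A \<in> G s" "A' \<in> G t" for A A'
    proof (rule power2_le_imp_le)
      show "(?f A A')\<^sup>2 \<le> ?b\<^sup>2"
        using Y[rule_format, of "(A, A')"] that L0 h by (simp add: Y_def power_mult_distrib)
      show "0 \<le> ?b" using L0 h by simp
    qed
    have "?f A A' \<le> 2 * ?b" if "A' \<in> G t" "contraction {..<s} {1..N} A" for A A'
      by (rule seminorm_net_bound[where f = "\<lambda>A. ?f A A'", OF G(3,4) partial_norm_add(1) partial_norm_le[OF _ G(3)[OF that(1)]]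
            net_le[OF _ that(1)] that(2)])
    then have "?f A A' \<le> 2 * (2 * ?b)"
      by (intro seminorm_net_bound[where f = "?f A", OF G(3,4) partial_norm_add(2) partial_norm_le[OF con(1)] _ con(2)])
        (use con(1) in auto)
    then have "(?f A A')\<^sup>2 \<le> (2 * (2 * ?b))\<^sup>2"
      by (intro power_mono) (auto simp: partial_norm_def)
    also have "\<dots> = 64 * (L + h)"
      using L0 h by (simp add: power_mult_distrib)
    finally show "(?f A A')\<^sup>2 \<le> 64 * (20 * real (N * s * t) + h)"
      unfolding L_def .
  qed
qed

lemma block_bound_unbalanced:
  fixes X :: "nat \<Rightarrow> nat \<Rightarrow> nat \<Rightarrow> 'a \<Rightarrow> real"
  assumes M: "prob_space M" and iid: "iid_gaussian_pair M N 1 X X'" and N: "1 \<le> N"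
    and st: "1 \<le> s" "1 \<le> t" and r: "s * t \<le> r"
  shows "block_bound M N X X' r s t"
proof -
  define Q where "Q x h \<longleftrightarrow> (\<forall>A A'. contraction {..<s} {1..N} A \<longrightarrow> contraction {..<t} {1..N} A' \<longrightarrow>
    (partial_norm N x s t A A')\<^sup>2 \<le> 64 * (20 * real (N * s * t) + h))" for x h
  \<comment> \<open>The boolean puts both Gaussian families into one union bound and accounts for
    the factor 2 in \<open>block_bound\<close>.\<close>
  have "dominated M (exp (- (6 * real N))) (\<lambda>\<omega> h. Q (sample (if b then X else X') \<omega>) h)" for b
    using partial_norm_bound[OF M iid N st] partial_norm_bound[OF M iid_gaussian_pair_swap[OF M iid] N st]
    unfolding Q_def by (cases b) simp_all
  then have dom: "dominated M (real (card (UNIV :: bool set)) * exp (- (6 * real N)))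
      (\<lambda>\<omega> h. \<forall>b\<in>UNIV. Q (sample (if b then X else X') \<omega>) h)"
    by (intro dominated_all) (force simp: Q_def)+
  define w where "w = sqrt (real (r * s * t))"
  \<comment> \<open>Here \<open>s * t \<le> r\<close> enters: the trace estimate is of order s t N,
    and the square root in \<open>block_bound\<close> dominates s t.\<close>
  have "(s * t)\<^sup>2 \<le> r * s * t"
    using mult_le_mono1[OF r, of "s * t"] by (simp only: power2_eq_square mult.assoc)
  then have "(real (s * t))\<^sup>2 \<le> real (r * s * t)"
    by (simp only: of_nat_le_iff of_nat_power[symmetric])
  then have st_w: "real (s * t) \<le> w"
    unfolding w_def by (rule real_le_rsqrt)
  have "1 \<le> s * t"
    using mult_le_mono[OF st] by (simp only: mult_1)
  then have "real 1 \<le> real (s * t)"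
    by (simp only: of_nat_le_iff)
  with st_w have w1: "1 \<le> w"
    unfolding of_nat_1 by (rule order_trans[rotated])
  show ?thesis
    unfolding block_bound_def
  proof (rule dominated_mono[OF dom], simp, intro ballI)
    fix \<omega> h U V W
    assume h: "0 \<le> h" and Qb: "\<forall>b\<in>UNIV. Q (sample (if b then X else X') \<omega>) h"
      and UVW_mem: "U \<in> factored N r" "V \<in> factored N s" "W \<in> factored N t"
    have Q: "Q (sample X \<omega>) h" "Q (sample X' \<omega>) h"
      using Qb[rule_format, of True] Qb[rule_format, of False] by simp_all
    from UVW_mem obtain A B A' B' A'' B'' where UVW: "U = matprod r A B" "V = matprod s A' B'" "W = matprod t A'' B''"
      and con: "contraction {1..N} {..<r} A" "contraction {..<r} {1..N} B"
        "contraction {1..N} {..<s} A'" "contraction {..<s} {1..N} B'"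
        "contraction {1..N} {..<t} A''" "contraction {..<t} {1..N} B''"
      unfolding factored_def by blast
    let ?T = "triform N (sample X \<omega>) (sample X' \<omega>) (matprod r A B) (matprod s A' B') (matprod t A'' B'')"
    \<comment> \<open>Transposing the left factors brings the tensor product of the last two blocks
      into the shape required by \<open>abs_bil_tensor_le_sum_squares\<close>.\<close>
    let ?A = "tensor (\<lambda>\<beta> k. A' k \<beta>) (\<lambda>\<gamma> l. A'' l \<gamma>)"
    have eq: "tensor (matprod s A' B') (matprod t A'' B'') =
        (\<lambda>p q. \<Sum>d\<in>{..<s} \<times> {..<t}. ?A d p * tensor B' B'' d q)"
    proof (intro ext)
      fix p q
      have "(\<Sum>d\<in>{..<s} \<times> {..<t}. ?A d p * tensor B' B'' d q) =
          (\<Sum>d\<in>{..<s} \<times> {..<t}. tensor A' A'' p d * tensor B' B'' d q)"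
        by (simp add: tensor_def)
      then show "tensor (matprod s A' B') (matprod t A'' B'') p q =
          (\<Sum>d\<in>{..<s} \<times> {..<t}. ?A d p * tensor B' B'' d q)"
        unfolding sum_tensor_mult by (simp add: tensor_def matprod_def)
    qed
    have "?T = bil (cube N) (cube N) (tensor (matprod r A B) (\<lambda>p q. \<Sum>d\<in>{..<s} \<times> {..<t}. ?A d p * tensor B' B'' d q))
        (sample X \<omega>) (sample X' \<omega>)"
      unfolding triform_def bil_def eq ..
    then have "\<bar>?T\<bar> \<le> 1 / 2 * ((partial_norm N (sample X \<omega>) s t (\<lambda>\<beta> k. A' k \<beta>) (\<lambda>\<gamma> l. A'' l \<gamma>))\<^sup>2 +
        (partial_norm N (sample X' \<omega>) s t B' B'')\<^sup>2)"
      unfolding partial_norm_def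
      using abs_bil_tensor_le_sum_squares[OF _ contraction_matprod[OF con(1,2)], where Q = "sq N" and D = "{..<s} \<times> {..<t}"
          and A = ?A and B = "tensor B' B''" and x = "sample X \<omega>" and x' = "sample X' \<omega>"]
      by simp
    also have "\<dots> \<le> 1 / 2 * (64 * (20 * real (N * s * t) + h) + 64 * (20 * real (N * s * t) + h))"
    proof (rule mult_left_mono[OF add_mono])
      show "(partial_norm N (sample X \<omega>) s t (\<lambda>\<beta> k. A' k \<beta>) (\<lambda>\<gamma> l. A'' l \<gamma>))\<^sup>2 \<le> 64 * (20 * real (N * s * t) + h)"
        by (rule Q(1)[unfolded Q_def, rule_format, OF contraction_flip[THEN iffD2] contraction_flip[THEN iffD2], OF con(3,5)])
      show "(partial_norm N (sample X' \<omega>) s t B' B'')\<^sup>2 \<le> 64 * (20 * real (N * s * t) + h)"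
        by (rule Q(2)[unfolded Q_def, rule_format, OF con(4,6)])
    qed simp
    also have "\<dots> = real (s * t) * (1280 * real N) + 1 * (64 * h)"
      by (simp add: algebra_simps)
    also have "\<dots> \<le> w * (1280 * real N) + w * (64 * h)"
      using h by (intro add_mono mult_right_mono st_w w1) simp_all
    also have "\<dots> = w * (1280 * real N + 64 * h)"
      by (rule distrib_left[symmetric])
    also have "\<dots> \<le> w * (2560 * real N + 128 * h)"
      using h w1 by (intro mult_left_mono) simp_all
    finally show "\<bar>triform N (sample X \<omega>) (sample X' \<omega>) U V W\<bar> \<le> sqrt (real (r * s * t)) * (2560 * real N + 128 * h)"
      unfolding w_def UVW .
  qed
qed

section \<open>Permuting the three tensor legs, and the bound for all ranks\<close>

lemma triform_swap12:
  "triform N x x' R S T = triform N (\<lambda>(i, k, l). x (k, i, l)) (\<lambda>(i, k, l). x' (k, i, l)) S R T"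
proof -
  let ?\<pi> = "\<lambda>(i, k, l). (k, i, l)"
  have bij: "bij_betw ?\<pi> (cube N) (cube N)"
    by (rule bij_betw_byWitness[where f' = ?\<pi>]) auto
  show ?thesis
    unfolding triform_def
    by (subst sum.reindex_bij_betw[OF bij, symmetric], rule sum.cong[OF refl],
        subst sum.reindex_bij_betw[OF bij, symmetric], rule sum.cong[OF refl])
      (auto simp: tensor_def mult_ac)
qed

lemma triform_swap13:
  "triform N x x' R S T = triform N (\<lambda>(i, k, l). x (l, k, i)) (\<lambda>(i, k, l). x' (l, k, i)) T S R"
proof -
  let ?\<pi> = "\<lambda>(i, k, l). (l, k, i)"
  have bij: "bij_betw ?\<pi> (cube N) (cube N)"
    by (rule bij_betw_byWitness[where f' = ?\<pi>]) auto
  show ?thesis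
    unfolding triform_def
    by (subst sum.reindex_bij_betw[OF bij, symmetric], rule sum.cong[OF refl],
        subst sum.reindex_bij_betw[OF bij, symmetric], rule sum.cong[OF refl])
      (auto simp: tensor_def mult_ac)
qed

lemma block_bound_swap12:
  assumes "block_bound M N (\<lambda>i k l. X k i l) (\<lambda>i k l. X' k i l) s r t"
  shows "block_bound M N X X' r s t"
proof -
  have *: "triform N (sample X \<omega>) (sample X' \<omega>) R S T =
      triform N (sample (\<lambda>i k l. X k i l) \<omega>) (sample (\<lambda>i k l. X' k i l) \<omega>) S R T" for \<omega> R S T
    unfolding triform_swap12[of N "sample X \<omega>"] by simp
  have eq: "s * r * t = r * s * t" by simp
  show ?thesis
    unfolding block_bound_def *
    by (rule dominated_mono[OF assms[unfolded block_bound_def eq] order_refl]) blast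
qed

lemma block_bound_swap13:
  assumes "block_bound M N (\<lambda>i k l. X l k i) (\<lambda>i k l. X' l k i) t s r"
  shows "block_bound M N X X' r s t"
proof -
  have *: "triform N (sample X \<omega>) (sample X' \<omega>) R S T =
      triform N (sample (\<lambda>i k l. X l k i) \<omega>) (sample (\<lambda>i k l. X' l k i) \<omega>) T S R" for \<omega> R S T
    unfolding triform_swap13[of N "sample X \<omega>"] by simp
  have eq: "t * s * r = r * s * t" by simp
  show ?thesis
    unfolding block_bound_def *
    by (rule dominated_mono[OF assms[unfolded block_bound_def eq] order_refl]) blast
qed

text \<open>The two regimes meet at r = s t and cover all ranks when the largest comes first.
  Permuting the legs of the Gaussian tensor preserves its law, so the largest rank may be moved to
  the front.\<close>

lemma block_bound_all:
  fixes X :: "nat \<Rightarrow> nat \<Rightarrow> nat \<Rightarrow> 'a \<Rightarrow> real"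
  assumes M: "prob_space M" and iid: "iid_gaussian_pair M N 1 X X'" and N: "1 \<le> N"
    and one: "1 \<le> r" "1 \<le> s" "1 \<le> t" and le: "r \<le> 2 * N" "s \<le> 2 * N" "t \<le> 2 * N"
  shows "block_bound M N X X' r s t"
proof -
  have sorted: "block_bound M N Z Z' r s t"
    if "iid_gaussian_pair M N 1 Z Z'" "1 \<le> s" "s \<le> r" "1 \<le> t" "t \<le> r" "r \<le> 2 * N"
    for Z Z' :: "nat \<Rightarrow> nat \<Rightarrow> nat \<Rightarrow> 'a \<Rightarrow> real" and r s t
    using block_bound_balanced[OF M that(1) N that(2-6)] block_bound_unbalanced[OF M that(1) N that(2,4), of r]
    by linarith
  have bij12: "bij_betw (\<lambda>(i, k, l). (k, i, l)) (cube N) (cube N)"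
    by (rule bij_betw_byWitness[where f' = "\<lambda>(i, k, l). (k, i, l)"]) auto
  have bij13: "bij_betw (\<lambda>(i, k, l). (l, k, i)) (cube N) (cube N)"
    by (rule bij_betw_byWitness[where f' = "\<lambda>(i, k, l). (l, k, i)"]) auto
  have iid12: "iid_gaussian_pair M N 1 (\<lambda>i k l. X k i l) (\<lambda>i k l. X' k i l)"
    using iid_gaussian_pair_permute[OF M _ bij12, of 1 "\<lambda>(i, k, l). X i k l" "\<lambda>(i, k, l). X' i k l"] iid by simp
  have iid13: "iid_gaussian_pair M N 1 (\<lambda>i k l. X l k i) (\<lambda>i k l. X' l k i)"
    using iid_gaussian_pair_permute[OF M _ bij13, of 1 "\<lambda>(i, k, l). X i k l" "\<lambda>(i, k, l). X' i k l"] iid by simp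
  consider "s \<le> r" "t \<le> r" | "r \<le> s" "t \<le> s" | "r \<le> t" "s \<le> t"
    by linarith
  then show ?thesis
  proof cases
    case 1
    show ?thesis by (intro sorted[OF iid] one le 1)
  next
    case 2
    show ?thesis by (rule block_bound_swap12) (intro sorted[OF iid12] one le 2)
  next
    case 3
    show ?thesis by (rule block_bound_swap13) (intro sorted[OF iid13] one le 3)
  qed
qed

lemma triform_cong:
  assumes "\<And>i j. i \<in> {1..N} \<Longrightarrow> j \<in> {1..N} \<Longrightarrow> R i j = R' i j"
    "\<And>i j. i \<in> {1..N} \<Longrightarrow> j \<in> {1..N} \<Longrightarrow> S i j = S' i j"
    "\<And>i j. i \<in> {1..N} \<Longrightarrow> j \<in> {1..N} \<Longrightarrow> T i j = T' i j"
  shows "triform N x x' R S T = triform N x x' R' S' T'"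
  unfolding triform_def tensor_def
  by (rule sum.cong[OF refl], rule sum.cong[OF refl]) (simp add: assms mem_Times_iff)

lemma linear_sum:
  fixes f :: "('i \<Rightarrow> 'j \<Rightarrow> 'k::comm_ring_1) \<Rightarrow> 'k"
  assumes zero: "f (\<lambda>i j. 0) = 0" and add: "\<And>R R' c. f (\<lambda>i j. R i j + c * R' i j) = f R + c * f R'"
  shows "f (\<lambda>i j. \<Sum>b\<in>B. c b * R b i j) = (\<Sum>b\<in>B. c b * f (R b))"
proof (induction B rule: infinite_finite_induct)
  case (insert a F)
  have eq: "(\<lambda>i j. \<Sum>b\<in>insert a F. c b * R b i j) = (\<lambda>i j. (\<Sum>b\<in>F. c b * R b i j) + c a * R a i j)"
    using insert by (simp add: add.commute)
  show ?case
    unfolding eq add using insert by (simp add: add.commute)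
qed (simp_all add: zero)

lemma triform_sum:
  "triform N x x' (\<lambda>i j. \<Sum>b\<in>B. c b * R' b i j) S T = (\<Sum>b\<in>B. c b * triform N x x' (R' b) S T)"
  "triform N x x' R (\<lambda>i j. \<Sum>b\<in>B. c b * R' b i j) T = (\<Sum>b\<in>B. c b * triform N x x' R (R' b) T)"
  "triform N x x' R S (\<lambda>i j. \<Sum>b\<in>B. c b * R' b i j) = (\<Sum>b\<in>B. c b * triform N x x' R S (R' b))"
  using linear_sum[of "\<lambda>R. triform N x x' R S T" c R' B] linear_sum[of "\<lambda>S. triform N x x' R S T" c R' B]
    linear_sum[of "triform N x x' R S" c R' B]
  by (simp_all only: triform_add) (simp_all add: triform_def tensor_def)

section \<open>Real Gaussian tensors\<close>

text \<open>Cauchy-Schwarz over the m + 1 dyadic blocks bounds the sum of the coefficients by their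
  square sum; here each matrix pays its factor of order (log N)^(1/2).\<close>

lemma flat_decomposition:
  assumes N: "N < 2 ^ m"
  obtains a U where "\<And>k. 0 \<le> a k" "\<And>k. k \<le> m \<Longrightarrow> U k \<in> factored N (2 ^ k)"
    "(\<Sum>k\<le>m. a k) \<le> sqrt (3 * (real m + 1)) * hs_norm N R"
    "\<And>i j. i \<in> {1..N} \<Longrightarrow> j \<in> {1..N} \<Longrightarrow> R i j = (\<Sum>k\<le>m. a k / sqrt (2 ^ k) * U k i j)"
proof -
  obtain c and P Q :: "nat \<Rightarrow> nat \<Rightarrow> nat \<Rightarrow> real" where c: "\<And>k. 0 \<le> c k"
    and P: "\<And>k. k \<le> m \<Longrightarrow> contraction {1..N} {..<2 ^ k} (P k)"
    and Q: "\<And>k. k \<le> m \<Longrightarrow> contraction {..<2 ^ k} {1..N} (Q k)"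
    and sum: "(\<Sum>k\<le>m. (c k)\<^sup>2) \<le> 3 * (\<Sum>i\<in>{1..N}. \<Sum>j\<in>{1..N}. (R i j)\<^sup>2)"
    and R: "\<And>i j. i \<in> {1..N} \<Longrightarrow> j \<in> {1..N} \<Longrightarrow>
       R i j = (\<Sum>k\<le>m. c k / sqrt (2 ^ k) * (\<Sum>\<alpha><2 ^ k. P k i \<alpha> * Q k \<alpha> j))"
  proof (rule dyadic_decomposition[of "{1..N}" "{1..N}" m R])
    show "{1..N} \<subseteq> {..<2 ^ m}" using N by auto
  qed (simp, rule that)
  have l2: "(\<Sum>i\<in>{1..N}. \<Sum>j\<in>{1..N}. (R i j)\<^sup>2) = (hs_norm N R)\<^sup>2"
    unfolding l2_norm_def L2_set_square sum.cartesian_product by (intro sum.cong refl) auto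
  have "(\<Sum>k\<le>m. c k) = (\<Sum>k\<le>m. 1 * c k)" by simp
  also have "\<dots> \<le> L2_set (\<lambda>_. 1) {..m} * L2_set c {..m}"
    using abs_sum_mult_le_L2_set[of "\<lambda>_. 1" c "{..m}"] by linarith
  also have "\<dots> = sqrt (real m + 1) * sqrt (\<Sum>k\<le>m. (c k)\<^sup>2)"
    by (simp add: L2_set_def add.commute)
  also have "\<dots> \<le> sqrt (real m + 1) * sqrt (3 * (hs_norm N R)\<^sup>2)"
    using sum unfolding l2 by (intro mult_left_mono real_sqrt_le_mono) auto
  also have "\<dots> = sqrt (3 * (real m + 1)) * hs_norm N R"
    unfolding real_sqrt_mult by (simp add: l2_norm_def)
  finally have sum_c: "(\<Sum>k\<le>m. c k) \<le> sqrt (3 * (real m + 1)) * hs_norm N R" .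
  show thesis
  proof (rule that[of c "\<lambda>k. matprod (2 ^ k) (P k) (Q k)"])
    show "matprod (2 ^ k) (P k) (Q k) \<in> factored N (2 ^ k)" if "k \<le> m" for k
      using P[OF that] Q[OF that] by (auto simp: factored_def)
    show "R i j = (\<Sum>k\<le>m. c k / sqrt (2 ^ k) * matprod (2 ^ k) (P k) (Q k) i j)"
      if "i \<in> {1..N}" "j \<in> {1..N}" for i j
      unfolding R[OF that] matprod_def ..
  qed (fact c sum_c)+
qed

lemma real_tensor_bound:
  fixes X :: "nat \<Rightarrow> nat \<Rightarrow> nat \<Rightarrow> 'a \<Rightarrow> real"
  assumes M: "prob_space M" and iid: "iid_gaussian_pair M N 1 X X'" and N: "2 \<le> N"
  shows "dominated M (1 / real N) (\<lambda>\<omega> h. \<forall>R S T. \<bar>triform N (sample X \<omega>) (sample X' \<omega>) R S T\<bar> \<le>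
    200000 * ln (real N) powr (3 / 2) * (real N + h) * (hs_norm N R * hs_norm N S * hs_norm N T))"
proof -
  have "\<exists>n. 2 ^ n \<le> N \<and> N < 2 ^ (n + 1)"
    using N by (intro ex_power_ivl1) auto
  then obtain n where n: "2 ^ n \<le> N" "N < 2 ^ (n + 1)" by auto
  \<comment> \<open>\<open>2 ^ m\<close> must exceed N to index all columns, and stay at most 2 N
    for the block estimates.\<close>
  define m where "m = n + 1"
  have m: "N < 2 ^ m" "2 ^ m \<le> 2 * N" using n by (simp_all add: m_def)
  let ?T = "{..m} \<times> {..m} \<times> {..m}"
  define Q where "Q p \<omega> h \<longleftrightarrow> (\<forall>U\<in>factored N (2 ^ fst p). \<forall>V\<in>factored N (2 ^ fst (snd p)). \<forall>W\<in>factored N (2 ^ snd (snd p)).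
     \<bar>triform N (sample X \<omega>) (sample X' \<omega>) U V W\<bar>
       \<le> sqrt (real (2 ^ fst p * 2 ^ fst (snd p) * 2 ^ snd (snd p))) * (2560 * real N + 128 * h))" for p \<omega> h
  have dom: "dominated M (real (card ?T) * (2 * exp (- 6 * real N))) (\<lambda>\<omega> h. \<forall>p\<in>?T. Q p \<omega> h)"
  proof (rule dominated_all)
    fix p assume p: "p \<in> ?T"
    have le: "2 ^ k \<le> 2 * N" if "k \<le> m" for k
      using power_increasing[OF that, of "2 :: nat"] m(2) by linarith
    have "block_bound M N X X' (2 ^ fst p) (2 ^ fst (snd p)) (2 ^ snd (snd p))"
      using p N by (intro block_bound_all[OF M iid] le) auto
    then show "dominated M (2 * exp (- 6 * real N)) (Q p)"
      unfolding block_bound_def Q_def .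
    fix \<omega> x y assume Q: "Q p \<omega> x" and "x \<le> (y :: real)"
    then have "sqrt (real (2 ^ fst p * 2 ^ fst (snd p) * 2 ^ snd (snd p))) * (2560 * real N + 128 * x) \<le>
        sqrt (real (2 ^ fst p * 2 ^ fst (snd p) * 2 ^ snd (snd p))) * (2560 * real N + 128 * y)"
      by (intro mult_left_mono) simp_all
    with Q show "Q p \<omega> y"
      unfolding Q_def by (meson order_trans)
  qed auto
  \<comment> \<open>The (m + 1)^3 \<le> 8 N^3 triples are affordable because 16 N^4 exp (-6 N) \<le>
    1, which follows from N \<le> exp N and 16 \<le> exp (2 N).\<close>
  have card: "real (card ?T) * (2 * exp (- 6 * real N)) \<le> 1 / real N"
  proof -
      have "m + 1 \<le> 2 ^ m" by (induction m) simp_all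
      then have mN: "m + 1 \<le> 2 * N" using m(2) by linarith
      have "card ?T = (m + 1) ^ 3"
        by (simp add: card_cartesian_product power3_eq_cube mult.assoc)
      also have "\<dots> \<le> (2 * N) ^ 3"
        using mN by (rule power_mono) simp
      finally have "real (card ?T) \<le> real ((2 * N) ^ 3)"
        by (simp only: of_nat_le_iff)
      then have card: "real (card ?T) \<le> 8 * real N ^ 3"
        by (simp add: power_mult_distrib)
      have "real N \<le> exp (real N)"
        using exp_ge_add_one_self[of "real N"] by linarith
      then have "real N ^ 4 \<le> exp (real N) ^ 4"
        by (intro power_mono) auto
      also have "\<dots> = exp (4 * real N)"
        by (simp add: exp_of_nat_mult[symmetric])
      finally have N4: "real N ^ 4 \<le> exp (4 * real N)" .
      have "(16::real) \<le> 5 ^ 2" by simp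
      also have "\<dots> \<le> 5 ^ N" using N by (intro power_increasing) auto
      also have "\<dots> \<le> exp (2 * real N)" by (rule five_power_le_exp)
      finally have "16 * real N ^ 4 \<le> exp (2 * real N) * exp (4 * real N)"
        using N4 by (intro mult_mono) auto
      also have "\<dots> = exp (6 * real N)" by (simp flip: exp_add)
      finally have key: "16 * real N ^ 4 * exp (- 6 * real N) \<le> 1"
        by (simp add: exp_minus field_simps)
      have "real N * (real (card ?T) * (2 * exp (- 6 * real N))) \<le> real N * (8 * real N ^ 3 * (2 * exp (- 6 * real N)))"
        by (intro mult_left_mono mult_right_mono card) auto
      also have "\<dots> = 16 * real N ^ 4 * exp (- 6 * real N)"
        by (simp add: power3_eq_cube power4_eq_xxxx)
      also note key
      finally have fin: "real N * (real (card ?T) * (2 * exp (- 6 * real N))) \<le> 1" .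
      show ?thesis
      proof (rule mult_imp_le_div_pos)
        show "0 < real N" using N by simp
        show "real (card ?T) * (2 * exp (- 6 * real N)) * real N \<le> 1"
          by (subst mult.commute) (rule fin)
      qed
    qed
  \<comment> \<open>From m ln 2 \<le> ln 2 + ln N and 1/2 \<le> ln 2 \<le> ln N follows m + 1 \<le>
    6 ln N; and 18^(3/2) < 77.\<close>
  have log: "sqrt (3 * (real m + 1)) ^ 3 \<le> 77 * ln (real N) powr (3 / 2)"
  proof -
    have ln0: "0 < ln (real N)" using N by simp
    have ln2: "1 / 2 \<le> ln (2::real)"
      using ln_le_minus_one[of "1 / 2 :: real"] by (simp add: ln_div)
    have "real (2 ^ m) \<le> real (2 * N)"
      using m(2) by (simp only: of_nat_le_iff)
    then have "2 ^ m \<le> 2 * real N" by simp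
    then have "ln (2 ^ m) \<le> ln (2 * real N)"
      using N by (subst ln_le_cancel_iff) simp_all
    also have "ln (2 * real N) = ln 2 + ln (real N)"
      using N by (intro ln_mult_pos) simp_all
    finally have "real m * ln 2 \<le> ln 2 + ln (real N)"
      by (simp only: ln_realpow zero_less_numeral)
    moreover have "ln 2 \<le> ln (real N)"
      using N by simp
    ultimately have "(real m + 1) * ln 2 \<le> 3 * ln (real N)"
      by (simp add: distrib_right)
    moreover have "(real m + 1) * (1 / 2) \<le> (real m + 1) * ln 2"
      using ln2 by (intro mult_left_mono) auto
    ultimately have "3 * (real m + 1) \<le> 18 * ln (real N)"
      by linarith
    then have "sqrt (3 * (real m + 1)) ^ 3 \<le> sqrt (18 * ln (real N)) ^ 3"
      by (intro power_mono real_sqrt_le_mono) auto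
    also have "\<dots> = sqrt 18 ^ 3 * sqrt (ln (real N)) ^ 3"
      by (simp add: real_sqrt_mult power_mult_distrib)
    also have "sqrt (ln (real N)) ^ 3 = ln (real N) powr (3 / 2)"
    proof -
      have "ln (real N) powr (3 / 2) = ln (real N) powr (1 + 1 / 2)" by simp
      also have "\<dots> = ln (real N) * sqrt (ln (real N))"
        using ln0 unfolding powr_add by (simp add: powr_half_sqrt)
      finally show ?thesis
        using ln0 by (simp add: power3_eq_cube)
    qed
    also have "sqrt 18 ^ 3 \<le> (77::real)"
    proof -
      have "sqrt 18 \<le> (17 / 4 :: real)"
        by (rule real_le_lsqrt) (simp_all add: power2_eq_square)
      then show ?thesis by (simp add: power3_eq_cube)
    qed
    finally show ?thesis by (simp add: mult_right_mono)
  qed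
  show ?thesis
  proof (rule dominated_mono[OF dom card], intro allI)
    fix \<omega> h R S T assume h: "0 \<le> h" and Q: "\<forall>p\<in>?T. Q p \<omega> h"
    let ?n = "hs_norm N" and ?s = "sqrt (3 * (real m + 1))"
    let ?\<Phi> = "triform N (sample X \<omega>) (sample X' \<omega>)"
    obtain a U where a: "\<And>k. 0 \<le> a k" and U: "\<And>k. k \<le> m \<Longrightarrow> U k \<in> factored N (2 ^ k)"
      and a_sum: "(\<Sum>k\<le>m. a k) \<le> ?s * ?n R"
      and R: "\<And>i j. i \<in> {1..N} \<Longrightarrow> j \<in> {1..N} \<Longrightarrow> R i j = (\<Sum>k\<le>m. a k / sqrt (2 ^ k) * U k i j)"
      by (rule flat_decomposition[OF m(1), of R], rule that)
    obtain b V where b: "\<And>k. 0 \<le> b k" and V: "\<And>k. k \<le> m \<Longrightarrow> V k \<in> factored N (2 ^ k)"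
      and b_sum: "(\<Sum>k\<le>m. b k) \<le> ?s * ?n S"
      and S: "\<And>i j. i \<in> {1..N} \<Longrightarrow> j \<in> {1..N} \<Longrightarrow> S i j = (\<Sum>k\<le>m. b k / sqrt (2 ^ k) * V k i j)"
      by (rule flat_decomposition[OF m(1), of S], rule that)
    obtain c W where c: "\<And>k. 0 \<le> c k" and W: "\<And>k. k \<le> m \<Longrightarrow> W k \<in> factored N (2 ^ k)"
      and c_sum: "(\<Sum>k\<le>m. c k) \<le> ?s * ?n T"
      and T: "\<And>i j. i \<in> {1..N} \<Longrightarrow> j \<in> {1..N} \<Longrightarrow> T i j = (\<Sum>k\<le>m. c k / sqrt (2 ^ k) * W k i j)"
      by (rule flat_decomposition[OF m(1), of T], rule that)
    define B where "B = 2560 * real N + 128 * h"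
    have B0: "0 \<le> B" using h by (simp add: B_def)
    \<comment> \<open>The weights of the decompositions cancel the square root of the product of
      ranks in the block bound.\<close>
    have block: "\<bar>a j / sqrt (2 ^ j) * (b k / sqrt (2 ^ k) * (c l / sqrt (2 ^ l) * ?\<Phi> (U j) (V k) (W l)))\<bar> \<le> a j * (b k * (c l * B))"
      if "j \<le> m" "k \<le> m" "l \<le> m" for j k l
    proof -
      have p: "(j, k, l) \<in> ?T" using that by simp
      have "\<bar>?\<Phi> (U j) (V k) (W l)\<bar> \<le> sqrt (real (2 ^ j * 2 ^ k * 2 ^ l)) * B"
        using Q[rule_format, OF p] U[OF that(1)] V[OF that(2)] W[OF that(3)] unfolding Q_def B_def by simp
      also have "sqrt (real (2 ^ j * 2 ^ k * 2 ^ l)) = sqrt (2 ^ j) * sqrt (2 ^ k) * sqrt (2 ^ l)"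
        by (simp add: real_sqrt_mult)
      finally have "\<bar>?\<Phi> (U j) (V k) (W l)\<bar> \<le> sqrt (2 ^ j) * sqrt (2 ^ k) * sqrt (2 ^ l) * B" .
      then have "a j / sqrt (2 ^ j) * (b k / sqrt (2 ^ k) * (c l / sqrt (2 ^ l) * \<bar>?\<Phi> (U j) (V k) (W l)\<bar>)) \<le>
          a j / sqrt (2 ^ j) * (b k / sqrt (2 ^ k) * (c l / sqrt (2 ^ l) * (sqrt (2 ^ j) * sqrt (2 ^ k) * sqrt (2 ^ l) * B)))"
        using a[of j] b[of k] c[of l] by (intro mult_left_mono) auto
      also have "\<dots> = a j * (b k * (c l * B))"
        by simp
      finally show ?thesis
        using a[of j] b[of k] c[of l] by (simp add: abs_mult)
    qed
    have "?\<Phi> R S T = ?\<Phi> (\<lambda>i j. \<Sum>k\<le>m. a k / sqrt (2 ^ k) * U k i j)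
        (\<lambda>i j. \<Sum>k\<le>m. b k / sqrt (2 ^ k) * V k i j) (\<lambda>i j. \<Sum>k\<le>m. c k / sqrt (2 ^ k) * W k i j)"
      by (intro triform_cong R S T)
    also have "\<dots> = (\<Sum>j\<le>m. \<Sum>k\<le>m. \<Sum>l\<le>m.
        a j / sqrt (2 ^ j) * (b k / sqrt (2 ^ k) * (c l / sqrt (2 ^ l) * ?\<Phi> (U j) (V k) (W l))))"
      unfolding triform_sum sum_distrib_left ..
    finally have eq: "?\<Phi> R S T = (\<Sum>j\<le>m. \<Sum>k\<le>m. \<Sum>l\<le>m.
        a j / sqrt (2 ^ j) * (b k / sqrt (2 ^ k) * (c l / sqrt (2 ^ l) * ?\<Phi> (U j) (V k) (W l))))" .
    have "\<bar>?\<Phi> R S T\<bar> \<le> (\<Sum>j\<le>m. \<Sum>k\<le>m. \<Sum>l\<le>m. a j * (b k * (c l * B)))"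
      unfolding eq real_norm_def[symmetric]
      by (rule sum_norm_le, rule sum_norm_le, rule sum_norm_le, unfold real_norm_def, rule block) simp_all
    also have "\<dots> = ((\<Sum>j\<le>m. a j) * (\<Sum>k\<le>m. b k) * (\<Sum>l\<le>m. c l)) * B"
    proof -
      have "(\<Sum>j\<le>m. \<Sum>k\<le>m. \<Sum>l\<le>m. a j * (b k * (c l * B))) =
          (\<Sum>j\<le>m. a j) * ((\<Sum>k\<le>m. b k) * ((\<Sum>l\<le>m. c l) * B))"
        by (simp only: sum_distrib_left[symmetric] sum_distrib_right[symmetric])
      then show ?thesis by (simp only: mult.assoc)
    qed
    finally have 1: "\<bar>?\<Phi> R S T\<bar> \<le> ((\<Sum>j\<le>m. a j) * (\<Sum>k\<le>m. b k) * (\<Sum>l\<le>m. c l)) * B" .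
    define nR nS nT s where n_def: "nR = ?n R" "nS = ?n S" "nT = ?n T" "s = ?s"
    define L where "L = ln (real N) powr (3 / 2)"
    have nonneg: "0 \<le> nR" "0 \<le> nS" "0 \<le> nT" "0 \<le> s" "0 \<le> L"
      by (simp_all add: n_def l2_norm_def L_def)
    have "(\<Sum>j\<le>m. a j) * (\<Sum>k\<le>m. b k) \<le> (s * nR) * (s * nS)"
      using a_sum b_sum nonneg unfolding n_def[symmetric]
      by (intro mult_mono sum_nonneg b mult_nonneg_nonneg) simp_all
    from mult_mono[OF this c_sum[folded n_def]] nonneg
    have "(\<Sum>j\<le>m. a j) * (\<Sum>k\<le>m. b k) * (\<Sum>l\<le>m. c l) \<le> (s * nR) * (s * nS) * (s * nT)"
      by (simp add: sum_nonneg c)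
    then have "\<bar>?\<Phi> R S T\<bar> \<le> (s * nR) * (s * nS) * (s * nT) * B"
      by (rule order_trans[OF 1 mult_right_mono[OF _ B0]])
    also have "\<dots> = s ^ 3 * (B * (nR * nS * nT))"
      by (simp add: power3_eq_cube)
    \<comment> \<open>The product 77 * 2560 = 197120 is afterwards rounded up to 200000.\<close>
    also have "\<dots> \<le> (77 * L) * ((2560 * (real N + h)) * (nR * nS * nT))"
      using log nonneg B0 h unfolding n_def(4)[symmetric] L_def[symmetric]
      by (intro mult_mono mult_nonneg_nonneg) (simp_all add: B_def)
    also have "\<dots> = 197120 * (L * (real N + h) * (nR * nS * nT))"
      by simp
    also have "\<dots> \<le> 200000 * (L * (real N + h) * (nR * nS * nT))"
      using nonneg h by (intro mult_right_mono mult_nonneg_nonneg) simp_all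
    finally show "\<bar>?\<Phi> R S T\<bar> \<le> 200000 * ln (real N) powr (3 / 2) * (real N + h) * (?n R * ?n S * ?n T)"
      unfolding n_def L_def by (simp only: mult.assoc)
  qed
qed

section \<open>Reduction to real coordinates\<close>

text \<open>The density is a product over \<open>Basis\<close>; against an indicator in the
  coordinate \<open>b\<close>, all other factors integrate to one.\<close>

lemma (in prob_space) gaussian_component_distributed:
  fixes Z :: "'a \<Rightarrow> 'k::euclidean_space"
  assumes Z: "distributed M lborel Z (\<lambda>x. ennreal (gaussian_density \<sigma> x))" and \<sigma>: "0 < \<sigma>" and b: "b \<in> Basis"
  shows "distributed M lborel (\<lambda>\<omega>. sqrt (real DIM('k)) / \<sigma> * (Z \<omega> \<bullet> b)) (\<lambda>x. ennreal (std_normal_density x))"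
proof -
  let ?s = "\<sigma> / sqrt (real DIM('k))"
  have s: "0 < ?s" using \<sigma> by simp
  have Z_meas[measurable]: "Z \<in> borel_measurable M"
    using distributed_measurable[OF Z] by simp
  have gauss_meas[measurable]: "(\<lambda>x::'k. ennreal (gaussian_density \<sigma> x)) \<in> borel_measurable borel"
    using distributed_borel_measurable[OF Z] by simp
  have "distributed M lborel (\<lambda>\<omega>. Z \<omega> \<bullet> b) (\<lambda>x. ennreal (normal_density 0 ?s x))"
    unfolding distributed_def
  proof (intro conjI)
    show "distr M lborel (\<lambda>\<omega>. Z \<omega> \<bullet> b) = density lborel (\<lambda>x. ennreal (normal_density 0 ?s x))"
    proof (rule measure_eqI)
      fix A :: "real set" assume "A \<in> sets (distr M lborel (\<lambda>\<omega>. Z \<omega> \<bullet> b))"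
      then have A[measurable]: "A \<in> sets borel" by simp
      define f where "f c x = ennreal (normal_density 0 ?s x) * (if c = b then indicator A x else 1)" for c :: 'k and x
      have f_meas: "f c \<in> borel_measurable borel" for c
        unfolding f_def by (cases "c = b") simp_all
      have prod: "(\<Prod>c\<in>Basis. f c (x \<bullet> c)) = ennreal (gaussian_density \<sigma> x) * indicator A (x \<bullet> b)" for x :: 'k
      proof -
        have "(\<Prod>c\<in>Basis. f c (x \<bullet> c)) = (\<Prod>c\<in>Basis. ennreal (normal_density 0 ?s (x \<bullet> c))) *
            (\<Prod>c\<in>Basis. if c = b then indicator A (x \<bullet> c) else 1)"
          unfolding f_def by (rule prod.distrib)
        also have "(\<Prod>c\<in>Basis. if c = b then indicator A (x \<bullet> c) else 1) = (indicator A (x \<bullet> b) :: ennreal)"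
          using b by (simp add: prod.delta)
        also have "(\<Prod>c\<in>Basis. ennreal (normal_density 0 ?s (x \<bullet> c))) = ennreal (gaussian_density \<sigma> x)"
          unfolding gaussian_density_def by (rule prod_ennreal) simp
        finally show ?thesis .
      qed
      have "emeasure (distr M lborel (\<lambda>\<omega>. Z \<omega> \<bullet> b)) A = (\<integral>\<^sup>+\<omega>. indicator A (Z \<omega> \<bullet> b) \<partial>M)"
        by (subst nn_integral_indicator[symmetric], simp, subst nn_integral_distr) simp_all
      also have "\<dots> = (\<integral>\<^sup>+x. ennreal (gaussian_density \<sigma> x) * indicator A (x \<bullet> b) \<partial>lborel)"
        by (rule distributed_nn_integral[OF Z, symmetric]) simp
      also have "\<dots> = (\<Prod>c\<in>Basis. \<integral>\<^sup>+x. f c x \<partial>lborel)"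
        unfolding prod[symmetric] by (rule nn_integral_lborel_prod) (simp_all add: f_meas)
      also have "\<dots> = (\<Prod>c\<in>Basis. if c = b then emeasure (density lborel (\<lambda>x. ennreal (normal_density 0 ?s x))) A else 1)"
      proof (intro prod.cong refl)
        fix c :: 'k
        show "(\<integral>\<^sup>+x. f c x \<partial>lborel) = (if c = b then emeasure (density lborel (\<lambda>x. ennreal (normal_density 0 ?s x))) A else 1)"
          using nn_integral_normal_density[OF s, of 0] by (simp add: f_def emeasure_density)
      qed
      also have "\<dots> = emeasure (density lborel (\<lambda>x. ennreal (normal_density 0 ?s x))) A"
        using b by (simp add: prod.delta)
      finally show "emeasure (distr M lborel (\<lambda>\<omega>. Z \<omega> \<bullet> b)) A = emeasure (density lborel (\<lambda>x. ennreal (normal_density 0 ?s x))) A" .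
    qed simp
  qed simp_all
  then have "distributed M lborel (\<lambda>\<omega>. (Z \<omega> \<bullet> b - 0) / ?s) (\<lambda>x. ennreal (std_normal_density x))"
    by (subst normal_standard_normal_convert[OF s, symmetric])
  then show ?thesis by (simp add: mult.commute)
qed

text \<open>One coordinate is taken from each entry, so independence survives by composition.
  Distinct \<open>a\<close> and \<open>b\<close> are allowed since the expansion of a complex
  product mixes real and imaginary parts.\<close>

lemma iid_gaussian_pair_component:
  fixes X :: "nat \<Rightarrow> nat \<Rightarrow> nat \<Rightarrow> 'a \<Rightarrow> 'k::euclidean_space"
  assumes M: "prob_space M" and iid: "iid_gaussian_pair M N \<sigma> X X'" and \<sigma>: "0 < \<sigma>" and ab: "a \<in> Basis" "b \<in> Basis"
  shows "iid_gaussian_pair M N 1 (\<lambda>i k l \<omega>. sqrt (real DIM('k)) / \<sigma> * (X i k l \<omega> \<bullet> a))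
    (\<lambda>i k l \<omega>. sqrt (real DIM('k)) / \<sigma> * (X' i k l \<omega> \<bullet> b))"
proof -
  interpret prob_space M by fact
  let ?c = "sqrt (real DIM('k)) / \<sigma>"
  let ?h = "case_sum (\<lambda>_ x. ?c * (x \<bullet> a)) (\<lambda>_ x. ?c * (x \<bullet> b))"
  have "indep_vars (\<lambda>_. borel) (\<lambda>e \<omega>. ?h e (joint X X' e \<omega>)) (cube N <+> cube N)"
    by (rule indep_vars_compose2[OF iid_gaussian_pair_indep[OF iid]]) (auto split: sum.splits)
  moreover have "(\<lambda>e \<omega>. ?h e (joint X X' e \<omega>)) =
      joint (\<lambda>i k l \<omega>. ?c * (X i k l \<omega> \<bullet> a)) (\<lambda>i k l \<omega>. ?c * (X' i k l \<omega> \<bullet> b))"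
    by (intro ext) (auto split: sum.splits)
  ultimately have "indep_vars (\<lambda>_. borel)
      (joint (\<lambda>i k l \<omega>. ?c * (X i k l \<omega> \<bullet> a)) (\<lambda>i k l \<omega>. ?c * (X' i k l \<omega> \<bullet> b))) (cube N <+> cube N)"
    by (simp only:)
  moreover have "distributed M lborel (\<lambda>\<omega>. ?c * (X i k l \<omega> \<bullet> a)) (\<lambda>x. ennreal (std_normal_density x)) \<and>
      distributed M lborel (\<lambda>\<omega>. ?c * (X' i k l \<omega> \<bullet> b)) (\<lambda>x. ennreal (std_normal_density x))"
    if "i \<in> {1..N}" "k \<in> {1..N}" "l \<in> {1..N}" for i k l
    using iid that unfolding iid_gaussian_pair_def
    by (intro conjI gaussian_component_distributed \<sigma> ab) simp_all
  ultimately show ?thesis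
    unfolding iid_gaussian_pair_def gaussian_density_real by blast
qed

lemma triform_sum_left:
  "triform N (\<lambda>p. \<Sum>b\<in>B. c b * y b p) x' R S T = (\<Sum>b\<in>B. c b * triform N (y b) x' R S T)"
proof -
  have *: "triform N z x' R S T = (\<Sum>p\<in>cube N. z p * (\<Sum>q\<in>cube N. tensor R (tensor S T) p q * x' q))" for z
    by (simp add: triform_def sum_distrib_left mult_ac)
  show ?thesis
    unfolding * sum_distrib_left[of "c _"] unfolding sum_distrib_right
    by (subst sum.swap) (simp only: mult.assoc)
qed

lemma triform_sum_right:
  "triform N x (\<lambda>p. \<Sum>b\<in>B. c b * y b p) R S T = (\<Sum>b\<in>B. c b * triform N x (y b) R S T)"
proof -
  have *: "triform N x z R S T = (\<Sum>q\<in>cube N. z q * (\<Sum>p\<in>cube N. tensor R (tensor S T) p q * x p))" for z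
    unfolding triform_def sum_distrib_left by (subst sum.swap) (simp add: mult_ac)
  show ?thesis
    unfolding * sum_distrib_left[of "c _"] unfolding sum_distrib_right
    by (subst sum.swap) (simp only: mult.assoc)
qed

lemma triform_scale: "triform N (\<lambda>p. c * x p) (\<lambda>p. d * x' p) R S T = c * d * triform N x x' R S T"
  by (simp add: triform_def sum_distrib_left mult_ac)

lemma triform_of_real:
  "triform N (\<lambda>p. of_real (x p)) (\<lambda>p. of_real (x' p)) (\<lambda>i j. of_real (R i j)) (\<lambda>i j. of_real (S i j)) (\<lambda>i j. of_real (T i j)) =
    (of_real (triform N x x' R S T) :: 'k::{real_algebra_1,comm_ring_1})"
  by (simp add: triform_def tensor_def)

text \<open>The basis vectors are read as field elements, so that multilinearity over the field can
  pull them out.\<close>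

lemma basis_expansion: "(x :: 'k::{real_normed_field,euclidean_space}) = (\<Sum>b\<in>Basis. b * of_real (x \<bullet> b))"
  using euclidean_representation[of x] by (simp add: scaleR_conv_of_real mult.commute)

lemma norm_sum_Basis_mult_le:
  fixes f :: "'k::{real_normed_field,euclidean_space} \<Rightarrow> 'k"
  assumes "\<And>b. b \<in> Basis \<Longrightarrow> norm (f b) \<le> g b"
  shows "norm (\<Sum>b\<in>Basis. b * f b) \<le> (\<Sum>b\<in>Basis. g b)"
  by (rule sum_norm_le) (simp add: norm_mult assms)

text \<open>Expanding all five arguments gives DIM^5 real forms, whose coefficients are products of
  basis elements and have norm one.\<close>

lemma norm_triform_le_components:
  fixes x :: "nat \<times> nat \<times> nat \<Rightarrow> 'k::{real_normed_field,euclidean_space}"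
  assumes le: "\<And>a b c d e. a \<in> Basis \<Longrightarrow> b \<in> Basis \<Longrightarrow> c \<in> Basis \<Longrightarrow> d \<in> Basis \<Longrightarrow> e \<in> Basis \<Longrightarrow>
    \<bar>triform N (\<lambda>p. x p \<bullet> a) (\<lambda>p. x' p \<bullet> b) (\<lambda>i j. R i j \<bullet> c) (\<lambda>i j. S i j \<bullet> d) (\<lambda>i j. T i j \<bullet> e)\<bar> \<le> \<beta>"
  shows "norm (triform N x x' R S T) \<le> real DIM('k) ^ 5 * \<beta>"
proof -
  have "triform N x x' R S T = triform N (\<lambda>p. \<Sum>b\<in>Basis. b * of_real (x p \<bullet> b)) (\<lambda>p. \<Sum>b\<in>Basis. b * of_real (x' p \<bullet> b))
      (\<lambda>i j. \<Sum>b\<in>Basis. b * of_real (R i j \<bullet> b)) (\<lambda>i j. \<Sum>b\<in>Basis. b * of_real (S i j \<bullet> b))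
      (\<lambda>i j. \<Sum>b\<in>Basis. b * of_real (T i j \<bullet> b))"
    by (simp only: basis_expansion[symmetric])
  also have "\<dots> = (\<Sum>a\<in>Basis. a * (\<Sum>b\<in>Basis. b * (\<Sum>c\<in>Basis. c * (\<Sum>d\<in>Basis. d * (\<Sum>e\<in>Basis. e *
      of_real (triform N (\<lambda>p. x p \<bullet> a) (\<lambda>p. x' p \<bullet> b) (\<lambda>i j. R i j \<bullet> c) (\<lambda>i j. S i j \<bullet> d) (\<lambda>i j. T i j \<bullet> e)))))))"
    by (simp only: triform_sum_left triform_sum_right triform_sum triform_of_real)
  finally have eq: "triform N x x' R S T = (\<Sum>a\<in>Basis. a * (\<Sum>b\<in>Basis. b * (\<Sum>c\<in>Basis. c * (\<Sum>d\<in>Basis. d * (\<Sum>e\<in>Basis. e *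
      of_real (triform N (\<lambda>p. x p \<bullet> a) (\<lambda>p. x' p \<bullet> b) (\<lambda>i j. R i j \<bullet> c) (\<lambda>i j. S i j \<bullet> d) (\<lambda>i j. T i j \<bullet> e)))))))" .
  have "norm (triform N x x' R S T) \<le> (\<Sum>a\<in>(Basis::'k set). \<Sum>b\<in>(Basis::'k set). \<Sum>c\<in>(Basis::'k set). \<Sum>d\<in>(Basis::'k set). \<Sum>e\<in>(Basis::'k set). \<beta>)"
    unfolding eq
    by (rule norm_sum_Basis_mult_le, rule norm_sum_Basis_mult_le, rule norm_sum_Basis_mult_le,
        rule norm_sum_Basis_mult_le, rule norm_sum_Basis_mult_le) (simp add: le)
  also have "\<dots> = real DIM('k) ^ 5 * \<beta>"
    by (simp add: eval_nat_numeral mult.assoc)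
  finally show ?thesis .
qed

lemma l2_norm_component_le:
  fixes R :: "nat \<Rightarrow> nat \<Rightarrow> 'k::{real_normed_field,euclidean_space}"
  assumes "b \<in> Basis"
  shows "l2_norm I (case_prod (\<lambda>i j. R i j \<bullet> b)) \<le> l2_norm I (case_prod R)"
  unfolding l2_norm_def
  by (rule L2_set_mono) (auto simp: Basis_le_norm[OF assms])

text \<open>The union bound runs over the DIM^2 pairs of coordinates of the two families; the
  coordinates of R, S, T are covered by uniformity. Undoing the normalization to unit variance gives
  \<sigma>^2 / DIM, so DIM^5 drops to DIM^4.\<close>

lemma gaussian_tensor_bound:
  fixes X :: "nat \<Rightarrow> nat \<Rightarrow> nat \<Rightarrow> 'a \<Rightarrow> 'k::{real_normed_field,euclidean_space}"
  assumes M: "prob_space M" and iid: "iid_gaussian_pair M N \<sigma> X X'" and \<sigma>: "0 < \<sigma>" and N: "2 \<le> N"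
  shows "dominated M (real DIM('k) ^ 2 / real N) (\<lambda>\<omega> h. \<forall>R S T. norm (triform N (sample X \<omega>) (sample X' \<omega>) R S T) \<le>
    200000 * real DIM('k) ^ 4 * \<sigma>\<^sup>2 * ln (real N) powr (3 / 2) * (real N + h) * (hs_norm N R * hs_norm N S * hs_norm N T))"
proof -
  let ?B = "Basis :: 'k set"
  define c where "c = sqrt (real DIM('k)) / \<sigma>"
  define L where "L = ln (real N) powr (3 / 2)"
  define P where "P R S T = hs_norm N R * hs_norm N S * hs_norm N T" for R S T :: "nat \<Rightarrow> nat \<Rightarrow> real"
  define Q where "Q p \<omega> h \<longleftrightarrow> (\<forall>R S T.
    \<bar>triform N (\<lambda>q. c * (sample X \<omega> q \<bullet> fst p)) (\<lambda>q. c * (sample X' \<omega> q \<bullet> snd p)) R S T\<bar> \<le>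
      200000 * L * (real N + h) * P R S T)" for p \<omega> h
  have dom: "dominated M (real (card (?B \<times> ?B)) * (1 / real N)) (\<lambda>\<omega> h. \<forall>p\<in>?B \<times> ?B. Q p \<omega> h)"
  proof (rule dominated_all)
    fix p assume "p \<in> ?B \<times> ?B"
    then have p: "fst p \<in> ?B" "snd p \<in> ?B" by auto
    have "sample (\<lambda>i k l \<omega>. c * (Z i k l \<omega> \<bullet> b)) \<omega> = (\<lambda>q. c * (sample Z \<omega> q \<bullet> b))"
      for Z :: "nat \<Rightarrow> nat \<Rightarrow> nat \<Rightarrow> 'a \<Rightarrow> 'k" and b \<omega>
      by (intro ext) (simp add: split_beta)
    then show "dominated M (1 / real N) (Q p)"
      using real_tensor_bound[OF M iid_gaussian_pair_component[OF M iid \<sigma> p] N, folded c_def]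
      unfolding Q_def L_def P_def by (simp only:)
    fix \<omega> x y assume Q: "Q p \<omega> x" and "x \<le> (y :: real)"
    then have "200000 * L * (real N + x) * P R S T \<le> 200000 * L * (real N + y) * P R S T" for R S T
      by (intro mult_right_mono mult_left_mono) (simp_all add: L_def P_def l2_norm_def)
    with Q show "Q p \<omega> y"
      unfolding Q_def by (meson order_trans)
  qed auto
  have card: "real (card (?B \<times> ?B)) * (1 / real N) \<le> real DIM('k) ^ 2 / real N"
    by (simp add: card_cartesian_product power2_eq_square)
  have c0: "0 < c" using \<sigma> by (simp add: c_def)
  have c2: "c\<^sup>2 = real DIM('k) / \<sigma>\<^sup>2" by (simp add: c_def power_divide)
  show ?thesis
  proof (rule dominated_mono[OF dom card], intro allI)
    fix \<omega> h and R S T :: "nat \<Rightarrow> nat \<Rightarrow> 'k"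
    assume h: "0 \<le> h" and Q: "\<forall>p\<in>?B \<times> ?B. Q p \<omega> h"
    let ?P = "hs_norm N R * hs_norm N S * hs_norm N T"
    have "norm (triform N (sample X \<omega>) (sample X' \<omega>) R S T) \<le>
        real DIM('k) ^ 5 * (1 / c\<^sup>2 * (200000 * L * (real N + h) * ?P))"
    proof (rule norm_triform_le_components)
      fix a b d e f :: 'k assume B: "a \<in> ?B" "b \<in> ?B" "d \<in> ?B" "e \<in> ?B" "f \<in> ?B"
      let ?R = "\<lambda>i j. R i j \<bullet> d" and ?S = "\<lambda>i j. S i j \<bullet> e" and ?T = "\<lambda>i j. T i j \<bullet> f"
      have ab: "(a, b) \<in> ?B \<times> ?B" using B by simp
      have "\<bar>triform N (\<lambda>q. c * (sample X \<omega> q \<bullet> a)) (\<lambda>q. c * (sample X' \<omega> q \<bullet> b)) ?R ?S ?T\<bar> \<le>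
          200000 * L * (real N + h) * P ?R ?S ?T"
        using Q[rule_format, OF ab] unfolding Q_def by simp
      also have "\<dots> \<le> 200000 * L * (real N + h) * ?P"
      proof (rule mult_left_mono)
        show "P ?R ?S ?T \<le> ?P"
          unfolding P_def using B
          by (intro mult_mono l2_norm_component_le mult_nonneg_nonneg) (simp_all add: l2_norm_def)
        show "0 \<le> 200000 * L * (real N + h)"
          using h by (simp add: L_def)
      qed
      finally have "c\<^sup>2 * \<bar>triform N (\<lambda>q. sample X \<omega> q \<bullet> a) (\<lambda>q. sample X' \<omega> q \<bullet> b) ?R ?S ?T\<bar> \<le>
          200000 * L * (real N + h) * ?P"
        unfolding triform_scale by (simp add: abs_mult power2_eq_square)
      then show "\<bar>triform N (\<lambda>q. sample X \<omega> q \<bullet> a) (\<lambda>q. sample X' \<omega> q \<bullet> b) ?R ?S ?T\<bar> \<le>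
          1 / c\<^sup>2 * (200000 * L * (real N + h) * ?P)"
        using c0 by (simp add: pos_le_divide_eq mult.commute)
    qed
    also have "real DIM('k) ^ 5 * (1 / c\<^sup>2 * (200000 * L * (real N + h) * ?P)) =
        (real DIM('k) ^ 5 * (1 / c\<^sup>2)) * (200000 * L * (real N + h) * ?P)"
      by (simp only: mult.assoc)
    also have "real DIM('k) ^ 5 * (1 / c\<^sup>2) = real DIM('k) ^ 4 * \<sigma>\<^sup>2"
      unfolding c2 by (simp add: eval_nat_numeral)
    finally show "norm (triform N (sample X \<omega>) (sample X' \<omega>) R S T) \<le>
        200000 * real DIM('k) ^ 4 * \<sigma>\<^sup>2 * ln (real N) powr (3 / 2) * (real N + h) * ?P"
      unfolding L_def by (simp only: mult_ac)
  qed
qed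

text \<open>The triples (i, k, l) and (i', k', l') are regrouped into the pairs (i, i'), (k, k'),
  (l, l').\<close>

lemma triform_eq_sum:
  "triform N (\<lambda>(i, k, l). g i k l) (\<lambda>(i, k, l). g' i k l) (curry R) (curry S) (curry T) =
    (\<Sum>p\<in>sq N. \<Sum>q\<in>sq N. \<Sum>r\<in>sq N. product_tensor N g g' p q r * R p * S q * T r)"
proof -
  have "(\<Sum>p\<in>sq N. \<Sum>q\<in>sq N. \<Sum>r\<in>sq N. product_tensor N g g' p q r * R p * S q * T r) =
      (\<Sum>p\<in>sq N. \<Sum>q\<in>sq N. \<Sum>r\<in>sq N.
        g (fst p) (fst q) (fst r) * g' (snd p) (snd q) (snd r) * R p * S q * T r)"
    by (intro sum.cong refl) (auto simp: product_tensor_eq simp del: One_nat_def)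
  also have "\<dots> = (\<Sum>(p, q, r)\<in>sq N \<times> sq N \<times> sq N.
        g (fst p) (fst q) (fst r) * g' (snd p) (snd q) (snd r) * R p * S q * T r)"
    by (simp add: sum.cartesian_product split_beta)
  also have "\<dots> = (\<Sum>(p, q)\<in>cube N \<times> cube N. tensor (curry R) (tensor (curry S) (curry T)) p q *
      (case p of (i, k, l) \<Rightarrow> g i k l) * (case q of (i, k, l) \<Rightarrow> g' i k l))"
    by (rule sum.reindex_bij_witness[of _ "\<lambda>((i, k, l), (i', k', l')). ((i, i'), (k, k'), (l, l'))"
          "\<lambda>((i, i'), (k, k'), (l, l')). ((i, k, l), (i', k', l'))"]) (auto simp: tensor_def mult_ac)
  finally show ?thesis
    by (simp add: triform_def sum.cartesian_product)
qed

section \<open>Operator norms and injective norms\<close>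

lemma l2_norm_le_iff:
  fixes z :: "'i \<Rightarrow> 'k::real_normed_field"
  assumes "finite I"
  shows "l2_norm I z \<le> B \<longleftrightarrow> (\<forall>y. l2_norm I y \<le> 1 \<longrightarrow> norm (\<Sum>p\<in>I. y p * z p) \<le> B)"
proof (intro iffI allI impI)
  fix y :: "'i \<Rightarrow> 'k"
  assume z: "l2_norm I z \<le> B" and y: "l2_norm I y \<le> 1"
  have "norm (\<Sum>p\<in>I. y p * z p) \<le> (\<Sum>p\<in>I. norm (y p) * norm (z p))"
    by (rule sum_norm_le) (simp add: norm_mult)
  also have "\<dots> \<le> l2_norm I y * l2_norm I z"
    unfolding l2_norm_def using L2_set_mult_ineq[of "\<lambda>p. norm (y p)" "\<lambda>p. norm (z p)" I] by simp
  also have "\<dots> \<le> 1 * l2_norm I z"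
    by (rule mult_right_mono[OF y]) (simp add: l2_norm_def)
  finally show "norm (\<Sum>p\<in>I. y p * z p) \<le> B" using z by simp
next
  assume *: "\<forall>y. l2_norm I y \<le> 1 \<longrightarrow> norm (\<Sum>p\<in>I. y p * z p) \<le> B"
  show "l2_norm I z \<le> B"
  proof (cases "l2_norm I z = 0")
    case True
    then show ?thesis
      using *[rule_format, of "\<lambda>_. 0"] by (simp add: l2_norm_def L2_set_def)
  next
    case False
    let ?n = "l2_norm I z"
    have n0: "0 < ?n" using False by (simp add: l2_norm_def less_le)
    \<comment> \<open>In a general normed field, |z|^2 / z takes the place of the complex conjugate
      of z; where z vanishes, division by zero gives 0.\<close>
    define y where "y p = of_real ((norm (z p))\<^sup>2 / ?n) / z p" for p
    have "norm (y p) = 1 / ?n * norm (z p)" for p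
      using n0 by (cases "z p = 0") (simp_all add: y_def norm_divide norm_mult norm_power power2_eq_square)
    then have "l2_norm I y = \<bar>1 / ?n\<bar> * L2_set (\<lambda>p. norm (z p)) I"
      unfolding l2_norm_def L2_set_scale[symmetric] by simp
    then have "l2_norm I y \<le> 1"
      using n0 by (simp add: l2_norm_def)
    moreover have "y p * z p = of_real ((norm (z p))\<^sup>2 / ?n)" for p
      by (cases "z p = 0") (simp_all add: y_def)
    ultimately have "norm (of_real (\<Sum>p\<in>I. (norm (z p))\<^sup>2 / ?n) :: 'k) \<le> B"
      using *[rule_format, of y] by (simp del: of_real_divide)
    moreover have "(\<Sum>p\<in>I. (norm (z p))\<^sup>2 / ?n) = ?n"
    proof -
      have "(\<Sum>p\<in>I. (norm (z p))\<^sup>2) = ?n\<^sup>2"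
        by (simp add: l2_norm_def L2_set_square)
      then show ?thesis
        using n0 unfolding sum_divide_distrib[symmetric] by (simp add: power2_eq_square)
    qed
    ultimately show ?thesis
      using n0 by simp
  qed
qed

lemma injective_norm_le_iff:
  fixes g g' :: "nat \<Rightarrow> nat \<Rightarrow> nat \<Rightarrow> 'k::real_normed_field"
  shows "injective_norm (sq N) (product_tensor N g g') \<le> B \<longleftrightarrow>
    (\<forall>R S T. l2_norm (sq N) R \<le> 1 \<and> l2_norm (sq N) S \<le> 1 \<and> l2_norm (sq N) T \<le> 1 \<longrightarrow>
      norm (triform N (\<lambda>(i, k, l). g i k l) (\<lambda>(i, k, l). g' i k l) (curry R) (curry S) (curry T)) \<le> B)"
proof -
  have "l2_norm (sq N) (\<lambda>_. 0 :: 'k) \<le> 1" by (simp add: l2_norm_def L2_set_def)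
  then show ?thesis
    unfolding injective_norm_def triform_eq_sum
    by (subst cSup_le_iff[OF _ bdd_above_injective_norm]) blast+
qed

text \<open>Rows of the Kronecker products are indexed by (k, k') and columns by (l, l'), so pairing
  the image of \<open>x\<close> with \<open>y\<close> gives the trilinear form at \<open>a\<close>,
  \<open>y\<close>, \<open>x\<close>.\<close>

lemma tensor_sum_norm_le_iff:
  fixes Y Y' :: "nat \<Rightarrow> nat \<Rightarrow> nat \<Rightarrow> 'k::real_normed_field"
  shows "tensor_sum_norm N a Y Y' \<le> B \<longleftrightarrow>
    (\<forall>x y. l2_norm (sq N) x \<le> 1 \<and> l2_norm (sq N) y \<le> 1 \<longrightarrow>
      norm (triform N (\<lambda>(i, k, l). Y i k l) (\<lambda>(i, k, l). Y' i k l) a (curry y) (curry x)) \<le> B)"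
proof -
  let ?A = "\<lambda>p q. \<Sum>i=1..N. \<Sum>i'=1..N. a i i' * kron (Y i) (Y' i') p q"
  have A: "?A p q = (\<Sum>r\<in>sq N. a (fst r) (snd r) * kron (Y (fst r)) (Y' (snd r)) p q)" for p q
    by (simp add: sum.cartesian_product split_beta)
  have eq: "(\<Sum>p\<in>sq N. y p * (\<Sum>q\<in>sq N. ?A p q * x q)) =
      triform N (\<lambda>(i, k, l). Y i k l) (\<lambda>(i, k, l). Y' i k l) a (curry y) (curry x)" for x y
  proof -
    have "triform N (\<lambda>(i, k, l). Y i k l) (\<lambda>(i, k, l). Y' i k l) (curry (case_prod a)) (curry y) (curry x) =
        (\<Sum>r\<in>sq N. \<Sum>p\<in>sq N. \<Sum>q\<in>sq N. product_tensor N Y Y' r p q * case_prod a r * y p * x q)"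
      by (rule triform_eq_sum)
    also have "\<dots> = (\<Sum>r\<in>sq N. \<Sum>p\<in>sq N. \<Sum>q\<in>sq N. y p * (a (fst r) (snd r) * kron (Y (fst r)) (Y' (snd r)) p q * x q))"
      by (intro sum.cong refl) (auto simp: product_tensor_eq kron_def simp del: One_nat_def)
    also have "\<dots> = (\<Sum>p\<in>sq N. \<Sum>r\<in>sq N. \<Sum>q\<in>sq N. y p * (a (fst r) (snd r) * kron (Y (fst r)) (Y' (snd r)) p q * x q))"
      by (rule sum.swap)
    also have "\<dots> = (\<Sum>p\<in>sq N. \<Sum>q\<in>sq N. \<Sum>r\<in>sq N. y p * (a (fst r) (snd r) * kron (Y (fst r)) (Y' (snd r)) p q * x q))"
      by (rule sum.cong[OF refl], rule sum.swap)
    also have "\<dots> = (\<Sum>p\<in>sq N. y p * (\<Sum>q\<in>sq N. ?A p q * x q))"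
      unfolding A sum_distrib_left sum_distrib_right ..
    finally show ?thesis by simp
  qed
  have "l2_norm (sq N) (\<lambda>_. 0 :: 'k) \<le> 1" by (simp add: l2_norm_def L2_set_def)
  then have "tensor_sum_norm N a Y Y' \<le> B \<longleftrightarrow>
      (\<forall>x. l2_norm (sq N) x \<le> 1 \<longrightarrow> l2_norm (sq N) (\<lambda>p. \<Sum>q\<in>sq N. ?A p q * x q) \<le> B)"
    unfolding tensor_sum_norm_def matrix_op_norm_def
    by (subst cSup_le_iff[OF _ bdd_above_matrix_op_norm]) blast+
  moreover have "l2_norm (sq N) (\<lambda>p. \<Sum>q\<in>sq N. ?A p q * x q) \<le> B \<longleftrightarrow>
      (\<forall>y. l2_norm (sq N) y \<le> 1 \<longrightarrow>
        norm (triform N (\<lambda>(i, k, l). Y i k l) (\<lambda>(i, k, l). Y' i k l) a (curry y) (curry x)) \<le> B)" for x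
    unfolding eq[symmetric] by (rule l2_norm_le_iff) simp
  ultimately show ?thesis
    by (simp only:) blast
qed

text \<open>The quantifier over \<open>t\<close> may be uncountable. For each \<open>t\<close> the
  bound is a closed condition on the entries, and closed sets are stable under arbitrary
  intersections, so the event is the preimage of one closed set.\<close>

lemma triform_bounded_measurable:
  fixes X :: "nat \<Rightarrow> nat \<Rightarrow> nat \<Rightarrow> 'a \<Rightarrow> 'k::{real_normed_field,euclidean_space}"
  assumes iid: "iid_gaussian_pair M N \<sigma> X X'"
  shows "{\<omega> \<in> space M. \<forall>t. P t \<longrightarrow> norm (triform N (sample X \<omega>) (sample X' \<omega>) (R t) (S t) (T t)) \<le> c t} \<in> sets M"
proof -
  define V where "V \<omega> e = (if e \<in> cube N <+> cube N then joint X X' e \<omega> else 0)" for \<omega> e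
  define \<phi> where "\<phi> t f = norm (triform N (\<lambda>p. f (Inl p)) (\<lambda>p. f (Inr p)) (R t) (S t) (T t))"
    for t and f :: "(nat \<times> nat \<times> nat) + (nat \<times> nat \<times> nat) \<Rightarrow> 'k"
  have "V \<in> measurable M borel"
  proof (rule measurable_coordinatewise_then_product)
    fix e
    show "(\<lambda>\<omega>. V \<omega> e) \<in> borel_measurable M"
    proof (cases "e \<in> cube N <+> cube N")
      case True
      then have "joint X X' e \<in> borel_measurable M"
        using distributed_measurable[OF iid_gaussian_pair_distributed[OF iid True]] by simp
      with True show ?thesis by (simp add: V_def)
    qed (simp add: V_def)
  qed
  moreover have "closed {f. \<forall>t. P t \<longrightarrow> \<phi> t f \<le> c t}"
  proof -
    have "continuous_on UNIV (\<phi> t)" for t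
      unfolding \<phi>_def[abs_def] triform_def
      by (intro continuous_on_norm continuous_on_sum continuous_on_mult continuous_on_const
          continuous_on_product_coordinates)
    then have "closed {f. \<phi> t f \<le> c t}" for t
      by (rule closed_Collect_le[OF _ continuous_on_const])
    then have "closed (\<Inter>t\<in>{t. P t}. {f. \<phi> t f \<le> c t})"
      by (intro closed_INT) auto
    moreover have "(\<Inter>t\<in>{t. P t}. {f. \<phi> t f \<le> c t}) = {f. \<forall>t. P t \<longrightarrow> \<phi> t f \<le> c t}"
      by auto
    ultimately show ?thesis by simp
  qed
  ultimately have "V -` {f. \<forall>t. P t \<longrightarrow> \<phi> t f \<le> c t} \<inter> space M \<in> sets M"
    by (intro measurable_sets[of V M borel]) auto
  moreover have "\<phi> t (V \<omega>) = norm (triform N (sample X \<omega>) (sample X' \<omega>) (R t) (S t) (T t))" for t \<omega>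
  proof -
    have "V \<omega> (Inl p) = sample X \<omega> p" "V \<omega> (Inr p) = sample X' \<omega> p" if "p \<in> cube N" for p
      using that by (simp_all add: V_def InlI InrI split_beta)
    then show ?thesis
      unfolding \<phi>_def triform_def by (simp cong: sum.cong_simp)
  qed
  ultimately show ?thesis
    by (simp add: vimage_def Collect_conj_eq Int_commute)
qed

lemma tensor_sum_norm_probability:
  fixes Y :: "nat \<Rightarrow> nat \<Rightarrow> nat \<Rightarrow> nat \<Rightarrow> 'a \<Rightarrow> 'k::{real_normed_field,euclidean_space}"
  assumes Y: "\<forall>N\<ge>2. prob_space (M N) \<and> iid_gaussian_pair (M N) N (1 / sqrt (real N)) (Y N) (Y' N)"
    and C: "400000 * real DIM('k) ^ 4 \<le> C"
  shows "(\<lambda>N. measure (M N) {\<omega> \<in> space (M N). \<forall>a :: nat \<Rightarrow> nat \<Rightarrow> 'k.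
      tensor_sum_norm N a (\<lambda>i k l. Y N i k l \<omega>) (\<lambda>i k l. Y' N i k l \<omega>)
        \<le> C * ln (real N) powr (3/2) * sqrt (\<Sum>i=1..N. \<Sum>i'=1..N. (norm (a i i'))\<^sup>2)}) \<longlonglongrightarrow> 1"
    (is "(\<lambda>N. measure (M N) (?E N)) \<longlonglongrightarrow> 1")
proof -
  have bound: "1 - real DIM('k) ^ 2 / real N \<le> measure (M N) (?E N) \<and> measure (M N) (?E N) \<le> 1" if N: "2 \<le> N" for N
  proof -
    have M: "prob_space (M N)" and iid: "iid_gaussian_pair (M N) N (1 / sqrt (real N)) (Y N) (Y' N)"
      using Y N by auto
    interpret prob_space "M N" by fact
    have \<sigma>: "0 < 1 / sqrt (real N)" using N by simp
    have l2: "sqrt (\<Sum>i=1..N. \<Sum>i'=1..N. (norm (a i i'))\<^sup>2) = hs_norm N a" for a :: "nat \<Rightarrow> nat \<Rightarrow> 'k"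
      by (simp add: l2_norm_def L2_set_def sum.cartesian_product split_beta)
    let ?c = "\<lambda>a :: nat \<Rightarrow> nat \<Rightarrow> 'k. C * ln (real N) powr (3/2) * hs_norm N a"
    have E_eq: "?E N = {\<omega> \<in> space (M N). \<forall>t. (l2_norm (sq N) (fst (snd t)) \<le> 1 \<and> l2_norm (sq N) (snd (snd t)) \<le> 1) \<longrightarrow>
        norm (triform N (sample (Y N) \<omega>) (sample (Y' N) \<omega>) (fst t) (curry (snd (snd t))) (curry (fst (snd t)))) \<le> ?c (fst t)}"
      unfolding l2 tensor_sum_norm_le_iff by auto
    \<comment> \<open>\<open>measure\<close> vanishes on nonmeasurable sets, so the lower bound
      needs the event itself to be measurable.\<close>
    have E_meas: "?E N \<in> sets (M N)"
      unfolding E_eq by (rule triform_bounded_measurable[OF iid])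
    obtain H where H: "H \<in> borel_measurable (M N)" "\<And>\<omega>. 0 \<le> H \<omega>"
      "(\<integral>\<^sup>+\<omega>. ennreal (H \<omega>) \<partial>M N) \<le> ennreal (real DIM('k) ^ 2 / real N)"
      and le: "\<And>\<omega>. \<forall>R S T. norm (triform N (sample (Y N) \<omega>) (sample (Y' N) \<omega>) R S T) \<le>
        200000 * real DIM('k) ^ 4 * (1 / sqrt (real N))\<^sup>2 * ln (real N) powr (3 / 2) * (real N + H \<omega>) *
        (hs_norm N R * hs_norm N S * hs_norm N T)"
      by (rule dominatedE[OF gaussian_tensor_bound[OF M iid \<sigma> N]], rule that)
    \<comment> \<open>Markov's inequality at level 1: outside an event of probability at most DIM^2
      / N one has N + H \<le> 2 N, and \<sigma>^2 = 1 / N cancels the N.\<close>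
    define G where "G = {\<omega> \<in> space (M N). H \<omega> < 1}"
    have G_meas: "G \<in> sets (M N)"
      unfolding G_def using H(1) by measurable
    have "emeasure (M N) (space (M N) - G) = (\<integral>\<^sup>+\<omega>. indicator (space (M N) - G) \<omega> \<partial>M N)"
      using G_meas by (intro nn_integral_indicator[symmetric]) auto
    also have "\<dots> \<le> (\<integral>\<^sup>+\<omega>. ennreal (H \<omega>) \<partial>M N)"
      by (intro nn_integral_mono) (auto simp: G_def not_less split: split_indicator)
    also note H(3)
    finally have "emeasure (M N) (space (M N) - G) \<le> ennreal (real DIM('k) ^ 2 / real N)" .
    then have "prob (space (M N) - G) \<le> real DIM('k) ^ 2 / real N"
      unfolding emeasure_eq_measure by (subst (asm) ennreal_le_iff) auto
    then have "1 - real DIM('k) ^ 2 / real N \<le> prob G"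
      using prob_compl[OF G_meas] by simp
    also have "\<dots> \<le> prob (?E N)"
    proof (rule finite_measure_mono[OF _ E_meas])
      show "G \<subseteq> ?E N"
      proof
        fix \<omega> assume "\<omega> \<in> G"
        then have \<omega>: "\<omega> \<in> space (M N)" "H \<omega> < 1" by (auto simp: G_def)
        have "norm (triform N (sample (Y N) \<omega>) (sample (Y' N) \<omega>) a (curry y) (curry x)) \<le> ?c a"
          if xy: "l2_norm (sq N) x \<le> 1" "l2_norm (sq N) y \<le> 1" for a and x y :: "nat \<times> nat \<Rightarrow> 'k"
        proof -
          define L where "L = ln (real N) powr (3 / 2)"
          define n where "n = hs_norm N a"
          have nonneg: "0 \<le> L" "0 \<le> n" by (simp_all add: L_def n_def l2_norm_def)
          have "norm (triform N (sample (Y N) \<omega>) (sample (Y' N) \<omega>) a (curry y) (curry x)) \<le>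
              200000 * real DIM('k) ^ 4 * (1 / sqrt (real N))\<^sup>2 * L * (real N + H \<omega>) * (n * l2_norm (sq N) y * l2_norm (sq N) x)"
            using le[rule_format, of \<omega> a "curry y" "curry x"] by (simp add: L_def n_def)
          also have "\<dots> \<le> 200000 * real DIM('k) ^ 4 * (1 / sqrt (real N))\<^sup>2 * L * (2 * real N) * (n * 1 * 1)"
          proof (rule mult_mono)
            show "200000 * real DIM('k) ^ 4 * (1 / sqrt (real N))\<^sup>2 * L * (real N + H \<omega>) \<le>
                200000 * real DIM('k) ^ 4 * (1 / sqrt (real N))\<^sup>2 * L * (2 * real N)"
              by (rule mult_left_mono) (use \<omega>(2) N nonneg(1) in simp_all)
            show "n * l2_norm (sq N) y * l2_norm (sq N) x \<le> n * 1 * 1"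
              by (rule mult_mono[OF mult_left_mono[OF xy(2) nonneg(2)] xy(1)])
                (use nonneg(2) in \<open>simp_all add: l2_norm_def\<close>)
          qed (use nonneg in \<open>simp_all add: l2_norm_def\<close>)
          also have "\<dots> = 400000 * real DIM('k) ^ 4 * (L * n)"
            using N by (simp add: power_divide)
          also have "\<dots> \<le> C * (L * n)"
            using nonneg by (intro mult_right_mono C) simp
          finally show ?thesis by (simp add: L_def n_def mult.assoc)
        qed
        then show "\<omega> \<in> ?E N"
          unfolding E_eq using \<omega>(1) by auto
      qed
    qed
    finally show ?thesis by simp
  qed
  have "(\<lambda>N. real DIM('k) ^ 2 / real N) \<longlonglongrightarrow> 0"
    by (rule lim_const_over_n)
  then have "(\<lambda>N. 1 - real DIM('k) ^ 2 / real N) \<longlonglongrightarrow> 1"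
    using tendsto_diff[OF tendsto_const[of 1]] by fastforce
  then show ?thesis
  proof (rule tendsto_sandwich[OF _ _ _ tendsto_const, rotated 2])
    show "\<forall>\<^sub>F N in sequentially. 1 - real DIM('k) ^ 2 / real N \<le> measure (M N) (?E N)"
      using bound by (auto simp: eventually_sequentially)
    show "\<forall>\<^sub>F N in sequentially. measure (M N) (?E N) \<le> 1"
      using bound by (auto simp: eventually_sequentially)
  qed
qed

text \<open>The mean of the error is at most DIM^2 / N \<le> N, because DIM \<le> 2 \<le> N; the
  factor N + H thus contributes at most 2 N in the mean.\<close>

lemma injective_norm_expectation:
  fixes g :: "nat \<Rightarrow> nat \<Rightarrow> nat \<Rightarrow> 'a \<Rightarrow> 'k::{real_normed_field,euclidean_space}"
  assumes M: "prob_space M" and iid: "iid_gaussian_pair M N 1 g g'" and N: "2 \<le> N"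
    and d: "DIM('k) \<le> 2" and C: "400000 * real DIM('k) ^ 4 \<le> C"
  shows "integrable M (\<lambda>\<omega>. injective_norm (sq N) (product_tensor N (\<lambda>i k l. g i k l \<omega>) (\<lambda>i k l. g' i k l \<omega>)))" (is "integrable M ?Q")
    and "(\<integral>\<omega>. injective_norm (sq N) (product_tensor N (\<lambda>i k l. g i k l \<omega>) (\<lambda>i k l. g' i k l \<omega>)) \<partial>M)
      \<le> C * ln (real N) powr (3/2) * real N"
proof -
  interpret prob_space M by fact
  \<comment> \<open>Sublevel sets of the supremum are uniform bounds on the form, hence
    measurable.\<close>
  have "{\<omega> \<in> space M. ?Q \<omega> \<le> c} \<in> sets M" for c
  proof -
    have "{\<omega> \<in> space M. ?Q \<omega> \<le> c} = {\<omega> \<in> space M. \<forall>t. (l2_norm (sq N) (fst t) \<le> 1 \<and> l2_norm (sq N) (fst (snd t)) \<le> 1 \<and> l2_norm (sq N) (snd (snd t)) \<le> 1) \<longrightarrow>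
        norm (triform N (sample g \<omega>) (sample g' \<omega>) (curry (fst t)) (curry (fst (snd t))) (curry (snd (snd t)))) \<le> c}"
      unfolding injective_norm_le_iff by auto
    then show ?thesis
      by (simp only: triform_bounded_measurable[OF iid])
  qed
  then have Q_meas: "?Q \<in> borel_measurable M"
    by (simp add: borel_measurable_iff_le)
  obtain H where H: "H \<in> borel_measurable M" "\<And>\<omega>. 0 \<le> H \<omega>"
    "(\<integral>\<^sup>+\<omega>. ennreal (H \<omega>) \<partial>M) \<le> ennreal (real DIM('k) ^ 2 / real N)"
    and le: "\<And>\<omega>. \<forall>R S T. norm (triform N (sample g \<omega>) (sample g' \<omega>) R S T) \<le>
      200000 * real DIM('k) ^ 4 * 1\<^sup>2 * ln (real N) powr (3 / 2) * (real N + H \<omega>) *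
      (hs_norm N R * hs_norm N S * hs_norm N T)"
    by (rule dominatedE[OF gaussian_tensor_bound[OF M iid zero_less_one N]], rule that)
  define K where "K = 200000 * real DIM('k) ^ 4 * ln (real N) powr (3 / 2)"
  have K0: "0 \<le> K" by (simp add: K_def)
  have Q_le: "?Q \<omega> \<le> K * (real N + H \<omega>)" for \<omega>
    unfolding injective_norm_le_iff
  proof (intro allI impI, elim conjE)
    fix R S T :: "nat \<times> nat \<Rightarrow> 'k"
    assume RST: "l2_norm (sq N) R \<le> 1" "l2_norm (sq N) S \<le> 1" "l2_norm (sq N) T \<le> 1"
    have "norm (triform N (sample g \<omega>) (sample g' \<omega>) (curry R) (curry S) (curry T)) \<le>
        K * (real N + H \<omega>) * (l2_norm (sq N) R * l2_norm (sq N) S * l2_norm (sq N) T)"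
      using le[rule_format, of \<omega> "curry R" "curry S" "curry T"] by (simp add: K_def)
    also have "\<dots> \<le> K * (real N + H \<omega>) * (1 * 1 * 1)"
    proof (rule mult_left_mono)
      show "l2_norm (sq N) R * l2_norm (sq N) S * l2_norm (sq N) T \<le> 1 * 1 * 1"
        by (rule mult_mono[OF mult_mono[OF RST(1,2)] RST(3)]) (simp_all add: l2_norm_def)
      show "0 \<le> K * (real N + H \<omega>)"
        using K0 H(2)[of \<omega>] by simp
    qed
    finally show "norm (triform N (sample g \<omega>) (sample g' \<omega>) (curry R) (curry S) (curry T)) \<le> K * (real N + H \<omega>)"
      by simp
  qed
  have Q0: "0 \<le> ?Q \<omega>" for \<omega>
  proof -
    have "norm (triform N (sample g \<omega>) (sample g' \<omega>) (curry (\<lambda>_. 0)) (curry (\<lambda>_. 0)) (curry (\<lambda>_. 0))) \<le> ?Q \<omega>"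
      using injective_norm_le_iff[of N "\<lambda>i k l. g i k l \<omega>" "\<lambda>i k l. g' i k l \<omega>" "?Q \<omega>"]
      by (auto simp: l2_norm_def L2_set_def)
    then show ?thesis
      using norm_ge_zero order_trans by blast
  qed
  have H_int: "integrable M H"
    using H by (intro integrableI_bounded) (auto intro: le_less_trans)
  then have KH_int: "integrable M (\<lambda>\<omega>. K * (real N + H \<omega>))"
    by simp
  show Q_int: "integrable M ?Q"
    using Q0 Q_le by (intro Bochner_Integration.integrable_bound[OF KH_int Q_meas] AE_I2) (auto intro: order_trans[OF _ abs_ge_self])
  have "ennreal (\<integral>\<omega>. H \<omega> \<partial>M) \<le> ennreal (real DIM('k) ^ 2 / real N)"
    using nn_integral_eq_integral[OF H_int] H(2,3) by simp
  then have "(\<integral>\<omega>. H \<omega> \<partial>M) \<le> real DIM('k) ^ 2 / real N"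
    by (subst (asm) ennreal_le_iff) auto
  also have "\<dots> \<le> real N"
  proof (rule mult_imp_div_pos_le)
    have "real DIM('k) \<le> real N" using d N by simp
    then show "real DIM('k) ^ 2 \<le> real N * real N"
      unfolding power2_eq_square by (intro mult_mono) simp_all
  qed (use N in simp)
  finally have H_le: "(\<integral>\<omega>. H \<omega> \<partial>M) \<le> real N" .
  have "(\<integral>\<omega>. ?Q \<omega> \<partial>M) \<le> (\<integral>\<omega>. K * (real N + H \<omega>) \<partial>M)"
    by (rule integral_mono[OF Q_int KH_int Q_le])
  also have "\<dots> = K * (real N + (\<integral>\<omega>. H \<omega> \<partial>M))"
    using H_int by (simp add: prob_space)
  also have "\<dots> \<le> K * (real N + real N)"
    using H_le K0 by (intro mult_left_mono) simp_all
  also have "\<dots> = (400000 * real DIM('k) ^ 4) * (ln (real N) powr (3/2) * real N)"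
    by (simp add: K_def)
  also have "\<dots> \<le> C * (ln (real N) powr (3/2) * real N)"
    by (intro mult_right_mono C) simp
  finally show "(\<integral>\<omega>. ?Q \<omega> \<partial>M) \<le> C * ln (real N) powr (3/2) * real N"
    by (simp only: mult.assoc)
qed

theorem theorem1p1:
  shows
   "(\<exists>C::real.
      (\<forall>(M :: nat \<Rightarrow> 'a measure) (Y :: nat \<Rightarrow> nat \<Rightarrow> nat \<Rightarrow> nat \<Rightarrow> 'a \<Rightarrow> real) Y'.
        (\<forall>N\<ge>2. prob_space (M N) \<and> iid_gaussian_pair (M N) N (1 / sqrt (real N)) (Y N) (Y' N)) \<longrightarrow>
        (\<lambda>N. measure (M N) {\<omega> \<in> space (M N). \<forall>a :: nat \<Rightarrow> nat \<Rightarrow> real.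
            tensor_sum_norm N a (\<lambda>i k l. Y N i k l \<omega>) (\<lambda>i k l. Y' N i k l \<omega>)
              \<le> C * ln (real N) powr (3/2) * sqrt (\<Sum>i=1..N. \<Sum>i'=1..N. (norm (a i i'))\<^sup>2)})
          \<longlonglongrightarrow> 1) \<and>
      (\<forall>(M :: nat \<Rightarrow> 'a measure) (Y :: nat \<Rightarrow> nat \<Rightarrow> nat \<Rightarrow> nat \<Rightarrow> 'a \<Rightarrow> complex) Y'.
        (\<forall>N\<ge>2. prob_space (M N) \<and> iid_gaussian_pair (M N) N (1 / sqrt (real N)) (Y N) (Y' N)) \<longrightarrow>
        (\<lambda>N. measure (M N) {\<omega> \<in> space (M N). \<forall>a :: nat \<Rightarrow> nat \<Rightarrow> complex.
            tensor_sum_norm N a (\<lambda>i k l. Y N i k l \<omega>) (\<lambda>i k l. Y' N i k l \<omega>)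
              \<le> C * ln (real N) powr (3/2) * sqrt (\<Sum>i=1..N. \<Sum>i'=1..N. (norm (a i i'))\<^sup>2)})
          \<longlonglongrightarrow> 1))
    \<and>
    (\<exists>C::real.
      (\<forall>N\<ge>2. \<forall>(M :: 'a measure) (g :: nat \<Rightarrow> nat \<Rightarrow> nat \<Rightarrow> 'a \<Rightarrow> real) g'.
        prob_space M \<and> iid_gaussian_pair M N 1 g g' \<longrightarrow>
        (let \<tau> = (\<lambda>\<omega>. product_tensor N (\<lambda>i k l. g i k l \<omega>) (\<lambda>i k l. g' i k l \<omega>)) in
          integrable M (\<lambda>\<omega>. injective_norm (sq N) (\<tau> \<omega>)) \<and>
          (\<integral>\<omega>. injective_norm (sq N) (\<tau> \<omega>) \<partial>M) \<le> C * ln (real N) powr (3/2) * real N)) \<and>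
      (\<forall>N\<ge>2. \<forall>(M :: 'a measure) (g :: nat \<Rightarrow> nat \<Rightarrow> nat \<Rightarrow> 'a \<Rightarrow> complex) g'.
        prob_space M \<and> iid_gaussian_pair M N 1 g g' \<longrightarrow>
        (let \<tau> = (\<lambda>\<omega>. product_tensor N (\<lambda>i k l. g i k l \<omega>) (\<lambda>i k l. g' i k l \<omega>)) in
          integrable M (\<lambda>\<omega>. injective_norm (sq N) (\<tau> \<omega>)) \<and>
          (\<integral>\<omega>. injective_norm (sq N) (\<tau> \<omega>) \<partial>M) \<le> C * ln (real N) powr (3/2) * real N)))"
  \<comment> \<open>One constant serves both fields: 6400000 = 400000 * 2^4, the real dimension of
    the complex numbers being 2.\<close>
  unfolding Let_def
  by (intro conjI exI[of _ "6400000 :: real"] allI impI; (elim conjE)?;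
      (erule tensor_sum_norm_probability
        | rule injective_norm_expectation(1)[OF _ _ _ _ order_refl]
        | rule injective_norm_expectation(2)); simp)

end
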